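(* Let $m>1$ and let $(\mathcal{M},\mathbf{c},K)$ be a $(2m+2)$-dimensional conformal optical geometry with twisting non-shearing congruence of null geodesics $\mathcal{K}$, whose Weyl tensor satisfies $W(k,w,k,\cdot)=0$ for any sections $k$ of $K$, $w$ of $K^\perp$, and whose conformal class contains an Einstein metric $\widehat g$ of Ricci scalar $(2m+2)\Lambda$, written locally in the normal form $\widehat g=\sec^2\phi\,g$, $g=2\kappa\odot\lambda+h$ described in the context. Then the vector field $v=g^{-1}(\alpha,\cdot)$, where $\alpha:=\lambda+\frac12\lambda_0\kappa$, is a Killing field for the metric $g$. Further, $v$ descends to the infinitesimal transverse symmetry $\underline e_0$ of the almost CR--Einstein structure $(\underline H,\underline J,\underline\theta^0)$ on the (local) leaf space $\underline{\mathcal M}$ of $\mathcal{K}$. This conformal Killing field is null if and only if $\widehat g$ is a Ricci-flat Fefferman--Einstein metric.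
   Context: Optical geometry. $(\mathcal{M},\mathbf{c},K)$ is an oriented, time-oriented Lorentzian conformal manifold with real null line distribution $K$; with $k$ a nowhere vanishing section of $K$ and $\kappa=g(k,\cdot)$ for a metric $g$ in $\mathbf{c}$, the congruence of integral curves of $K$ is geodesic if $\mathcal{L}_k\kappa$ vanishes on $K^\perp$, non-shearing if $\mathcal{L}_kg\propto g$ on $K^\perp$, and twisting if $\kappa\wedge d\kappa\ne0$. Normal form. Under the stated hypotheses, locally $\mathcal{M}=(-\frac\pi2,\frac\pi2)\times\underline{\mathcal{M}}$ with coordinate $\phi$ on the first factor and projection $\varpi$ onto the leaf space, $\underline{\mathcal{M}}$ carries an almost CR--Einstein structure $(\underline H,\underline J,\underline\theta^0)$ of positive definite signature with Levi form $\underline h$ and constant $\underline\Lambda$, and $\widehat g=\sec^2\phi\,g$, $g=2\kappa\odot\lambda+h$, $\kappa=2\varpi^*\underline\theta^0$, $h=\varpi^*\underline h$, $\lambda=d\phi+\lambda_0\varpi^*\underline\theta^0$, $$\lambda_0=\frac{\underline\Lambda}{2m+2}+\Bigl(\frac{\Lambda}{2m+1}-\frac{\underline\Lambda}{2m+2}\Bigr)\Bigl(\sum_{j=0}^m a_j\cos^{2j}\phi-2a_m\cos^{2m+2}\phi\Bigr)+\underline c\cos^{2m+1}\phi\sin\phi,$$ with $\underline c$ constant, $a_0=1$, $a_j=\frac{2m-2j+4}{2m-2j+1}a_{j-1}$ for $j=1,\ldots,m$; for $1$-forms, $\beta\odot\gamma=\frac12(\beta\otimes\gamma+\gamma\otimes\beta)$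 and $\beta\wedge\gamma=\frac12(\beta\otimes\gamma-\gamma\otimes\beta)$. CR notions. $(\underline H,\underline J)$ is a contact distribution with bundle complex structure with $[\underline H^{(1,0)},\underline H^{(1,0)}]\subset{}^{\mathbb C}\underline H$. For a contact form $\underline\theta^0$ with Reeb vector field $\underline e_0$ ($\underline\theta^0(\underline e_0)=1$, $d\underline\theta^0(\underline e_0,\cdot)=0$) and adapted coframe, $d\underline\theta^0=\mathrm i\underline h_{\alpha\bar\beta}\underline\theta^\alpha\wedge\overline{\underline\theta}{}^{\bar\beta}$, $\underline h=2\underline h_{\alpha\bar\beta}\underline\theta^\alpha\odot\overline{\underline\theta}{}^{\bar\beta}$; the Webster--Tanaka connection $\underline\nabla$ preserves $\underline\theta^0,d\underline\theta^0,\underline J$ and satisfies $d\underline\theta^\alpha=\underline\theta^\beta\wedge\underline\Gamma_\beta{}^\alpha+\underline A^\alpha{}_{\bar\beta}\underline\theta^0\wedge\overline{\underline\theta}{}^{\bar\beta}-\frac12\underline{\mathsf N}_{\bar\beta\bar\gamma}{}^\alpha\overline{\underline\theta}{}^{\bar\beta}\wedge\overline{\underline\theta}{}^{\bar\gamma}$, with $\underline A_{\alpha\beta}$ symmetric, $\underline{\mathsf N}_{\alpha\beta\gamma}=\underline{\mathsf N}_{[\alpha\beta]\gamma}$, $\underline{\mathsf N}_{[\alpha\beta\gamma]}=0$; $\underline{\mathrm{Ric}}_\gamma{}^\delta=\underline h^{\alpha\bar\beta}\underline R_{\alpha\bar\beta\gamma}{}^\delta$ is the trace of the curvature operator $\underline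 R(\underline e_\alpha,\overline{\underline e}_{\bar\beta})$ on $\underline H^{(1,0)}$, $\underline{\mathrm{Sc}}=\underline{\mathrm{Ric}}_\gamma{}^\gamma$. Almost CR--Einstein means $\underline A_{\alpha\beta}=0$, $\underline\nabla^\gamma\underline{\mathsf N}_{\gamma(\alpha\beta)}=0$, $\underline{\mathrm{Ric}}_\alpha{}^\beta-\underline{\mathsf N}_{\alpha\delta\gamma}\underline{\mathsf N}^{\beta\delta\gamma}=\underline\Lambda\delta_\alpha^\beta$ with $\underline\Lambda$ constant. An infinitesimal symmetry is a vector field preserving $\underline H$ and $\underline J$; it is transverse if it is the Reeb vector field of some contact form. In the claim, $\underline e_0$ is the Reeb vector field of $\underline\theta^0$. Fefferman--Einstein metrics. The (gauged) Fefferman conformal structure of a partially integrable contact almost CR manifold is the Lorentzian conformal class on a circle bundle over it given locally, with fibre coordinate $\phi$, by $4\underline\theta^0\odot\bigl(d\phi+\frac1{m+2}(\mathrm i\underline\Gamma_\alpha{}^\alpha-\frac1{2m+2}\underline{\mathrm{Sc}}\,\underline\theta^0)+\xi\bigr)+\underline h$, with $\underline\theta^0$ a contact form, $\underline\Gamma_\alpha{}^\beta$ its Webster--Tanaka connection form in a unitary coframe, and $\xi$ a real $1$-form on the almost CR manifold (the gauge field). A Fefferman--Einstein metric is an Einstein metric in such a conformal class. In the normal form above, $\widehat g$ is a Fefferman--Einstein metric exactly when $\lambda_0$ is constant, i.e. $(2m+2)\Lambda=(2m+1)\underline\Lambda$ and $\underline c=0$.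
   Formalization: With the stated conventions g(e_0,·)=2α, so v=½e_0 and the literal claim that v descends to e_0 is off by a factor 1/2; the formal theorem says v descends to ½e_0 and that e_0 is the infinitesimal transverse symmetry. *)

theory Defs
  imports "HOL-Analysis.Analysis"
begin

section \<open>Calculus on open subsets of a Euclidean space\<close>

text \<open>
  Vector fields on an open set are functions \<open>'e \<Rightarrow> 'e\<close>, covariant tensor fields are functions
  of a point followed by the vector arguments.  In the coordinate formulas below, the vector
  arguments \<open>X, Y, Z\<close> are constant vector fields.
\<close>

abbreviation dird :: "('a::real_normed_vector \<Rightarrow> 'b::real_normed_vector) \<Rightarrow> 'a \<Rightarrow> 'a \<Rightarrow> 'b"
  where "dird f x X \<equiv> frechet_derivative f (at x) X"

text \<open>Used for open \<open>S\<close> and finite-dimensional \<open>'a\<close>, where it is the usual notion of class $C^k$.\<close>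

primrec Ck_on :: "nat \<Rightarrow> 'a::real_normed_vector set \<Rightarrow> ('a \<Rightarrow> 'b::real_normed_vector) \<Rightarrow> bool" where
  "Ck_on 0 S f \<longleftrightarrow> continuous_on S f"
| "Ck_on (Suc k) S f \<longleftrightarrow>
     (\<forall>x\<in>S. f differentiable (at x)) \<and> (\<forall>X. Ck_on k S (\<lambda>x. dird f x X))"

definition smooth_on :: "'a::real_normed_vector set \<Rightarrow> ('a \<Rightarrow> 'b::real_normed_vector) \<Rightarrow> bool"
  where "smooth_on S f \<longleftrightarrow> (\<forall>k. Ck_on k S f)"

definition one_form_on ::
    "'a::real_normed_vector set \<Rightarrow> ('a \<Rightarrow> 'a \<Rightarrow> 'b::real_normed_vector) \<Rightarrow> bool" where
  "one_form_on S \<omega> \<longleftrightarrow>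
     (\<forall>x\<in>S. linear (\<omega> x)) \<and> (\<forall>X. smooth_on S (\<lambda>x. \<omega> x X))"

definition lie_bracket :: "('a::real_normed_vector \<Rightarrow> 'a) \<Rightarrow> ('a \<Rightarrow> 'a) \<Rightarrow> 'a \<Rightarrow> 'a"
  where "lie_bracket X Y x = dird Y x (X x) - dird X x (Y x)"

definition odot :: "('v \<Rightarrow> 'b::real_normed_field) \<Rightarrow> ('v \<Rightarrow> 'b) \<Rightarrow> 'v \<Rightarrow> 'v \<Rightarrow> 'b"
  where "odot \<beta> \<gamma> X Y = (\<beta> X * \<gamma> Y + \<gamma> X * \<beta> Y) / 2"

definition wedge :: "('v \<Rightarrow> 'b::real_normed_field) \<Rightarrow> ('v \<Rightarrow> 'b) \<Rightarrow> 'v \<Rightarrow> 'v \<Rightarrow> 'b"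
  where "wedge \<beta> \<gamma> X Y = (\<beta> X * \<gamma> Y - \<gamma> X * \<beta> Y) / 2"

text \<open>
  The factor 1/2 goes with the factor 1/2 in \<open>wedge\<close>, so that d(f dg) is the wedge product
  of df and dg.
\<close>

definition extd :: "('a::real_normed_vector \<Rightarrow> 'a \<Rightarrow> 'b::real_normed_field) \<Rightarrow> 'a \<Rightarrow> 'a \<Rightarrow> 'a \<Rightarrow> 'b"
  where "extd \<omega> x X Y = (dird (\<lambda>y. \<omega> y Y) x X - dird (\<lambda>y. \<omega> y X) x Y) / 2"

text \<open>Wedge product of a 1-form with a 2-form.\<close>

definition wedge12 ::
    "('v \<Rightarrow> real) \<Rightarrow> ('v \<Rightarrow> 'v \<Rightarrow> real) \<Rightarrow> 'v \<Rightarrow> 'v \<Rightarrow> 'v \<Rightarrow> real" where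
  "wedge12 \<beta> \<omega> X Y Z = (\<beta> X * \<omega> Y Z + \<beta> Y * \<omega> Z X + \<beta> Z * \<omega> X Y) / 3"

definition lie_one_form ::
    "('a::real_normed_vector \<Rightarrow> 'a) \<Rightarrow> ('a \<Rightarrow> 'a \<Rightarrow> real) \<Rightarrow> 'a \<Rightarrow> 'a \<Rightarrow> real" where
  "lie_one_form v \<omega> x X = dird (\<lambda>y. \<omega> y X) x (v x) + \<omega> x (dird v x X)"

definition lie_metric ::
    "('a::real_normed_vector \<Rightarrow> 'a) \<Rightarrow> ('a \<Rightarrow> 'a \<Rightarrow> 'a \<Rightarrow> real) \<Rightarrow> 'a \<Rightarrow> 'a \<Rightarrow> 'a \<Rightarrow> real" where
  "lie_metric v g x X Y =
     dird (\<lambda>y. g y X Y) x (v x) + g x (dird v x X) Y + g x X (dird v x Y)"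

definition trace_end :: "('a::euclidean_space \<Rightarrow> 'a) \<Rightarrow> real"
  where "trace_end f = (\<Sum>b\<in>Basis. f b \<bullet> b)"

definition det_end :: "('a::euclidean_space \<Rightarrow> 'a) \<Rightarrow> real"
  where "det_end f = (\<Sum>p | p permutes Basis. of_int (sign p) * (\<Prod>b\<in>Basis. f b \<bullet> p b))"


section \<open>Pseudo-Riemannian metrics on open subsets of a Euclidean space\<close>

type_synonym 'e metric = "'e \<Rightarrow> 'e \<Rightarrow> 'e \<Rightarrow> real"

definition lorentzian_on :: "'e::euclidean_space set \<Rightarrow> 'e metric \<Rightarrow> bool" where
  "lorentzian_on S g \<longleftrightarrow>
     (\<forall>X Y. smooth_on S (\<lambda>x. g x X Y)) \<and>
     (\<forall>x\<in>S. (\<forall>X. linear (g x X)) \<and> (\<forall>X Y. g x X Y = g x Y X) \<and>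
        (\<exists>T. g x T T < 0 \<and> (\<forall>X. g x T X = 0 \<and> X \<noteq> 0 \<longrightarrow> g x X X > 0)))"

text \<open>The vector obtained by contracting the inverse metric at \<open>x\<close> with the covector \<open>\<alpha>\<close>.\<close>

definition sharp :: "'e::euclidean_space metric \<Rightarrow> 'e \<Rightarrow> ('e \<Rightarrow> real) \<Rightarrow> 'e"
  where "sharp g x \<alpha> = (THE v. \<forall>Z. g x v Z = \<alpha> Z)"

definition christoffel :: "'e::euclidean_space metric \<Rightarrow> 'e \<Rightarrow> 'e \<Rightarrow> 'e \<Rightarrow> 'e" where
  "christoffel g x X Y = sharp g x (\<lambda>Z.
     (dird (\<lambda>y. g y Y Z) x X + dird (\<lambda>y. g y X Z) x Y - dird (\<lambda>y. g y X Y) x Z) / 2)"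

text \<open>\<open>riemann g x X Y Z\<close> is R(X,Y)Z for the Levi-Civita connection.\<close>

definition riemann :: "'e::euclidean_space metric \<Rightarrow> 'e \<Rightarrow> 'e \<Rightarrow> 'e \<Rightarrow> 'e \<Rightarrow> 'e" where
  "riemann g x X Y Z =
     dird (\<lambda>y. christoffel g y Y Z) x X - dird (\<lambda>y. christoffel g y X Z) x Y
     + christoffel g x X (christoffel g x Y Z) - christoffel g x Y (christoffel g x X Z)"

definition ricci :: "'e::euclidean_space metric \<Rightarrow> 'e \<Rightarrow> 'e \<Rightarrow> 'e \<Rightarrow> real"
  where "ricci g x Y Z = trace_end (\<lambda>X. riemann g x X Y Z)"

definition ricci_scalar :: "'e::euclidean_space metric \<Rightarrow> 'e \<Rightarrow> real"
  where "ricci_scalar g x = trace_end (\<lambda>Y. sharp g x (ricci g x Y))"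

definition schouten :: "'e::euclidean_space metric \<Rightarrow> 'e \<Rightarrow> 'e \<Rightarrow> 'e \<Rightarrow> real" where
  "schouten g x X Y =
     (ricci g x X Y - ricci_scalar g x / (2 * (real DIM('e) - 1)) * g x X Y) / (real DIM('e) - 2)"

definition weyl :: "'e::euclidean_space metric \<Rightarrow> 'e \<Rightarrow> 'e \<Rightarrow> 'e \<Rightarrow> 'e \<Rightarrow> 'e \<Rightarrow> real" where
  "weyl g x X Y Z V =
     g x (riemann g x X Y Z) V
     - (schouten g x Y Z * g x X V - schouten g x X Z * g x Y V
        + g x Y Z * schouten g x X V - g x X Z * schouten g x Y V)"

definition einstein_on :: "'e::euclidean_space set \<Rightarrow> 'e metric \<Rightarrow> bool" where
  "einstein_on S g \<longleftrightarrow> (\<exists>c. \<forall>x\<in>S. \<forall>X Y. ricci g x X Y = c * g x X Y)"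

definition ricci_flat_on :: "'e::euclidean_space set \<Rightarrow> 'e metric \<Rightarrow> bool" where
  "ricci_flat_on S g \<longleftrightarrow> (\<forall>x\<in>S. \<forall>X Y. ricci g x X Y = 0)"

definition killing_on :: "'e::euclidean_space set \<Rightarrow> 'e metric \<Rightarrow> ('e \<Rightarrow> 'e) \<Rightarrow> bool" where
  "killing_on S g v \<longleftrightarrow> smooth_on S v \<and> (\<forall>x\<in>S. \<forall>X Y. lie_metric v g x X Y = 0)"

definition conformal_killing_on :: "'e::euclidean_space set \<Rightarrow> 'e metric \<Rightarrow> ('e \<Rightarrow> 'e) \<Rightarrow> bool" where
  "conformal_killing_on S g v \<longleftrightarrow>
     smooth_on S v \<and> (\<forall>x\<in>S. \<exists>\<rho>. \<forall>X Y. lie_metric v g x X Y = \<rho> * g x X Y)"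


section \<open>Manifolds and optical geometries\<close>

text \<open>
  A manifold is a second countable Hausdorff type \<open>'p\<close> with an atlas of charts into \<open>'e\<close>; a chart
  is a pair of its domain and its coordinate map.  A tensor field on the manifold is the family of
  its coordinate expressions: a metric assigns to every chart a metric on the chart's image, and
  the expressions in two charts are related by the transition map.
\<close>

type_synonym ('p, 'e) chart = "'p set \<times> ('p \<Rightarrow> 'e)"

definition img :: "('p, 'e) chart \<Rightarrow> 'e set"
  where "img c = snd c ` fst c"

definition transition :: "('p, 'e) chart \<Rightarrow> ('p, 'e) chart \<Rightarrow> 'e \<Rightarrow> 'e"
  where "transition c d = snd d \<circ> inv_into (fst c) (snd c)"

abbreviation jac :: "('p, 'e::euclidean_space) chart \<Rightarrow> ('p, 'e) chart \<Rightarrow> 'p \<Rightarrow> 'e \<Rightarrow> 'e"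
  where "jac c d p \<equiv> frechet_derivative (transition c d) (at (snd c p))"

definition smooth_manifold ::
    "('p::{t2_space, second_countable_topology}, 'e::euclidean_space) chart set \<Rightarrow> bool" where
  "smooth_manifold A \<longleftrightarrow>
     (\<Union>c\<in>A. fst c) = UNIV \<and>
     (\<forall>c\<in>A. open (fst c) \<and> open (img c) \<and> (\<exists>y. homeomorphism (fst c) (img c) (snd c) y)) \<and>
     (\<forall>c\<in>A. \<forall>d\<in>A. smooth_on (snd c ` (fst c \<inter> fst d)) (transition c d))"

definition oriented_atlas :: "('p, 'e::euclidean_space) chart set \<Rightarrow> bool" where
  "oriented_atlas A \<longleftrightarrow> (\<forall>c\<in>A. \<forall>d\<in>A. \<forall>p \<in> fst c \<inter> fst d. det_end (jac c d p) > 0)"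

definition lorentzian_metric ::
    "('p, 'e::euclidean_space) chart set \<Rightarrow> (('p, 'e) chart \<Rightarrow> 'e metric) \<Rightarrow> bool" where
  "lorentzian_metric A g \<longleftrightarrow>
     (\<forall>c\<in>A. lorentzian_on (img c) (g c)) \<and>
     (\<forall>c\<in>A. \<forall>d\<in>A. \<forall>p \<in> fst c \<inter> fst d. \<forall>X Y.
        g c (snd c p) X Y = g d (snd d p) (jac c d p X) (jac c d p Y))"

definition conformal_metrics ::
    "('p, 'e::euclidean_space) chart set \<Rightarrow>
     (('p, 'e) chart \<Rightarrow> 'e metric) \<Rightarrow> (('p, 'e) chart \<Rightarrow> 'e metric) \<Rightarrow> bool" where
  "conformal_metrics A g g' \<longleftrightarrow>
     (\<exists>\<Omega> :: 'p \<Rightarrow> real. \<forall>c\<in>A.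
        smooth_on (img c) (\<Omega> \<circ> inv_into (fst c) (snd c)) \<and>
        (\<forall>p\<in>fst c. \<Omega> p > 0 \<and> (\<forall>X Y. g' c (snd c p) X Y = \<Omega> p * g c (snd c p) X Y)))"

definition lorentzian_conformal_class ::
    "('p, 'e::euclidean_space) chart set \<Rightarrow> (('p, 'e) chart \<Rightarrow> 'e metric) set \<Rightarrow> bool" where
  "lorentzian_conformal_class A C \<longleftrightarrow>
     C \<noteq> {} \<and> (\<forall>g\<in>C. lorentzian_metric A g) \<and>
     (\<forall>g\<in>C. \<forall>g'. lorentzian_metric A g' \<longrightarrow> (g' \<in> C \<longleftrightarrow> conformal_metrics A g g'))"

definition time_oriented ::
    "('p, 'e::euclidean_space) chart set \<Rightarrow> (('p, 'e) chart \<Rightarrow> 'e metric) set \<Rightarrow> bool" where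
  "time_oriented A C \<longleftrightarrow>
     (\<exists>T :: ('p, 'e) chart \<Rightarrow> 'e \<Rightarrow> 'e.
        (\<forall>c\<in>A. smooth_on (img c) (T c)) \<and>
        (\<forall>c\<in>A. \<forall>d\<in>A. \<forall>p \<in> fst c \<inter> fst d. T d (snd d p) = jac c d p (T c (snd c p))) \<and>
        (\<forall>g\<in>C. \<forall>c\<in>A. \<forall>x\<in>img c. g c x (T c x) (T c x) < 0))"

text \<open>
  A line distribution on the manifold is given in every chart by its fibres, as subspaces of \<open>'e\<close>.
  \<open>section_of\<close> is about nowhere vanishing local sections \<open>k\<close> over an open subset \<open>V\<close> of the
  image of a chart.
\<close>

definition section_of ::
    "('p, 'e::euclidean_space) chart \<Rightarrow> (('p, 'e) chart \<Rightarrow> 'e \<Rightarrow> 'e set) \<Rightarrow> 'e set \<Rightarrow> ('e \<Rightarrow> 'e) \<Rightarrow> bool"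
  where
  "section_of c K V k \<longleftrightarrow>
     open V \<and> V \<subseteq> img c \<and> smooth_on V k \<and> (\<forall>x\<in>V. k x \<in> K c x \<and> k x \<noteq> 0)"

definition null_line_distribution ::
    "('p, 'e::euclidean_space) chart set \<Rightarrow> (('p, 'e) chart \<Rightarrow> 'e metric) set \<Rightarrow>
     (('p, 'e) chart \<Rightarrow> 'e \<Rightarrow> 'e set) \<Rightarrow> bool" where
  "null_line_distribution A C K \<longleftrightarrow>
     (\<forall>c\<in>A. \<forall>x\<in>img c. \<exists>V k. x \<in> V \<and> section_of c K V k \<and> (\<forall>y\<in>V. K c y = span {k y})) \<and>
     (\<forall>c\<in>A. \<forall>d\<in>A. \<forall>p \<in> fst c \<inter> fst d. K d (snd d p) = jac c d p ` K c (snd c p)) \<and>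
     (\<forall>g\<in>C. \<forall>c\<in>A. \<forall>x\<in>img c. \<forall>k\<in>K c x. g c x k k = 0)"

definition perp :: "'e::euclidean_space metric \<Rightarrow> 'e \<Rightarrow> 'e set \<Rightarrow> 'e set"
  where "perp g x L = {w. \<forall>k\<in>L. g x k w = 0}"

definition geodesic_congruence ::
    "('p, 'e::euclidean_space) chart set \<Rightarrow> (('p, 'e) chart \<Rightarrow> 'e metric) set \<Rightarrow>
     (('p, 'e) chart \<Rightarrow> 'e \<Rightarrow> 'e set) \<Rightarrow> bool" where
  "geodesic_congruence A C K \<longleftrightarrow>
     (\<forall>g\<in>C. \<forall>c\<in>A. \<forall>V k. section_of c K V k \<longrightarrow>
        (\<forall>x\<in>V. \<forall>w\<in>perp (g c) x (K c x). lie_one_form k (\<lambda>y. g c y (k y)) x w = 0))"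

definition nonshearing_congruence ::
    "('p, 'e::euclidean_space) chart set \<Rightarrow> (('p, 'e) chart \<Rightarrow> 'e metric) set \<Rightarrow>
     (('p, 'e) chart \<Rightarrow> 'e \<Rightarrow> 'e set) \<Rightarrow> bool" where
  "nonshearing_congruence A C K \<longleftrightarrow>
     (\<forall>g\<in>C. \<forall>c\<in>A. \<forall>V k. section_of c K V k \<longrightarrow>
        (\<forall>x\<in>V. \<exists>\<rho>. \<forall>w\<in>perp (g c) x (K c x). \<forall>w'\<in>perp (g c) x (K c x).
           lie_metric k (g c) x w w' = \<rho> * g c x w w'))"

definition twisting_congruence ::
    "('p, 'e::euclidean_space) chart set \<Rightarrow> (('p, 'e) chart \<Rightarrow> 'e metric) set \<Rightarrow>
     (('p, 'e) chart \<Rightarrow> 'e \<Rightarrow> 'e set) \<Rightarrow> bool" where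
  "twisting_congruence A C K \<longleftrightarrow>
     (\<forall>g\<in>C. \<forall>c\<in>A. \<forall>V k. section_of c K V k \<longrightarrow>
        (\<forall>x\<in>V. \<exists>X Y Z. wedge12 (g c x (k x)) (extd (\<lambda>y. g c y (k y)) x) X Y Z \<noteq> 0))"

text \<open>W(k,w,k,-) = 0 for \<open>k\<close> in K and \<open>w\<close> orthogonal to K.\<close>

definition weyl_condition ::
    "('p, 'e::euclidean_space) chart set \<Rightarrow> (('p, 'e) chart \<Rightarrow> 'e metric) set \<Rightarrow>
     (('p, 'e) chart \<Rightarrow> 'e \<Rightarrow> 'e set) \<Rightarrow> bool" where
  "weyl_condition A C K \<longleftrightarrow>
     (\<forall>g\<in>C. \<forall>c\<in>A. \<forall>x\<in>img c. \<forall>k\<in>K c x. \<forall>w\<in>perp (g c) x (K c x). \<forall>Z.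
        weyl (g c) x k w k Z = 0)"

definition einstein_metric ::
    "('p, 'e::euclidean_space) chart set \<Rightarrow> (('p, 'e) chart \<Rightarrow> 'e metric) \<Rightarrow> bool" where
  "einstein_metric A g \<longleftrightarrow> (\<exists>r. \<forall>c\<in>A. \<forall>x\<in>img c. \<forall>X Y. ricci (g c) x X Y = r * g c x X Y)"


section \<open>Contact almost CR structures\<close>

text \<open>
  A distribution on an open set \<open>U\<close> is given by its fibres \<open>H x\<close>; the complex structure
  \<open>J x\<close> is only relevant on \<open>H x\<close>.
\<close>

definition local_section :: "'a::euclidean_space set \<Rightarrow> ('a \<Rightarrow> 'a set) \<Rightarrow> 'a set \<Rightarrow> ('a \<Rightarrow> 'a) \<Rightarrow> bool"
  where
  "local_section U H V X \<longleftrightarrow> open V \<and> V \<subseteq> U \<and> smooth_on V X \<and> (\<forall>x\<in>V. X x \<in> H x)"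

definition contact_form ::
    "'a::euclidean_space set \<Rightarrow> ('a \<Rightarrow> 'a set) \<Rightarrow> ('a \<Rightarrow> 'a \<Rightarrow> real) \<Rightarrow> bool" where
  "contact_form U H \<theta> \<longleftrightarrow>
     one_form_on U \<theta> \<and>
     (\<forall>x\<in>U. H x = {X. \<theta> x X = 0} \<and> H x \<noteq> UNIV \<and>
        (\<forall>X\<in>H x. (\<forall>Y\<in>H x. extd \<theta> x X Y = 0) \<longrightarrow> X = 0))"

definition reeb :: "('a::euclidean_space \<Rightarrow> 'a \<Rightarrow> real) \<Rightarrow> 'a \<Rightarrow> 'a"
  where "reeb \<theta> x = (THE e. \<theta> x e = 1 \<and> (\<forall>Y. extd \<theta> x e Y = 0))"

definition bundle_complex_structure ::
    "'a::euclidean_space set \<Rightarrow> ('a \<Rightarrow> 'a set) \<Rightarrow> ('a \<Rightarrow> 'a \<Rightarrow> 'a) \<Rightarrow> bool" where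
  "bundle_complex_structure U H J \<longleftrightarrow>
     (\<forall>x\<in>U. \<forall>X\<in>H x. J x X \<in> H x \<and> J x (J x X) = - X) \<and>
     (\<forall>x\<in>U. \<forall>X\<in>H x. \<forall>Y\<in>H x. \<forall>a b. J x (a *\<^sub>R X + b *\<^sub>R Y) = a *\<^sub>R J x X + b *\<^sub>R J x Y) \<and>
     (\<forall>V X. local_section U H V X \<longrightarrow> smooth_on V (\<lambda>x. J x (X x)))"

text \<open>
  The sections of $H^{(1,0)}$ are $X - \mathrm i JX$ with \<open>X\<close> a section of \<open>H\<close>; the two conditions
  on brackets are the real and the imaginary part of
  $[X - \mathrm i JX, Y - \mathrm i JY] \in {}^{\mathbb C}H$.
\<close>

definition partially_integrable ::
    "'a::euclidean_space set \<Rightarrow> ('a \<Rightarrow> 'a set) \<Rightarrow> ('a \<Rightarrow> 'a \<Rightarrow> 'a) \<Rightarrow> bool" where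
  "partially_integrable U H J \<longleftrightarrow>
     (\<forall>V X Y. local_section U H V X \<and> local_section U H V Y \<longrightarrow>
        (let JX = (\<lambda>x. J x (X x)); JY = (\<lambda>x. J x (Y x)) in
         \<forall>x\<in>V. lie_bracket X Y x - lie_bracket JX JY x \<in> H x \<and>
               lie_bracket JX Y x + lie_bracket X JY x \<in> H x))"

definition contact_almost_CR ::
    "nat \<Rightarrow> 'a::euclidean_space set \<Rightarrow> ('a \<Rightarrow> 'a set) \<Rightarrow> ('a \<Rightarrow> 'a \<Rightarrow> 'a) \<Rightarrow> bool" where
  "contact_almost_CR m U H J \<longleftrightarrow>
     DIM('a) = 2 * m + 1 \<and> open U \<and>
     (\<forall>x\<in>U. \<exists>V \<theta>. x \<in> V \<and> open V \<and> V \<subseteq> U \<and> contact_form V H \<theta>) \<and>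
     bundle_complex_structure U H J \<and> partially_integrable U H J"

definition infinitesimal_symmetry ::
    "'a::euclidean_space set \<Rightarrow> ('a \<Rightarrow> 'a set) \<Rightarrow> ('a \<Rightarrow> 'a \<Rightarrow> 'a) \<Rightarrow> ('a \<Rightarrow> 'a) \<Rightarrow> bool" where
  "infinitesimal_symmetry U H J e \<longleftrightarrow>
     smooth_on U e \<and>
     (\<forall>V X. local_section U H V X \<longrightarrow>
        (\<forall>x\<in>V. lie_bracket e X x \<in> H x \<and>
               lie_bracket e (\<lambda>y. J y (X y)) x = J x (lie_bracket e X x)))"

definition transverse_infinitesimal_symmetry ::
    "'a::euclidean_space set \<Rightarrow> ('a \<Rightarrow> 'a set) \<Rightarrow> ('a \<Rightarrow> 'a \<Rightarrow> 'a) \<Rightarrow> ('a \<Rightarrow> 'a) \<Rightarrow> bool" where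
  "transverse_infinitesimal_symmetry U H J e \<longleftrightarrow>
     infinitesimal_symmetry U H J e \<and>
     (\<exists>\<theta>. contact_form U H \<theta> \<and> (\<forall>x\<in>U. e x = reeb \<theta> x))"


section \<open>Webster--Tanaka calculus in adapted coframes\<close>

text \<open>
  Indices range over \<open>{..<m}\<close>.  A complex tangent vector A + iB is the pair \<open>(A, B)\<close>; complex
  1-forms and 2-forms are given on real vectors and extended complex (bi)linearly.
\<close>

definition cx1 :: "('a \<Rightarrow> complex) \<Rightarrow> 'a \<times> 'a \<Rightarrow> complex"
  where "cx1 \<beta> Z = \<beta> (fst Z) + \<i> * \<beta> (snd Z)"

definition cx2 :: "('a \<Rightarrow> 'a \<Rightarrow> complex) \<Rightarrow> 'a \<times> 'a \<Rightarrow> 'a \<times> 'a \<Rightarrow> complex"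
  where "cx2 \<omega> Z W = cx1 (\<lambda>X. cx1 (\<omega> X) W) Z"

definition cconj :: "'a::uminus \<times> 'a \<Rightarrow> 'a \<times> 'a"
  where "cconj Z = (fst Z, - snd Z)"

abbreviation bar :: "('v \<Rightarrow> complex) \<Rightarrow> 'v \<Rightarrow> complex"
  where "bar \<beta> \<equiv> (\<lambda>X. cnj (\<beta> X))"

definition adapted_coframe ::
    "nat \<Rightarrow> 'a::euclidean_space set \<Rightarrow> ('a \<Rightarrow> 'a set) \<Rightarrow> ('a \<Rightarrow> 'a \<Rightarrow> 'a) \<Rightarrow> ('a \<Rightarrow> 'a \<Rightarrow> real) \<Rightarrow>
     (nat \<Rightarrow> 'a \<Rightarrow> 'a \<Rightarrow> complex) \<Rightarrow> bool" where
  "adapted_coframe m V H J \<theta> \<phi> \<longleftrightarrow>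
     (\<forall>\<alpha><m. one_form_on V (\<phi> \<alpha>)) \<and>
     (\<forall>x\<in>V.
        (\<forall>\<alpha><m. \<phi> \<alpha> x (reeb \<theta> x) = 0 \<and> (\<forall>X\<in>H x. \<phi> \<alpha> x (J x X) = \<i> * \<phi> \<alpha> x X)) \<and>
        (\<forall>X. \<theta> x X = 0 \<and> (\<forall>\<alpha><m. \<phi> \<alpha> x X = 0) \<longrightarrow> X = 0))"

text \<open>\<open>h \<alpha> \<beta>\<close> is $h_{\alpha\bar\beta}$.\<close>

definition levi_matrix ::
    "nat \<Rightarrow> 'a::euclidean_space set \<Rightarrow> ('a \<Rightarrow> 'a \<Rightarrow> real) \<Rightarrow> (nat \<Rightarrow> 'a \<Rightarrow> 'a \<Rightarrow> complex) \<Rightarrow>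
     (nat \<Rightarrow> nat \<Rightarrow> 'a \<Rightarrow> complex) \<Rightarrow> bool" where
  "levi_matrix m V \<theta> \<phi> h \<longleftrightarrow>
     (\<forall>\<alpha><m. \<forall>\<beta><m. smooth_on V (h \<alpha> \<beta>)) \<and>
     (\<forall>x\<in>V. \<forall>X Y. complex_of_real (extd \<theta> x X Y) =
        \<i> * (\<Sum>\<alpha><m. \<Sum>\<beta><m. h \<alpha> \<beta> x * wedge (\<phi> \<alpha> x) (bar (\<phi> \<beta> x)) X Y))"

definition unitary :: "nat \<Rightarrow> 'a set \<Rightarrow> (nat \<Rightarrow> nat \<Rightarrow> 'a \<Rightarrow> complex) \<Rightarrow> bool"
  where "unitary m V h \<longleftrightarrow> (\<forall>x\<in>V. \<forall>\<alpha><m. \<forall>\<beta><m. h \<alpha> \<beta> x = of_bool (\<alpha> = \<beta>))"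

text \<open>\<open>hi \<alpha> \<beta>\<close> is $h^{\alpha\bar\beta}$, with $h_{\alpha\bar\gamma} h^{\beta\bar\gamma} = \delta_\alpha^\beta$.\<close>

definition inverse_levi_matrix ::
    "nat \<Rightarrow> 'a set \<Rightarrow> (nat \<Rightarrow> nat \<Rightarrow> 'a \<Rightarrow> complex) \<Rightarrow> (nat \<Rightarrow> nat \<Rightarrow> 'a \<Rightarrow> complex) \<Rightarrow> bool" where
  "inverse_levi_matrix m V h hi \<longleftrightarrow>
     (\<forall>x\<in>V. \<forall>\<alpha><m. \<forall>\<beta><m. (\<Sum>\<gamma><m. h \<alpha> \<gamma> x * hi \<beta> \<gamma> x) = of_bool (\<alpha> = \<beta>))"

text \<open>The Levi form as a degenerate real metric, annihilating the Reeb vector field.\<close>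

definition levi_form ::
    "nat \<Rightarrow> 'a::euclidean_space set \<Rightarrow> ('a \<Rightarrow> 'a set) \<Rightarrow> ('a \<Rightarrow> 'a \<Rightarrow> 'a) \<Rightarrow> ('a \<Rightarrow> 'a \<Rightarrow> real) \<Rightarrow>
     'a metric \<Rightarrow> bool" where
  "levi_form m U H J \<theta> L \<longleftrightarrow>
     (\<forall>V \<phi> h. open V \<and> V \<subseteq> U \<and> adapted_coframe m V H J \<theta> \<phi> \<and> levi_matrix m V \<theta> \<phi> h \<longrightarrow>
        (\<forall>x\<in>V. \<forall>X Y. complex_of_real (L x X Y) =
           2 * (\<Sum>\<alpha><m. \<Sum>\<beta><m. h \<alpha> \<beta> x * odot (\<phi> \<alpha> x) (bar (\<phi> \<beta> x)) X Y)))"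

text \<open>The vector $e_\alpha$ of the complex frame dual to $(\theta, \phi^\alpha, \bar\phi^\alpha)$.\<close>

definition frame ::
    "nat \<Rightarrow> ('a::euclidean_space \<Rightarrow> 'a \<Rightarrow> real) \<Rightarrow> (nat \<Rightarrow> 'a \<Rightarrow> 'a \<Rightarrow> complex) \<Rightarrow> 'a \<Rightarrow> nat \<Rightarrow> 'a \<times> 'a"
  where
  "frame m \<theta> \<phi> x \<alpha> = (THE Z. cx1 (\<lambda>X. complex_of_real (\<theta> x X)) Z = 0 \<and>
     (\<forall>\<beta><m. cx1 (\<phi> \<beta> x) Z = of_bool (\<beta> = \<alpha>) \<and> cx1 (bar (\<phi> \<beta> x)) Z = 0))"

text \<open>
  Torsion with all indices lowered: \<open>A \<alpha> \<beta>\<close> is $A^\alpha{}_{\bar\beta}$ and \<open>N \<beta> \<gamma> \<alpha>\<close> is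
  $N_{\bar\beta\bar\gamma}{}^\alpha$, so that lowering the unbarred index yields
  $A_{\bar\alpha\bar\beta}$ and $N_{\bar\alpha\bar\beta\bar\gamma}$, the complex conjugates of
  $A_{\alpha\beta}$ and $N_{\alpha\beta\gamma}$.
\<close>

definition A_low ::
    "nat \<Rightarrow> (nat \<Rightarrow> nat \<Rightarrow> 'a \<Rightarrow> complex) \<Rightarrow> (nat \<Rightarrow> nat \<Rightarrow> 'a \<Rightarrow> complex) \<Rightarrow> nat \<Rightarrow> nat \<Rightarrow> 'a \<Rightarrow> complex"
  where "A_low m h A \<alpha> \<beta> x = cnj (\<Sum>\<gamma><m. h \<gamma> \<alpha> x * A \<gamma> \<beta> x)"

definition N_low ::
    "nat \<Rightarrow> (nat \<Rightarrow> nat \<Rightarrow> 'a \<Rightarrow> complex) \<Rightarrow> (nat \<Rightarrow> nat \<Rightarrow> nat \<Rightarrow> 'a \<Rightarrow> complex) \<Rightarrow>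
     nat \<Rightarrow> nat \<Rightarrow> nat \<Rightarrow> 'a \<Rightarrow> complex"
  where "N_low m h N \<alpha> \<beta> \<gamma> x = cnj (\<Sum>\<delta><m. h \<delta> \<gamma> x * N \<alpha> \<beta> \<delta> x)"

text \<open>
  \<open>\<Gamma> \<beta> \<alpha>\<close> is $\Gamma_\beta{}^\alpha$, i.e. $\nabla e_\beta = \Gamma_\beta{}^\alpha \otimes e_\alpha$.
  A connection of this form with \<open>\<nabla>\<close> annihilating the Reeb field preserves \<open>\<theta>\<close> and
  \<open>J\<close>; it preserves \<open>d\<theta>\<close> when the covariant derivative of $h_{\alpha\bar\beta}$ vanishes, which
  is the first of the equations below.
\<close>

definition webster_tanaka ::
    "nat \<Rightarrow> 'a::euclidean_space set \<Rightarrow> ('a \<Rightarrow> 'a set) \<Rightarrow> ('a \<Rightarrow> 'a \<Rightarrow> 'a) \<Rightarrow> ('a \<Rightarrow> 'a \<Rightarrow> real) \<Rightarrow>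
     (nat \<Rightarrow> 'a \<Rightarrow> 'a \<Rightarrow> complex) \<Rightarrow> (nat \<Rightarrow> nat \<Rightarrow> 'a \<Rightarrow> complex) \<Rightarrow> (nat \<Rightarrow> nat \<Rightarrow> 'a \<Rightarrow> complex) \<Rightarrow>
     (nat \<Rightarrow> nat \<Rightarrow> 'a \<Rightarrow> 'a \<Rightarrow> complex) \<Rightarrow> (nat \<Rightarrow> nat \<Rightarrow> 'a \<Rightarrow> complex) \<Rightarrow>
     (nat \<Rightarrow> nat \<Rightarrow> nat \<Rightarrow> 'a \<Rightarrow> complex) \<Rightarrow> bool" where
  "webster_tanaka m V H J \<theta> \<phi> h hi \<Gamma> A N \<longleftrightarrow>
     open V \<and> adapted_coframe m V H J \<theta> \<phi> \<and> levi_matrix m V \<theta> \<phi> h \<and> inverse_levi_matrix m V h hi \<and>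
     (\<forall>\<alpha><m. \<forall>\<beta><m. one_form_on V (\<Gamma> \<alpha> \<beta>) \<and> smooth_on V (A \<alpha> \<beta>) \<and> (\<forall>\<gamma><m. smooth_on V (N \<alpha> \<beta> \<gamma>))) \<and>
     (\<forall>x\<in>V. \<forall>X. \<forall>\<alpha><m. \<forall>\<beta><m. dird (h \<alpha> \<beta>) x X =
        (\<Sum>\<gamma><m. \<Gamma> \<alpha> \<gamma> x X * h \<gamma> \<beta> x + h \<alpha> \<gamma> x * cnj (\<Gamma> \<beta> \<gamma> x X))) \<and>
     (\<forall>x\<in>V. \<forall>X Y. \<forall>\<alpha><m. extd (\<phi> \<alpha>) x X Y =
        (\<Sum>\<beta><m. wedge (\<phi> \<beta> x) (\<Gamma> \<beta> \<alpha> x) X Y)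
        + (\<Sum>\<beta><m. A \<alpha> \<beta> x * wedge (\<lambda>X. complex_of_real (\<theta> x X)) (bar (\<phi> \<beta> x)) X Y)
        - 1 / 2 * (\<Sum>\<beta><m. \<Sum>\<gamma><m. N \<beta> \<gamma> \<alpha> x * wedge (bar (\<phi> \<beta> x)) (bar (\<phi> \<gamma> x)) X Y)) \<and>
     (\<forall>x\<in>V. \<forall>\<alpha><m. \<forall>\<beta><m.
        A_low m h A \<alpha> \<beta> x = A_low m h A \<beta> \<alpha> x \<and>
        (\<forall>\<gamma><m. N_low m h N \<alpha> \<beta> \<gamma> x = - N_low m h N \<beta> \<alpha> \<gamma> x \<and>
           N_low m h N \<alpha> \<beta> \<gamma> x + N_low m h N \<beta> \<gamma> \<alpha> x + N_low m h N \<gamma> \<alpha> \<beta> x = 0))"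

text \<open>
  \<open>webster_curv m \<theta> \<phi> \<Gamma> \<alpha> \<beta> \<gamma> \<delta>\<close> is $R_{\alpha\bar\beta\gamma}{}^\delta$, the component along
  $e_\delta$ of $R(e_\alpha, \bar e_{\bar\beta}) e_\gamma$.  The factor 2 compensates the factors
  1/2 in \<open>extd\<close> and \<open>wedge\<close>.
\<close>

definition webster_curv ::
    "nat \<Rightarrow> ('a::euclidean_space \<Rightarrow> 'a \<Rightarrow> real) \<Rightarrow> (nat \<Rightarrow> 'a \<Rightarrow> 'a \<Rightarrow> complex) \<Rightarrow>
     (nat \<Rightarrow> nat \<Rightarrow> 'a \<Rightarrow> 'a \<Rightarrow> complex) \<Rightarrow> nat \<Rightarrow> nat \<Rightarrow> nat \<Rightarrow> nat \<Rightarrow> 'a \<Rightarrow> complex" where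
  "webster_curv m \<theta> \<phi> \<Gamma> \<alpha> \<beta> \<gamma> \<delta> x =
     2 * cx2 (\<lambda>X Y. extd (\<Gamma> \<gamma> \<delta>) x X Y - (\<Sum>\<epsilon><m. wedge (\<Gamma> \<gamma> \<epsilon> x) (\<Gamma> \<epsilon> \<delta> x) X Y))
           (frame m \<theta> \<phi> x \<alpha>) (cconj (frame m \<theta> \<phi> x \<beta>))"

definition webster_ric ::
    "nat \<Rightarrow> ('a::euclidean_space \<Rightarrow> 'a \<Rightarrow> real) \<Rightarrow> (nat \<Rightarrow> 'a \<Rightarrow> 'a \<Rightarrow> complex) \<Rightarrow>
     (nat \<Rightarrow> nat \<Rightarrow> 'a \<Rightarrow> complex) \<Rightarrow> (nat \<Rightarrow> nat \<Rightarrow> 'a \<Rightarrow> 'a \<Rightarrow> complex) \<Rightarrow> nat \<Rightarrow> nat \<Rightarrow> 'a \<Rightarrow> complex"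
  where
  "webster_ric m \<theta> \<phi> hi \<Gamma> \<gamma> \<delta> x = (\<Sum>\<alpha><m. \<Sum>\<beta><m. hi \<alpha> \<beta> x * webster_curv m \<theta> \<phi> \<Gamma> \<alpha> \<beta> \<gamma> \<delta> x)"

definition webster_sc ::
    "nat \<Rightarrow> ('a::euclidean_space \<Rightarrow> 'a \<Rightarrow> real) \<Rightarrow> (nat \<Rightarrow> 'a \<Rightarrow> 'a \<Rightarrow> complex) \<Rightarrow>
     (nat \<Rightarrow> nat \<Rightarrow> 'a \<Rightarrow> complex) \<Rightarrow> (nat \<Rightarrow> nat \<Rightarrow> 'a \<Rightarrow> 'a \<Rightarrow> complex) \<Rightarrow> 'a \<Rightarrow> complex"
  where "webster_sc m \<theta> \<phi> hi \<Gamma> x = (\<Sum>\<gamma><m. webster_ric m \<theta> \<phi> hi \<Gamma> \<gamma> \<gamma> x)"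

text \<open>The component $\nabla_X N_{\alpha\beta\gamma}$; \<open>T\<close> stands for \<open>N_low m h N\<close>.\<close>

definition nabla_N ::
    "nat \<Rightarrow> (nat \<Rightarrow> nat \<Rightarrow> 'a::euclidean_space \<Rightarrow> 'a \<Rightarrow> complex) \<Rightarrow>
     (nat \<Rightarrow> nat \<Rightarrow> nat \<Rightarrow> 'a \<Rightarrow> complex) \<Rightarrow> 'a \<Rightarrow> nat \<Rightarrow> nat \<Rightarrow> nat \<Rightarrow> 'a \<Rightarrow> complex" where
  "nabla_N m \<Gamma> T x \<alpha> \<beta> \<gamma> X =
     dird (T \<alpha> \<beta> \<gamma>) x X
     - (\<Sum>\<delta><m. \<Gamma> \<alpha> \<delta> x X * T \<delta> \<beta> \<gamma> x + \<Gamma> \<beta> \<delta> x X * T \<alpha> \<delta> \<gamma> x + \<Gamma> \<gamma> \<delta> x X * T \<alpha> \<beta> \<delta> x)"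

text \<open>$\nabla^\gamma N_{\gamma\alpha\beta} = h^{\gamma\bar\delta} \nabla_{\bar\delta} N_{\gamma\alpha\beta}$.\<close>

definition div_N ::
    "nat \<Rightarrow> ('a::euclidean_space \<Rightarrow> 'a \<Rightarrow> real) \<Rightarrow> (nat \<Rightarrow> 'a \<Rightarrow> 'a \<Rightarrow> complex) \<Rightarrow>
     (nat \<Rightarrow> nat \<Rightarrow> 'a \<Rightarrow> complex) \<Rightarrow> (nat \<Rightarrow> nat \<Rightarrow> 'a \<Rightarrow> 'a \<Rightarrow> complex) \<Rightarrow>
     (nat \<Rightarrow> nat \<Rightarrow> nat \<Rightarrow> 'a \<Rightarrow> complex) \<Rightarrow> nat \<Rightarrow> nat \<Rightarrow> 'a \<Rightarrow> complex" where
  "div_N m \<theta> \<phi> hi \<Gamma> T \<alpha> \<beta> x = (\<Sum>\<gamma><m. \<Sum>\<delta><m.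
     hi \<gamma> \<delta> x * cx1 (nabla_N m \<Gamma> T x \<gamma> \<alpha> \<beta>) (cconj (frame m \<theta> \<phi> x \<delta>)))"

text \<open>$N^{\alpha\beta\gamma}$, from \<open>T\<close> as above.\<close>

definition N_up ::
    "nat \<Rightarrow> (nat \<Rightarrow> nat \<Rightarrow> 'a \<Rightarrow> complex) \<Rightarrow> (nat \<Rightarrow> nat \<Rightarrow> nat \<Rightarrow> 'a \<Rightarrow> complex) \<Rightarrow>
     nat \<Rightarrow> nat \<Rightarrow> nat \<Rightarrow> 'a \<Rightarrow> complex" where
  "N_up m hi T \<alpha> \<beta> \<gamma> x = (\<Sum>\<mu><m. \<Sum>\<nu><m. \<Sum>\<rho><m.
     hi \<alpha> \<mu> x * hi \<beta> \<nu> x * hi \<gamma> \<rho> x * cnj (T \<mu> \<nu> \<rho> x))"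

definition CR_einstein_equations ::
    "nat \<Rightarrow> 'a::euclidean_space set \<Rightarrow> ('a \<Rightarrow> 'a \<Rightarrow> real) \<Rightarrow> (nat \<Rightarrow> 'a \<Rightarrow> 'a \<Rightarrow> complex) \<Rightarrow>
     (nat \<Rightarrow> nat \<Rightarrow> 'a \<Rightarrow> complex) \<Rightarrow> (nat \<Rightarrow> nat \<Rightarrow> 'a \<Rightarrow> complex) \<Rightarrow>
     (nat \<Rightarrow> nat \<Rightarrow> 'a \<Rightarrow> 'a \<Rightarrow> complex) \<Rightarrow> (nat \<Rightarrow> nat \<Rightarrow> 'a \<Rightarrow> complex) \<Rightarrow>
     (nat \<Rightarrow> nat \<Rightarrow> nat \<Rightarrow> 'a \<Rightarrow> complex) \<Rightarrow> real \<Rightarrow> bool" where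
  "CR_einstein_equations m V \<theta> \<phi> h hi \<Gamma> A N \<Lambda> \<longleftrightarrow>
     (let T = N_low m h N in
      \<forall>x\<in>V. \<forall>\<alpha><m. \<forall>\<beta><m.
        A_low m h A \<alpha> \<beta> x = 0 \<and>
        div_N m \<theta> \<phi> hi \<Gamma> T \<alpha> \<beta> x + div_N m \<theta> \<phi> hi \<Gamma> T \<beta> \<alpha> x = 0 \<and>
        webster_ric m \<theta> \<phi> hi \<Gamma> \<alpha> \<beta> x - (\<Sum>\<delta><m. \<Sum>\<gamma><m. T \<alpha> \<delta> \<gamma> x * N_up m hi T \<beta> \<delta> \<gamma> x)
          = complex_of_real \<Lambda> * of_bool (\<alpha> = \<beta>))"

text \<open>
  Positive definite signature means that near every point there are unitary coframes; these carry
  a (unique) Webster--Tanaka connection.  The equations are required in all adapted coframes.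
\<close>

definition almost_CR_einstein ::
    "nat \<Rightarrow> 'a::euclidean_space set \<Rightarrow> ('a \<Rightarrow> 'a set) \<Rightarrow> ('a \<Rightarrow> 'a \<Rightarrow> 'a) \<Rightarrow> ('a \<Rightarrow> 'a \<Rightarrow> real) \<Rightarrow>
     real \<Rightarrow> bool" where
  "almost_CR_einstein m U H J \<theta> \<Lambda> \<longleftrightarrow>
     contact_almost_CR m U H J \<and> contact_form U H \<theta> \<and>
     (\<forall>x\<in>U. \<exists>V \<phi> h hi \<Gamma> A N. x \<in> V \<and> V \<subseteq> U \<and> unitary m V h \<and>
        webster_tanaka m V H J \<theta> \<phi> h hi \<Gamma> A N) \<and>
     (\<forall>V \<phi> h hi \<Gamma> A N. V \<subseteq> U \<and> webster_tanaka m V H J \<theta> \<phi> h hi \<Gamma> A N \<longrightarrow>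
        CR_einstein_equations m V \<theta> \<phi> h hi \<Gamma> A N \<Lambda>)"


section \<open>Fefferman--Einstein metrics\<close>

text \<open>
  The representative of the gauged Fefferman conformal structure in a unitary coframe, with fibre
  coordinate \<open>\<psi>\<close> and gauge field \<open>\<xi>\<close>.  The bundle projection is \<open>snd\<close>; in a unitary coframe
  $\mathrm i \Gamma_\alpha{}^\alpha$ and the Webster scalar are real.
\<close>

definition fefferman ::
    "nat \<Rightarrow> ('a::euclidean_space \<Rightarrow> 'a \<Rightarrow> real) \<Rightarrow> (nat \<Rightarrow> 'a \<Rightarrow> 'a \<Rightarrow> complex) \<Rightarrow>
     (nat \<Rightarrow> nat \<Rightarrow> 'a \<Rightarrow> complex) \<Rightarrow> (nat \<Rightarrow> nat \<Rightarrow> 'a \<Rightarrow> 'a \<Rightarrow> complex) \<Rightarrow> ('a \<Rightarrow> 'a \<Rightarrow> real) \<Rightarrow>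
     (real \<times> 'a \<Rightarrow> real) \<Rightarrow> (real \<times> 'a) metric" where
  "fefferman m \<theta> \<phi> hi \<Gamma> \<xi> \<psi> p X Y =
     (let x = snd p;
          \<theta>' = (\<lambda>Z. \<theta> x (snd Z));
          \<sigma> = (\<lambda>Z. dird \<psi> p Z
                 + 1 / (real m + 2) * (Re (\<i> * (\<Sum>\<alpha><m. \<Gamma> \<alpha> \<alpha> x (snd Z)))
                     - 1 / (2 * real m + 2) * Re (webster_sc m \<theta> \<phi> hi \<Gamma> x) * \<theta> x (snd Z))
                 + \<xi> x (snd Z))
      in 4 * odot \<theta>' \<sigma> X Y
         + Re (2 * (\<Sum>\<alpha><m. odot (\<lambda>Z. \<phi> \<alpha> x (snd Z)) (\<lambda>Z. cnj (\<phi> \<alpha> x (snd Z))) X Y)))"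

text \<open>
  Being conformal to a Fefferman metric is a local condition.  For a metric on \<open>S\<close> whose optical
  leaf space is described by the projection \<open>snd\<close>, the base of the circle bundle is (locally)
  that leaf space, and a fibre coordinate is any function completing \<open>snd\<close> to local coordinates.
\<close>

definition fefferman_einstein_on ::
    "nat \<Rightarrow> (real \<times> 'a::euclidean_space) set \<Rightarrow> (real \<times> 'a) metric \<Rightarrow> bool" where
  "fefferman_einstein_on m S g \<longleftrightarrow>
     einstein_on S g \<and>
     (\<forall>p\<in>S. \<exists>W V H J \<theta> \<phi> h hi \<Gamma> A N \<xi> \<psi> \<Omega>.
        p \<in> W \<and> open W \<and> W \<subseteq> S \<and> snd ` W \<subseteq> V \<and>
        contact_almost_CR m V H J \<and> contact_form V H \<theta> \<and>
        unitary m V h \<and> webster_tanaka m V H J \<theta> \<phi> h hi \<Gamma> A N \<and>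
        one_form_on V \<xi> \<and>
        smooth_on W \<psi> \<and> (\<forall>q\<in>W. dird \<psi> q (1, 0) \<noteq> 0) \<and>
        smooth_on W \<Omega> \<and>
        (\<forall>q\<in>W. \<Omega> q > 0 \<and> (\<forall>X Y. g q X Y = \<Omega> q * fefferman m \<theta> \<phi> hi \<Gamma> \<xi> \<psi> q X Y)))"


section \<open>The normal form\<close>

definition strip :: "'a set \<Rightarrow> (real \<times> 'a) set"
  where "strip U = {- pi / 2 <..< pi / 2} \<times> U"

primrec nf_coeff :: "nat \<Rightarrow> nat \<Rightarrow> real" where
  "nf_coeff m 0 = 1"
| "nf_coeff m (Suc j) =
     (2 * real m - 2 * real (Suc j) + 4) / (2 * real m - 2 * real (Suc j) + 1) * nf_coeff m j"

definition nf_lambda0 :: "nat \<Rightarrow> real \<Rightarrow> real \<Rightarrow> real \<Rightarrow> real \<Rightarrow> real" where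
  "nf_lambda0 m \<Lambda> \<Lambda>u cu t =
     \<Lambda>u / (2 * real m + 2)
     + (\<Lambda> / (2 * real m + 1) - \<Lambda>u / (2 * real m + 2))
       * ((\<Sum>j=0..m. nf_coeff m j * cos t ^ (2 * j)) - 2 * nf_coeff m m * cos t ^ (2 * m + 2))
     + cu * cos t ^ (2 * m + 1) * sin t"

definition descends_to :: "(real \<times> 'a) set \<Rightarrow> (real \<times> 'a \<Rightarrow> real \<times> 'a) \<Rightarrow> ('a \<Rightarrow> 'a) \<Rightarrow> bool"
  where "descends_to S v w \<longleftrightarrow> (\<forall>p\<in>S. snd (v p) = w (snd p))"

end

theory Submission
  imports Defs
begin

text \<open>
  Contracting with the metric shows \<open>v = (0, e/2)\<close> with \<open>e\<close> the Reeb field.  By Cartan's formula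
  \<open>e\<close> preserves \<open>\<theta>\<close>, and since the pseudohermitian torsion vanishes, the structure equations
  give $L_e \phi^\alpha = - \Gamma_\beta{}^\alpha(e) \phi^\beta$ in a unitary coframe, with
  skew-Hermitian coefficients.  Hence \<open>e\<close> preserves the Levi form and \<open>J\<close>, and \<open>v\<close> is Killing
  because it annihilates the coordinate \<open>\<phi>\<close>.

  The squared length of \<open>v\<close> is $\lambda_0$, which tends to $\Lambda/(2m+1)$ at both ends of the
  interval.  If it vanishes, then $\Lambda = 0$ and \<open>g\<close> is a Fefferman metric with the gauge field
  that cancels the connection terms.  Conversely, comparing \<open>g\<close> with any Fefferman metric in its
  conformal class shows that $\lambda_0$ is locally affine in \<open>\<phi>\<close>; its boundary values being
  equal, it is the constant $\Lambda/(2m+1)$, which is zero in the Ricci-flat case.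
\<close>

section \<open>Smooth maps\<close>

text \<open>Two obstacles shape the proof. First, the Reeb field is a definite description and the
  Levi form \<open>L\<close> is only characterised through coframes, so neither comes with any
  regularity. The Reeb field acquires it as the solution of an invertible linear system with smooth
  coefficients, and \<open>L\<close> from its expression in a unitary coframe. Second, the Fefferman
  condition is local and leaves the fibre coordinate \<psi> free: it may be r \<phi> plus a function
  on the leaf space, where r is itself a function on the leaf space. The slope of
  \<open>\<lambda>_0\<close> in \<phi> is then, up to a factor, the derivative of r along the Reeb
  field. Comparing the metrics near a point does not exclude a nonzero slope, so constancy has to
  come from the two ends of the interval.\<close>

lemma dird_eq: "(f has_derivative f') (at x) \<Longrightarrow> dird f x X = f' X"
  by (metis frechet_derivative_at)

lemma has_derivative_dird: "f differentiable (at x) \<Longrightarrow> (f has_derivative dird f x) (at x)"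
  using frechet_derivative_works by blast

lemma linear_dird: "f differentiable (at x) \<Longrightarrow> linear (dird f x)"
  by (rule linear_frechet_derivative)

text \<open>Differentiability is not assumed: both functions have the same derivatives at
  \<open>x\<close>, so the choice operator inside \<open>frechet_derivative\<close> picks the same
  one, whatever it is.\<close>

lemma dird_cong:
  assumes "open S" "x \<in> S" "\<And>y. y \<in> S \<Longrightarrow> f y = g y"
  shows "dird f x = dird g x"
proof -
  have "(f has_derivative f') (at x) \<longleftrightarrow> (g has_derivative f') (at x)" for f'
    using has_derivative_transform_within_open[OF _ assms(1,2), of f f' UNIV g]
      has_derivative_transform_within_open[OF _ assms(1,2), of g f' UNIV f] assms(3) by auto
  then show ?thesis unfolding frechet_derivative_def by presburger
qed

lemma differentiable_cong:
  assumes "open S" "x \<in> S" "\<And>y. y \<in> S \<Longrightarrow> f y = g y" "f differentiable (at x)"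
  shows "g differentiable (at x)"
  using has_derivative_transform_within_open[OF _ assms(1,2), of f _ UNIV g] assms(3,4)
  unfolding differentiable_def by blast

lemma Ck_on_cong:
  assumes "open S" "\<And>y. y \<in> S \<Longrightarrow> f y = g y" "Ck_on k S f"
  shows "Ck_on k S g"
  using assms(2,3)
proof (induction k arbitrary: f g)
  case 0
  then show ?case by (simp cong: continuous_on_cong)
next
  case (Suc k)
  have "dird f x X = dird g x X" if "x \<in> S" for x X
    using dird_cong[OF assms(1) that, of f g] Suc.prems(1) by simp
  then have "Ck_on k S (\<lambda>x. dird g x X)" for X
    by (rule Suc.IH) (use Suc.prems in auto)
  moreover have "g differentiable (at x)" if "x \<in> S" for x
    using differentiable_cong[OF assms(1) that, of f g] Suc.prems that by auto
  ultimately show ?case by simp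
qed

lemma Ck_on_subset: "Ck_on k S f \<Longrightarrow> T \<subseteq> S \<Longrightarrow> Ck_on k T f"
  by (induction k arbitrary: f) (auto intro: continuous_on_subset)

lemma Ck_on_Suc_imp: "Ck_on (Suc k) S f \<Longrightarrow> Ck_on k S f"
proof (induction k arbitrary: f)
  case 0
  then show ?case
    by (auto intro!: continuous_at_imp_continuous_on differentiable_imp_continuous_within)
next
  case (Suc k)
  then show ?case by simp
qed

lemma Ck_on_const: "Ck_on k S (\<lambda>x. c)"
  by (induction k arbitrary: c) (simp_all add: frechet_derivative_const)

lemma Ck_on_bounded_linear:
  assumes "open S" "bounded_linear T" "Ck_on k S f"
  shows "Ck_on k S (\<lambda>x. T (f x))"
  using assms(3)
proof (induction k arbitrary: f)
  case 0
  then show ?case by (simp add: bounded_linear.continuous_on[OF assms(2)])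
next
  case (Suc k)
  have d: "((\<lambda>x. T (f x)) has_derivative (\<lambda>X. T (dird f x X))) (at x)" if "x \<in> S" for x
    using Suc.prems that by (auto intro!: bounded_linear.has_derivative[OF assms(2)] has_derivative_dird)
  have "Ck_on k S (\<lambda>x. dird (\<lambda>x. T (f x)) x X)" for X
    by (rule Ck_on_cong[OF assms(1), of "\<lambda>x. T (dird f x X)"])
      (use Suc dird_eq[OF d] in auto)
  with d show ?case by (auto simp: differentiable_def)
qed

lemma Ck_on_add:
  assumes "open S" "Ck_on k S f" "Ck_on k S g"
  shows "Ck_on k S (\<lambda>x. f x + g x)"
  using assms(2,3)
proof (induction k arbitrary: f g)
  case 0
  then show ?case by (simp add: continuous_on_add)
next
  case (Suc k)
  have d: "((\<lambda>x. f x + g x) has_derivative (\<lambda>X. dird f x X + dird g x X)) (at x)" if "x \<in> S" for x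
    using Suc.prems that by (auto intro!: has_derivative_add has_derivative_dird)
  have "Ck_on k S (\<lambda>x. dird (\<lambda>x. f x + g x) x X)" for X
    by (rule Ck_on_cong[OF assms(1), of "\<lambda>x. dird f x X + dird g x X"])
      (use Suc dird_eq[OF d] in auto)
  with d show ?case by (auto simp: differentiable_def)
qed

lemma Ck_on_bilinear:
  assumes "open S" "bounded_bilinear T" "Ck_on k S f" "Ck_on k S g"
  shows "Ck_on k S (\<lambda>x. T (f x) (g x))"
  using assms(3,4)
proof (induction k arbitrary: f g)
  case 0
  then show ?case by (simp add: bounded_bilinear.continuous_on[OF assms(2)])
next
  case (Suc k)
  have d: "((\<lambda>x. T (f x) (g x)) has_derivative (\<lambda>X. T (f x) (dird g x X) + T (dird f x X) (g x))) (at x)"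
    if "x \<in> S" for x
    using Suc.prems that by (auto intro!: bounded_bilinear.FDERIV[OF assms(2)] has_derivative_dird)
  \<comment> \<open>The product rule pairs a differentiated factor with an undifferentiated one, so
    both factors are needed at order \<open>k\<close> as well.\<close>
  have "Ck_on k S f" "Ck_on k S g"
    using Suc.prems Ck_on_Suc_imp by metis+
  then have "Ck_on k S (\<lambda>x. T (f x) (dird g x X) + T (dird f x X) (g x))" for X
    using Suc.prems by (intro Ck_on_add[OF assms(1)] Suc.IH) auto
  then have "Ck_on k S (\<lambda>x. dird (\<lambda>x. T (f x) (g x)) x X)" for X
    by (rule Ck_on_cong[OF assms(1), rotated]) (simp add: dird_eq[OF d])
  with d show ?case by (auto simp: differentiable_def)
qed

lemma Ck_on_sum:
  "open S \<Longrightarrow> (\<And>i. Ck_on k S (f i)) \<Longrightarrow> Ck_on k S (\<lambda>x. \<Sum>i\<in>I. f i x)"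
  by (induction I rule: infinite_finite_induct) (auto intro: Ck_on_const Ck_on_add)

text \<open>For a linear inner map the chain rule produces the fixed direction \<open>T X\<close>,
  so the derivative has the shape of the original function and the induction closes. The inner maps
  that occur are the projections \<open>fst\<close> and \<open>snd\<close>.\<close>

lemma Ck_on_compose_linear:
  assumes "open S" "bounded_linear T" "Ck_on k S f"
  shows "Ck_on k (T -` S) (\<lambda>x. f (T x))"
  using assms(3)
proof (induction k arbitrary: f)
  case 0
  then show ?case
    by (auto intro!: continuous_on_compose2[of S f] bounded_linear.continuous_on[OF assms(2)])
next
  case (Suc k)
  have o: "open (T -` S)"
    using assms by (simp add: linear_continuous_on open_vimage)
  have d: "((\<lambda>x. f (T x)) has_derivative (\<lambda>X. dird f (T x) (T X))) (at x)" if "x \<in> T -` S" for x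
    using Suc.prems that
    by (auto intro!: has_derivative_compose[OF bounded_linear_imp_has_derivative[OF assms(2)], of f] has_derivative_dird)
  have "Ck_on k (T -` S) (\<lambda>x. dird (\<lambda>x. f (T x)) x X)" for X
    by (rule Ck_on_cong[OF o _ Suc.IH[of "\<lambda>x. dird f x (T X)"]])
      (use Suc.prems dird_eq[OF d] in auto)
  with d show ?case by (auto simp: differentiable_def)
qed

lemma smooth_onD: "smooth_on S f \<Longrightarrow> Ck_on k S f"
  by (simp add: smooth_on_def)

lemma smooth_on_cong: "open S \<Longrightarrow> (\<And>y. y \<in> S \<Longrightarrow> f y = g y) \<Longrightarrow> smooth_on S f \<Longrightarrow> smooth_on S g"
  unfolding smooth_on_def using Ck_on_cong by metis

lemma smooth_on_subset: "smooth_on S f \<Longrightarrow> T \<subseteq> S \<Longrightarrow> smooth_on T f"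
  unfolding smooth_on_def using Ck_on_subset by metis

lemma smooth_on_const: "smooth_on S (\<lambda>x. c)"
  unfolding smooth_on_def by (simp add: Ck_on_const)

lemma smooth_on_bounded_linear:
  "open S \<Longrightarrow> bounded_linear T \<Longrightarrow> smooth_on S f \<Longrightarrow> smooth_on S (\<lambda>x. T (f x))"
  unfolding smooth_on_def by (simp add: Ck_on_bounded_linear)

lemma smooth_on_add: "open S \<Longrightarrow> smooth_on S f \<Longrightarrow> smooth_on S g \<Longrightarrow> smooth_on S (\<lambda>x. f x + g x)"
  unfolding smooth_on_def by (simp add: Ck_on_add)

lemma smooth_on_bilinear:
  "open S \<Longrightarrow> bounded_bilinear T \<Longrightarrow> smooth_on S f \<Longrightarrow> smooth_on S g \<Longrightarrow> smooth_on S (\<lambda>x. T (f x) (g x))"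
  unfolding smooth_on_def by (simp add: Ck_on_bilinear)

lemma smooth_on_mult:
  fixes f g :: "'a::real_normed_vector \<Rightarrow> 'b::real_normed_algebra"
  shows "open S \<Longrightarrow> smooth_on S f \<Longrightarrow> smooth_on S g \<Longrightarrow> smooth_on S (\<lambda>x. f x * g x)"
  by (rule smooth_on_bilinear[OF _ bounded_bilinear_mult])

lemma smooth_on_scaleR:
  "open S \<Longrightarrow> smooth_on S f \<Longrightarrow> smooth_on S g \<Longrightarrow> smooth_on S (\<lambda>x. f x *\<^sub>R g x)"
  by (rule smooth_on_bilinear[OF _ bounded_bilinear_scaleR])

lemma smooth_on_diff: "open S \<Longrightarrow> smooth_on S f \<Longrightarrow> smooth_on S g \<Longrightarrow> smooth_on S (\<lambda>x. f x - g x)"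
  using smooth_on_add[of S f "\<lambda>x. - g x"]
    smooth_on_bounded_linear[OF _ bounded_linear_minus[OF bounded_linear_ident], of S g] by simp

lemma smooth_on_sum:
  "open S \<Longrightarrow> (\<And>i. i \<in> I \<Longrightarrow> smooth_on S (f i)) \<Longrightarrow> smooth_on S (\<lambda>x. \<Sum>i\<in>I. f i x)"
  by (induction I rule: infinite_finite_induct) (auto intro: smooth_on_const smooth_on_add)

lemma smooth_on_compose_linear:
  "open S \<Longrightarrow> bounded_linear T \<Longrightarrow> smooth_on S f \<Longrightarrow> smooth_on (T -` S) (\<lambda>x. f (T x))"
  unfolding smooth_on_def by (simp add: Ck_on_compose_linear)

lemma smooth_on_differentiable: "smooth_on S f \<Longrightarrow> x \<in> S \<Longrightarrow> f differentiable (at x)"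
  unfolding smooth_on_def by (metis Ck_on.simps(2))

lemma smooth_on_dird: "smooth_on S f \<Longrightarrow> smooth_on S (\<lambda>x. dird f x X)"
  unfolding smooth_on_def by (metis Ck_on.simps(2))

lemma smooth_on_linear:
  assumes "bounded_linear T" shows "smooth_on S T"
proof -
  have "(T has_derivative T) (at x)" for x
    by (rule bounded_linear_imp_has_derivative[OF assms])
  then have d: "T differentiable at x" "dird T x X = T X" for x X
    using dird_eq[of T T] by (auto simp: differentiable_def)
  have "Ck_on k S T" for k
    by (cases k) (simp_all add: d Ck_on_const linear_continuous_on[OF assms])
  then show ?thesis by (simp add: smooth_on_def)
qed

section \<open>Regularity of solutions of linear systems with smooth coefficients\<close>

text \<open>In the product rule the derivative of \<open>u\<close> is multiplied by
  \<open>w x = 0\<close>, so continuity of \<open>u\<close> is enough. This breaks the circle of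
  proving a solution differentiable through terms in which that solution occurs.\<close>

lemma has_derivative_scaleR_vanishing:
  fixes u :: "'a::real_normed_vector \<Rightarrow> real"
  assumes u: "continuous (at x) u" and w: "(w has_derivative w') (at x)" and "w x = 0"
  shows "((\<lambda>y. u y *\<^sub>R w y) has_derivative (\<lambda>X. u x *\<^sub>R w' X)) (at x)"
proof -
  have bl: "bounded_linear w'" using w by (rule has_derivative_bounded_linear)
  have w0: "((\<lambda>y. norm (w y - w x - w' (y - x)) / norm (y - x)) \<longlongrightarrow> 0) (at x)"
    using w by (simp add: has_derivative_iff_norm)
  obtain B where B: "\<And>z. norm (w' z) \<le> norm z * B" using bl bounded_linear.bounded by blast
  have ux: "(u \<longlongrightarrow> u x) (at x)" using u by (simp add: continuous_within)
  have l1: "((\<lambda>y. \<bar>u y\<bar> * (norm (w y - w x - w' (y - x)) / norm (y - x)) + \<bar>u y - u x\<bar> * \<bar>B\<bar>) \<longlongrightarrow> 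
      \<bar>u x\<bar> * 0 + \<bar>u x - u x\<bar> * \<bar>B\<bar>) (at x)"
    by (intro tendsto_intros ux w0)
  have "((\<lambda>y. norm (u y *\<^sub>R w y - u x *\<^sub>R w x - u x *\<^sub>R w' (y - x)) / norm (y - x)) \<longlongrightarrow> 0) (at x)"
  proof (rule Lim_null_comparison[OF _ l1[simplified]], rule eventuallyI)
    fix y
    have "u y *\<^sub>R w y - u x *\<^sub>R w x - u x *\<^sub>R w' (y - x)
      = u y *\<^sub>R (w y - w x - w' (y - x)) + (u y - u x) *\<^sub>R w' (y - x)"
      using \<open>w x = 0\<close> by (simp add: algebra_simps)
    then have "norm (u y *\<^sub>R w y - u x *\<^sub>R w x - u x *\<^sub>R w' (y - x))
      \<le> \<bar>u y\<bar> * norm (w y - w x - w' (y - x)) + \<bar>u y - u x\<bar> * (norm (y - x) * \<bar>B\<bar>)"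
      by (smt (verit) B abs_ge_zero mult_left_mono norm_ge_zero norm_scaleR norm_triangle_ineq)
    then show "norm (norm (u y *\<^sub>R w y - u x *\<^sub>R w x - u x *\<^sub>R w' (y - x)) / norm (y - x))
      \<le> \<bar>u y\<bar> * norm (w y - w x - w' (y - x)) / norm (y - x) + \<bar>u y - u x\<bar> * \<bar>B\<bar>"
      by (cases "y = x") (auto simp: field_simps)
  qed
  then show ?thesis
    using bl by (simp add: has_derivative_iff_norm bounded_linear_const_scaleR)
qed

lemma linear_expand:
  fixes A :: "'a::euclidean_space \<Rightarrow> 'b::real_vector"
  assumes "linear A"
  shows "A Z = (\<Sum>b\<in>Basis. (Z \<bullet> b) *\<^sub>R A b)"
proof -
  have "A Z = A (\<Sum>b\<in>Basis. (Z \<bullet> b) *\<^sub>R b)" by (simp add: euclidean_representation)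
  also have "\<dots> = (\<Sum>b\<in>Basis. (Z \<bullet> b) *\<^sub>R A b)"
    using assms by (simp add: linear_sum linear_scale)
  finally show ?thesis .
qed

lemma one_form_on_linear: "one_form_on S \<omega> \<Longrightarrow> x \<in> S \<Longrightarrow> linear (\<omega> x)"
  by (simp add: one_form_on_def)

lemma one_form_on_smooth: "one_form_on S \<omega> \<Longrightarrow> smooth_on S (\<lambda>x. \<omega> x X)"
  by (simp add: one_form_on_def)

lemma one_form_on_differentiable:
  "one_form_on S \<omega> \<Longrightarrow> x \<in> S \<Longrightarrow> (\<lambda>x. \<omega> x X) differentiable (at x)"
  by (rule smooth_on_differentiable[OF one_form_on_smooth])

lemma one_form_on_subset: "one_form_on S \<omega> \<Longrightarrow> T \<subseteq> S \<Longrightarrow> one_form_on T \<omega>"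
  unfolding one_form_on_def by (auto intro: smooth_on_subset)

text \<open>\<open>one_form_on\<close> gives smoothness only for each fixed vector argument.
  Expanding the argument in the basis turns the claim into the product rule for finitely many
  coefficients.\<close>

lemma one_form_apply_has_derivative:
  fixes \<omega> :: "'a::euclidean_space \<Rightarrow> 'a \<Rightarrow> 'b::real_normed_vector"
  assumes "open S" "one_form_on S \<omega>" "x \<in> S" and f: "(f has_derivative f') (at x)"
  shows "((\<lambda>y. \<omega> y (f y)) has_derivative (\<lambda>X. dird (\<lambda>y. \<omega> y (f x)) x X + \<omega> x (f' X))) (at x)"
proof -
  have exp: "\<omega> y Z = (\<Sum>b\<in>Basis. (Z \<bullet> b) *\<^sub>R \<omega> y b)" if "y \<in> S" for y Z
    by (rule linear_expand[OF one_form_on_linear[OF assms(2) that]])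
  have *: "((\<lambda>y. \<Sum>b\<in>Basis. (h y \<bullet> b) *\<^sub>R \<omega> y b) has_derivative
      (\<lambda>X. \<Sum>b\<in>Basis. (h x \<bullet> b) *\<^sub>R dird (\<lambda>y. \<omega> y b) x X + (h' X \<bullet> b) *\<^sub>R \<omega> x b)) (at x)"
    if "(h has_derivative h') (at x)" for h h'
    using that by (auto intro!: derivative_eq_intros has_derivative_dird
      one_form_on_differentiable[OF assms(2,3)])
  have "((\<lambda>y. \<omega> y (h y)) has_derivative
      (\<lambda>X. \<Sum>b\<in>Basis. (h x \<bullet> b) *\<^sub>R dird (\<lambda>y. \<omega> y b) x X + (h' X \<bullet> b) *\<^sub>R \<omega> x b)) (at x)"
    if "(h has_derivative h') (at x)" for h h'
    by (rule has_derivative_transform_within_open[OF *[OF that] assms(1,3)]) (rule exp[symmetric])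
  note d = this
  have "dird (\<lambda>y. \<omega> y (f x)) x X = (\<Sum>b\<in>Basis. (f x \<bullet> b) *\<^sub>R dird (\<lambda>y. \<omega> y b) x X)" for X
    using dird_eq[OF d[OF has_derivative_const[of "f x"]]] by simp
  moreover have "\<omega> x (f' X) = (\<Sum>b\<in>Basis. (f' X \<bullet> b) *\<^sub>R \<omega> x b)" for X
    by (rule exp[OF assms(3)])
  ultimately show ?thesis
    using d[OF f] by (simp add: sum.distrib)
qed

text \<open>Injectivity bounds \<open>T x\<close> from below by some \<open>c > 0\<close>, and
  \<open>E y\<close> bounds the operator norm of \<open>T y - T x\<close>. Once
  \<open>E y < c / 2\<close>, the part of the error that involves \<open>f y - f x\<close> is
  absorbed into the left-hand side, so no prior bound on \<open>f\<close> is required.\<close>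

lemma linear_system_continuous:
  fixes T :: "'a::euclidean_space \<Rightarrow> 'a \<Rightarrow> 'b::euclidean_space"
  assumes "open S" and T: "one_form_on S T" and x: "x \<in> S" and inj: "inj (T x)"
    and sol: "\<And>y. y \<in> S \<Longrightarrow> T y (f y) = b y" and b: "continuous (at x) b"
  shows "continuous (at x) f"
proof -
  have lin: "linear (T y)" if "y \<in> S" for y using one_form_on_linear[OF T that] .
  obtain c where "c > 0" and c: "\<And>Z. c * norm Z \<le> norm (T x Z)"
    using linear_inj_bounded_below_pos[OF lin[OF x] inj] by blast
  define E where "E y = (\<Sum>i\<in>Basis. norm (T y i - T x i))" for y
  have E: "norm (T y Z - T x Z) \<le> E y * norm Z" if "y \<in> S" for y Z
  proof -
    have "T y Z - T x Z = (\<Sum>i\<in>Basis. (Z \<bullet> i) *\<^sub>R (T y i - T x i))"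
      using linear_expand[OF lin[OF that], of Z] linear_expand[OF lin[OF x], of Z]
      by (simp add: sum_subtractf scaleR_diff_right)
    also have "norm \<dots> \<le> (\<Sum>i\<in>Basis. norm (T y i - T x i) * norm Z)"
      by (rule sum_norm_le) (simp add: mult.commute mult_right_mono Basis_le_norm)
    finally show ?thesis by (simp add: E_def sum_distrib_right)
  qed
  have contT: "((\<lambda>y. T y i) \<longlongrightarrow> T x i) (at x)" for i
    using differentiable_imp_continuous_within[OF one_form_on_differentiable[OF T x]]
    by (simp add: continuous_within)
  have "(E \<longlongrightarrow> (\<Sum>i\<in>Basis. norm (T x i - T x i))) (at x)"
    unfolding E_def by (intro tendsto_intros contT)
  then have E0: "(E \<longlongrightarrow> 0) (at x)" by simp
  have b0: "(b \<longlongrightarrow> b x) (at x)"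
    using b by (simp add: continuous_within)
  have "((\<lambda>y. 2 / c * (E y * norm (f x) + norm (b y - b x))) \<longlongrightarrow>
      2 / c * (0 * norm (f x) + norm (b x - b x))) (at x)"
    by (intro tendsto_intros E0 b0)
  then have lim: "((\<lambda>y. 2 / c * (E y * norm (f x) + norm (b y - b x))) \<longlongrightarrow> 0) (at x)"
    by simp
  have evS: "eventually (\<lambda>y. y \<in> S) (at x)"
    using assms(1) x by (rule eventually_at_in_open')
  have "eventually (\<lambda>y. E y < c / 2) (at x)"
    by (rule order_tendstoD(2)[OF E0]) (use \<open>c > 0\<close> in simp)
  with evS have "eventually (\<lambda>y. norm (f y - f x) \<le> 2 / c * (E y * norm (f x) + norm (b y - b x))) (at x)"
  proof eventually_elim
    case (elim y)
    have "T x (f y - f x) = (b y - b x) - (T y (f y) - T x (f y))"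
      using sol[OF elim(1)] sol[OF x] linear_diff[OF lin[OF x], of "f y" "f x"] by simp
    then have "norm (T x (f y - f x)) \<le> norm (b y - b x) + norm (T y (f y) - T x (f y))"
      by (metis norm_triangle_ineq4)
    also have "\<dots> \<le> norm (b y - b x) + E y * norm (f y)"
      using E[OF elim(1), of "f y"] by simp
    also have "\<dots> \<le> norm (b y - b x) + E y * (norm (f y - f x) + norm (f x))"
      using norm_triangle_sub[of "f y" "f x"]
      by (intro add_left_mono mult_left_mono) (auto simp: E_def sum_nonneg add.commute)
    also have "\<dots> \<le> norm (b y - b x) + c / 2 * norm (f y - f x) + E y * norm (f x)"
      using mult_right_mono[of "E y" "c / 2" "norm (f y - f x)"] elim(2)
      by (simp add: algebra_simps)
    finally have "c / 2 * norm (f y - f x) \<le> E y * norm (f x) + norm (b y - b x)"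
      using c[of "f y - f x"] by simp
    then show ?case using \<open>c > 0\<close> by (simp add: field_simps)
  qed
  then have "((\<lambda>y. f y - f x) \<longlongrightarrow> 0) (at x)"
    by (rule Lim_null_comparison[OF _ lim])
  then show ?thesis
    by (simp add: continuous_within LIM_zero_iff)
qed

text \<open>
  Solving for \<open>f\<close> against the fixed operator \<open>T x\<close> expresses the increment of \<open>f\<close> through
  terms that only require \<open>f\<close> to be continuous at \<open>x\<close>.
\<close>

lemma linear_system_differentiable:
  fixes T :: "'a::euclidean_space \<Rightarrow> 'a \<Rightarrow> 'b::euclidean_space"
  assumes "open S" and T: "one_form_on S T" and x: "x \<in> S" and inj: "inj (T x)"
    and sol: "\<And>y. y \<in> S \<Longrightarrow> T y (f y) = b y" and b: "b differentiable (at x)"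
  shows "f differentiable (at x)"
proof -
  have lin: "linear (T y)" if "y \<in> S" for y using one_form_on_linear[OF T that] .
  have cont: "continuous (at x) f"
    using linear_system_continuous[OF assms(1-4) sol] differentiable_imp_continuous_within[OF b]
    by blast
  obtain T' where T': "linear T'" "T' \<circ> T x = id"
    using linear_injective_left_inverse[OF lin[OF x] inj] by blast
  let ?r = "\<lambda>y. f x + T' ((b y - b x) - (\<Sum>i\<in>Basis. (f y \<bullet> i) *\<^sub>R (T y i - T x i)))"
  have "((\<lambda>y. (f y \<bullet> i) *\<^sub>R (T y i - T x i)) has_derivative
      (\<lambda>X. (f x \<bullet> i) *\<^sub>R dird (\<lambda>y. T y i) x X)) (at x)" for i
    by (rule has_derivative_scaleR_vanishing)
      (auto intro!: continuous_intros cont derivative_eq_intros has_derivative_dird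
        one_form_on_differentiable[OF T x])
  then have "(?r has_derivative (\<lambda>X. 0 + T' ((dird b x X - 0) -
      (\<Sum>i\<in>Basis. (f x \<bullet> i) *\<^sub>R dird (\<lambda>y. T y i) x X)))) (at x)"
    by (intro has_derivative_add has_derivative_const has_derivative_diff has_derivative_sum
      bounded_linear.has_derivative[OF linear_conv_bounded_linear[THEN iffD1, OF T'(1)]]
      has_derivative_dird b)
  moreover have "?r y = f y" if "y \<in> S" for y
  proof -
    have "(\<Sum>i\<in>Basis. (f y \<bullet> i) *\<^sub>R (T y i - T x i)) = b y - T x (f y)"
      using sol[OF that] linear_expand[OF lin[OF that], of "f y"] linear_expand[OF lin[OF x], of "f y"]
      by (simp add: sum_subtractf scaleR_diff_right)
    then have "?r y = f x + T' (T x (f y - f x))"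
      using sol[OF x] linear_diff[OF lin[OF x], of "f y" "f x"] by simp
    also have "T' (T x (f y - f x)) = f y - f x" using T'(2) by (metis comp_apply id_apply)
    finally show ?thesis by simp
  qed
  ultimately show ?thesis
    unfolding differentiable_def using has_derivative_transform_within_open[OF _ assms(1) x] by blast
qed

lemma one_form_on_dird:
  fixes \<omega> :: "'a::euclidean_space \<Rightarrow> 'a \<Rightarrow> 'b::real_normed_vector"
  assumes "open S" "one_form_on S \<omega>" "x \<in> S"
  shows "dird (\<lambda>y. \<omega> y Z) x X = (\<Sum>b\<in>Basis. (Z \<bullet> b) *\<^sub>R dird (\<lambda>y. \<omega> y b) x X)"
proof -
  have "((\<lambda>y. \<Sum>b\<in>Basis. (Z \<bullet> b) *\<^sub>R \<omega> y b) has_derivative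
      (\<lambda>X. \<Sum>b\<in>Basis. (Z \<bullet> b) *\<^sub>R dird (\<lambda>y. \<omega> y b) x X)) (at x)"
    by (auto intro!: derivative_eq_intros has_derivative_dird one_form_on_differentiable[OF assms(2,3)])
  then have "((\<lambda>y. \<omega> y Z) has_derivative
      (\<lambda>X. \<Sum>b\<in>Basis. (Z \<bullet> b) *\<^sub>R dird (\<lambda>y. \<omega> y b) x X)) (at x)"
    by (rule has_derivative_transform_within_open[OF _ assms(1,3)])
      (rule linear_expand[OF one_form_on_linear[OF assms(2)], symmetric])
  then show ?thesis by (rule dird_eq)
qed

text \<open>Differentiating \<open>T y (f y) = b y\<close> shows that each directional derivative of
  \<open>f\<close> solves a system with the same operator. Its right-hand side contains derivatives
  of \<open>b\<close> and \<open>T\<close> but only \<open>f\<close> itself, so order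
  \<open>k\<close> of \<open>f\<close> yields order \<open>k\<close> of its derivatives.\<close>

lemma linear_system_smooth:
  fixes T :: "'a::euclidean_space \<Rightarrow> 'a \<Rightarrow> 'b::euclidean_space"
  assumes S: "open S" and T: "one_form_on S T" and inj: "\<And>x. x \<in> S \<Longrightarrow> inj (T x)"
    and sol: "\<And>x. x \<in> S \<Longrightarrow> T x (f x) = b x" and b: "smooth_on S b"
  shows "smooth_on S f"
proof -
  have "Ck_on k S f" if "\<And>x. x \<in> S \<Longrightarrow> T x (f x) = b x" "Ck_on k S b" for k f b
    using that
  proof (induction k arbitrary: f b)
    case 0
    then have "continuous (at x) f" if "x \<in> S" for x
      using linear_system_continuous[OF S T that inj[OF that], of f b] that
      by (simp add: continuous_on_eq_continuous_at[OF S])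
    then show ?case
      by (auto intro!: continuous_at_imp_continuous_on)
  next
    case (Suc k)
    have fk: "Ck_on k S f"
      by (rule Suc.IH[OF Suc.prems(1) Ck_on_Suc_imp[OF Suc.prems(2)]])
    have d: "f differentiable (at x)" if "x \<in> S" for x
      using linear_system_differentiable[OF S T that inj[OF that], of f b] Suc.prems that
      by auto
    let ?b' = "\<lambda>X x. dird b x X + (- 1) *\<^sub>R (\<Sum>i\<in>Basis. (f x \<bullet> i) *\<^sub>R dird (\<lambda>y. T y i) x X)"
    have b': "T x (dird f x X) = ?b' X x" if "x \<in> S" for x X
    proof -
      have "((\<lambda>y. T y (f y)) has_derivative (\<lambda>X. dird (\<lambda>y. T y (f x)) x X + T x (dird f x X))) (at x)"
        by (rule one_form_apply_has_derivative[OF S T that has_derivative_dird[OF d[OF that]]])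
      then have "(b has_derivative (\<lambda>X. dird (\<lambda>y. T y (f x)) x X + T x (dird f x X))) (at x)"
        by (rule has_derivative_transform_within_open[OF _ S that]) (rule Suc.prems(1))
      from dird_eq[OF this] show ?thesis
        unfolding one_form_on_dird[OF S T that, of "f x"] by simp
    qed
    have db: "Ck_on k S (\<lambda>x. dird b x X)" for X
      using Suc.prems(2)[unfolded Ck_on.simps, THEN conjunct2] by (rule spec)
    have "Ck_on k S (\<lambda>x. dird (\<lambda>y. T y i) x X)" for i X
      by (rule smooth_onD[OF smooth_on_dird[OF one_form_on_smooth[OF T]]])
    then have "Ck_on k S (\<lambda>x. (f x \<bullet> i) *\<^sub>R dird (\<lambda>y. T y i) x X)" for i X
      by (rule Ck_on_bilinear[OF S bounded_bilinear_scaleR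
        Ck_on_bounded_linear[OF S bounded_linear_inner_left fk]])
    then have "Ck_on k S (\<lambda>x. \<Sum>i\<in>Basis. (f x \<bullet> i) *\<^sub>R dird (\<lambda>y. T y i) x X)" for X
      by (rule Ck_on_sum[OF S, of k "\<lambda>i x. (f x \<bullet> i) *\<^sub>R dird (\<lambda>y. T y i) x X" Basis])
    from Ck_on_add[OF S db Ck_on_bounded_linear[OF S bounded_linear_scaleR_right this]]
    have "Ck_on k S (?b' X)" for X .
    from Suc.IH[OF b' this] have "Ck_on k S (\<lambda>x. dird f x X)" for X .
    with d show ?case by simp
  qed
  from this[OF sol smooth_onD[OF b]] have "Ck_on k S f" for k .
  then show ?thesis
    unfolding smooth_on_def ..
qed

lemma linear_extd_left:
  fixes \<omega> :: "'a::euclidean_space \<Rightarrow> 'a \<Rightarrow> 'b::real_normed_field"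
  assumes "open S" "one_form_on S \<omega>" "x \<in> S"
  shows "linear (\<lambda>X. extd \<omega> x X Y)"
proof (rule linearI)
  have lin: "linear (dird (\<lambda>y. \<omega> y Y) x)"
    by (rule linear_dird[OF one_form_on_differentiable[OF assms(2,3)]])
  have add: "dird (\<lambda>y. \<omega> y (X + X')) x Y = dird (\<lambda>y. \<omega> y X) x Y + dird (\<lambda>y. \<omega> y X') x Y"
    and scale: "dird (\<lambda>y. \<omega> y (r *\<^sub>R X)) x Y = r *\<^sub>R dird (\<lambda>y. \<omega> y X) x Y" for X X' r
    unfolding one_form_on_dird[OF assms, of "X + X'" Y] one_form_on_dird[OF assms, of X Y]
      one_form_on_dird[OF assms, of X' Y] one_form_on_dird[OF assms, of "r *\<^sub>R X" Y]
    by (simp_all add: inner_add_left scaleR_add_left sum.distrib scaleR_sum_right)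
  show "extd \<omega> x (X + X') Y = extd \<omega> x X Y + extd \<omega> x X' Y" for X X'
    unfolding extd_def add linear_add[OF lin] by (simp add: add_divide_distrib diff_divide_distrib)
  show "extd \<omega> x (r *\<^sub>R X) Y = r *\<^sub>R extd \<omega> x X Y" for r X
    unfolding extd_def scale linear_scale[OF lin]
    by (simp add: scaleR_conv_of_real diff_divide_distrib right_diff_distrib)
qed

lemma extd_antisym: "extd \<omega> x X Y = - extd \<omega> x Y X"
  unfolding extd_def by (simp add: diff_divide_distrib)

lemma extd_self [simp]: "extd \<omega> x X X = 0"
  by (simp add: extd_def)

lemma linear_extd_right:
  fixes \<omega> :: "'a::euclidean_space \<Rightarrow> 'a \<Rightarrow> 'b::real_normed_field"
  assumes "open S" "one_form_on S \<omega>" "x \<in> S"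
  shows "linear (extd \<omega> x X)"
proof -
  have "extd \<omega> x X = (\<lambda>Y. - extd \<omega> x Y X)"
    by (rule ext) (rule extd_antisym)
  then show ?thesis
    using linear_compose_neg[OF linear_extd_left[OF assms, of X]] by simp
qed

lemma smooth_on_extd:
  fixes \<omega> :: "'a::euclidean_space \<Rightarrow> 'a \<Rightarrow> 'b::real_normed_field"
  assumes "open S" "one_form_on S \<omega>"
  shows "smooth_on S (\<lambda>x. extd \<omega> x X Y)"
proof -
  have "smooth_on S (\<lambda>x. (dird (\<lambda>y. \<omega> y Y) x X - dird (\<lambda>y. \<omega> y X) x Y) * (1 / 2))"
    by (intro smooth_on_mult smooth_on_diff smooth_on_const smooth_on_dird
      one_form_on_smooth[OF assms(2)] assms(1))
  then show ?thesis unfolding extd_def by simp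
qed

section \<open>Reeb fields and unitary coframes\<close>

text \<open>
  The contact condition says that the bilinear form $d\theta + \theta \otimes \theta$ is
  nondegenerate; the Reeb field represents \<open>\<theta>\<close> with respect to it.
\<close>

lemma reeb_system:
  fixes \<theta> :: "'a::euclidean_space \<Rightarrow> 'a \<Rightarrow> real"
  assumes U: "open U" and ct: "contact_form U H \<theta>"
  defines "T \<equiv> \<lambda>x X. \<Sum>b\<in>Basis. (extd \<theta> x X b + \<theta> x X * \<theta> x b) *\<^sub>R b"
  shows "one_form_on U T" "x \<in> U \<Longrightarrow> inj (T x)"
    and "x \<in> U \<Longrightarrow> T x X \<bullet> Y = extd \<theta> x X Y + \<theta> x X * \<theta> x Y"
proof -
  have \<theta>: "one_form_on U \<theta>" using ct by (simp add: contact_form_def)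
  have nd: "X = 0" if "x \<in> U" "\<theta> x X = 0" "\<And>Y. extd \<theta> x X Y = 0" for x X
    using ct that by (simp add: contact_form_def)
  note lin\<theta> = one_form_on_linear[OF \<theta>] and linl = linear_extd_left[OF U \<theta>]
    and linr = linear_extd_right[OF U \<theta>]
  have linT: "linear (T x)" if x: "x \<in> U" for x
    by (rule linearI)
      (simp_all add: T_def linear_add[OF linl[OF x]] linear_scale[OF linl[OF x]] linear_add[OF lin\<theta>[OF x]]
        linear_scale[OF lin\<theta>[OF x]] algebra_simps sum.distrib scaleR_sum_right)
  have Tin: "T x X \<bullet> Y = extd \<theta> x X Y + \<theta> x X * \<theta> x Y" if x: "x \<in> U" for x X Y
  proof -
    have "T x X \<bullet> Y = (\<Sum>b\<in>Basis. (Y \<bullet> b) *\<^sub>R extd \<theta> x X b) + \<theta> x X * (\<Sum>b\<in>Basis. (Y \<bullet> b) *\<^sub>R \<theta> x b)"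
      by (simp add: T_def inner_sum_left sum_distrib_left inner_commute[of Y] ring_distribs sum.distrib mult_ac)
    then show ?thesis
      unfolding linear_expand[OF linr[OF x], of X Y, symmetric] linear_expand[OF lin\<theta>[OF x], of Y, symmetric] .
  qed
  show "T x X \<bullet> Y = extd \<theta> x X Y + \<theta> x X * \<theta> x Y" if "x \<in> U" using Tin that .
  have "smooth_on U (\<lambda>x. T x X)" for X
    unfolding T_def
    by (intro smooth_on_sum smooth_on_scaleR smooth_on_add smooth_on_mult smooth_on_const U
      smooth_on_extd \<theta> one_form_on_smooth[OF \<theta>])
  then show "one_form_on U T" using linT by (simp add: one_form_on_def)
  show "inj (T x)" if x: "x \<in> U"
  proof -
    have "X = 0" if "T x X = 0" for X
    proof -
      have *: "extd \<theta> x X Y + \<theta> x X * \<theta> x Y = 0" for Y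
        using Tin[OF x, of X Y] that by simp
      \<comment> \<open>The argument \<open>Y = X\<close> removes the antisymmetric term and leaves
        the square of \<open>\<theta> x X\<close>.\<close>
      from *[of X] have "\<theta> x X = 0" by simp
      with * nd[OF x] show ?thesis by simp
    qed
    then show ?thesis using linear_injective_0[OF linT[OF x]] by blast
  qed
qed

text \<open>An injective endomorphism is surjective, so some \<open>e\<close> satisfies
  d\<theta>(e,-) + \<theta>(e) \<theta> = \<theta>. Evaluating at \<open>e\<close> leaves
  \<theta>(e) = 0 or 1. The value 0 would give d\<theta>(e,-) = \<theta>, which vanishes on the
  contact distribution; nondegeneracy there would force \<open>e = 0\<close> and hence \<theta> =
  0.\<close>

lemma reeb_unique:
  fixes \<theta> :: "'a::euclidean_space \<Rightarrow> 'a \<Rightarrow> real"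
  assumes U: "open U" and ct: "contact_form U H \<theta>" and x: "x \<in> U"
  shows "\<exists>!e. \<theta> x e = 1 \<and> (\<forall>Y. extd \<theta> x e Y = 0)"
proof -
  note T = reeb_system[OF U ct]
  let ?T = "\<lambda>x X. \<Sum>b\<in>Basis. (extd \<theta> x X b + \<theta> x X * \<theta> x b) *\<^sub>R b"
  have \<theta>: "one_form_on U \<theta>" using ct by (simp add: contact_form_def)
  obtain e where e: "?T x e = (\<Sum>b\<in>Basis. \<theta> x b *\<^sub>R b)"
    using linear_injective_imp_surjective[OF one_form_on_linear[OF T(1) x] T(2)[OF x]] 
    unfolding surj_def by metis
  have *: "extd \<theta> x e Y + \<theta> x e * \<theta> x Y = \<theta> x Y" for Y
  proof -
    have "\<theta> x Y = (\<Sum>b\<in>Basis. \<theta> x b *\<^sub>R b) \<bullet> Y"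
      using linear_expand[OF one_form_on_linear[OF \<theta> x], of Y]
      by (simp add: inner_sum_left mult.commute inner_commute[of Y])
    then show ?thesis using T(3)[OF x, of e Y] unfolding e by simp
  qed
  have "\<theta> x e = 1"
  proof (rule ccontr)
    assume "\<theta> x e \<noteq> 1"
    moreover from *[of e] have "\<theta> x e * \<theta> x e = \<theta> x e" by simp
    ultimately have e0: "\<theta> x e = 0" by simp
    with * have "extd \<theta> x e Y = \<theta> x Y" for Y by simp
    with e0 ct x have "e = 0" by (simp add: contact_form_def)
    then have "\<theta> x Y = 0" for Y
      using *[of Y] e0 linear_0[OF linear_extd_left[OF U \<theta> x]] by simp
    with ct x show False by (auto simp: contact_form_def)
  qed
  with * have ex: "\<theta> x e = 1 \<and> (\<forall>Y. extd \<theta> x e Y = 0)" by simp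
  moreover have "d = e" if "\<theta> x d = 1 \<and> (\<forall>Y. extd \<theta> x d Y = 0)" for d
  proof -
    have "?T x d = ?T x e" using ex that by simp
    with T(2)[OF x] show ?thesis by (rule injD)
  qed
  ultimately show ?thesis by (rule ex1I)
qed

lemma reeb:
  fixes \<theta> :: "'a::euclidean_space \<Rightarrow> 'a \<Rightarrow> real"
  assumes "open U" "contact_form U H \<theta>" "x \<in> U"
  shows "\<theta> x (reeb \<theta> x) = 1" "extd \<theta> x (reeb \<theta> x) Y = 0"
proof -
  have "\<theta> x (reeb \<theta> x) = 1 \<and> (\<forall>Y. extd \<theta> x (reeb \<theta> x) Y = 0)"
    unfolding reeb_def by (rule theI'[OF reeb_unique[OF assms]])
  then show "\<theta> x (reeb \<theta> x) = 1" "extd \<theta> x (reeb \<theta> x) Y = 0" by blast+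
qed

lemma smooth_on_reeb:
  fixes \<theta> :: "'a::euclidean_space \<Rightarrow> 'a \<Rightarrow> real"
  assumes U: "open U" and ct: "contact_form U H \<theta>"
  shows "smooth_on U (reeb \<theta>)"
proof (rule linear_system_smooth[OF U reeb_system(1)[OF U ct] reeb_system(2)[OF U ct]])
  show "(\<Sum>b\<in>Basis. (extd \<theta> x (reeb \<theta> x) b + \<theta> x (reeb \<theta> x) * \<theta> x b) *\<^sub>R b)
    = (\<Sum>b\<in>Basis. \<theta> x b *\<^sub>R b)" if "x \<in> U" for x
    using reeb[OF U ct that] by simp
  have "one_form_on U \<theta>" using ct by (simp add: contact_form_def)
  then show "smooth_on U (\<lambda>x. \<Sum>b\<in>Basis. \<theta> x b *\<^sub>R b)"
    by (intro smooth_on_sum smooth_on_scaleR smooth_on_const one_form_on_smooth U)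
qed

text \<open>Cartan's formula, whose exact term drops out because \<open>\<omega>(e)\<close> is constant.\<close>

lemma lie_form_eq_extd:
  fixes \<omega> :: "'a::euclidean_space \<Rightarrow> 'a \<Rightarrow> 'b::real_normed_field"
  assumes "open S" "one_form_on S \<omega>" "x \<in> S" "e differentiable (at x)"
    and c: "\<And>y. y \<in> S \<Longrightarrow> \<omega> y (e y) = c"
  shows "dird (\<lambda>y. \<omega> y Y) x (e x) + \<omega> x (dird e x Y) = 2 * extd \<omega> x (e x) Y"
proof -
  have "((\<lambda>y. c) has_derivative (\<lambda>X. dird (\<lambda>y. \<omega> y (e x)) x X + \<omega> x (dird e x X))) (at x)"
    by (rule has_derivative_transform_within_open[OF
        one_form_apply_has_derivative[OF assms(1-3) has_derivative_dird[OF assms(4)]] assms(1,3) c])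
  from dird_eq[OF this, of Y] have "dird (\<lambda>y. \<omega> y (e x)) x Y = - \<omega> x (dird e x Y)"
    by (simp add: frechet_derivative_const add_eq_0_iff)
  then show ?thesis by (simp add: extd_def)
qed

text \<open>Leibniz rule for the Lie derivative of \<omega>(X) along \<open>e\<close>. The bracketed
  term is the Lie derivative of \<omega> on the constant vector field with value \<open>X x\<close>,
  the form in which \<open>lie_form_eq_extd\<close> computes it.\<close>

lemma form_lie_bracket:
  fixes \<omega> :: "'a::euclidean_space \<Rightarrow> 'a \<Rightarrow> 'b::real_normed_field"
  assumes "open S" "one_form_on S \<omega>" "x \<in> S" "X differentiable (at x)"
    and s: "\<And>y. y \<in> S \<Longrightarrow> \<omega> y (X y) = s y"
  shows "\<omega> x (lie_bracket e X x) =
    dird s x (e x) - (dird (\<lambda>y. \<omega> y (X x)) x (e x) + \<omega> x (dird e x (X x)))"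
proof -
  have "(s has_derivative (\<lambda>Z. dird (\<lambda>y. \<omega> y (X x)) x Z + \<omega> x (dird X x Z))) (at x)"
    by (rule has_derivative_transform_within_open[OF
        one_form_apply_has_derivative[OF assms(1-3) has_derivative_dird[OF assms(4)]] assms(1,3) s])
  from dird_eq[OF this] show ?thesis
    by (simp add: lie_bracket_def linear_diff[OF one_form_on_linear[OF assms(2,3)]])
qed

section \<open>Pseudohermitian calculus in a unitary coframe\<close>

locale unitary_coframe =
  fixes m :: nat and V :: "'a::euclidean_space set" and H :: "'a \<Rightarrow> 'a set" and J :: "'a \<Rightarrow> 'a \<Rightarrow> 'a"
    and \<theta> :: "'a \<Rightarrow> 'a \<Rightarrow> real" and \<phi> h hi \<Gamma> A N
  assumes contact: "contact_form V H \<theta>"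
    and unitary: "unitary m V h"
    and webster_tanaka: "webster_tanaka m V H J \<theta> \<phi> h hi \<Gamma> A N"
begin

abbreviation "e \<equiv> reeb \<theta>"

lemmas webster_tanaka_conj = webster_tanaka[unfolded webster_tanaka_def]

lemmas open_V = webster_tanaka_conj[THEN conjunct1]
  and coframe = webster_tanaka_conj[THEN conjunct2, THEN conjunct1]
  and levi = webster_tanaka_conj[THEN conjunct2, THEN conjunct2, THEN conjunct1]
  and inverse_levi = webster_tanaka_conj[THEN conjunct2, THEN conjunct2, THEN conjunct2, THEN conjunct1]

lemma connection_form: "\<alpha> < m \<Longrightarrow> \<beta> < m \<Longrightarrow> one_form_on V (\<Gamma> \<alpha> \<beta>)"
  and smooth_N: "\<alpha> < m \<Longrightarrow> \<beta> < m \<Longrightarrow> \<gamma> < m \<Longrightarrow> smooth_on V (N \<alpha> \<beta> \<gamma>)"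
  using webster_tanaka_conj[THEN conjunct2, THEN conjunct2, THEN conjunct2, THEN conjunct2, THEN conjunct1] by blast+

lemma parallel_levi:
  "x \<in> V \<Longrightarrow> \<alpha> < m \<Longrightarrow> \<beta> < m \<Longrightarrow> dird (h \<alpha> \<beta>) x X =
     (\<Sum>\<gamma><m. \<Gamma> \<alpha> \<gamma> x X * h \<gamma> \<beta> x + h \<alpha> \<gamma> x * cnj (\<Gamma> \<beta> \<gamma> x X))"
  using webster_tanaka_conj[THEN conjunct2, THEN conjunct2, THEN conjunct2, THEN conjunct2, THEN conjunct2, THEN conjunct1] by blast

lemma structure_equation:
  "x \<in> V \<Longrightarrow> \<alpha> < m \<Longrightarrow> extd (\<phi> \<alpha>) x X Y =
     (\<Sum>\<beta><m. wedge (\<phi> \<beta> x) (\<Gamma> \<beta> \<alpha> x) X Y)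
     + (\<Sum>\<beta><m. A \<alpha> \<beta> x * wedge (\<lambda>X. complex_of_real (\<theta> x X)) (bar (\<phi> \<beta> x)) X Y)
     - 1 / 2 * (\<Sum>\<beta><m. \<Sum>\<gamma><m. N \<beta> \<gamma> \<alpha> x * wedge (bar (\<phi> \<beta> x)) (bar (\<phi> \<gamma> x)) X Y)"
  using webster_tanaka_conj[THEN conjunct2, THEN conjunct2, THEN conjunct2, THEN conjunct2, THEN conjunct2, THEN conjunct2, THEN conjunct1] by blast

lemma theta_form: "one_form_on V \<theta>"
  using contact by (simp add: contact_form_def)

lemma phi_form: "\<alpha> < m \<Longrightarrow> one_form_on V (\<phi> \<alpha>)"
  and phi_reeb: "x \<in> V \<Longrightarrow> \<alpha> < m \<Longrightarrow> \<phi> \<alpha> x (e x) = 0"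
  and phi_J: "x \<in> V \<Longrightarrow> \<alpha> < m \<Longrightarrow> X \<in> H x \<Longrightarrow> \<phi> \<alpha> x (J x X) = \<i> * \<phi> \<alpha> x X"
  and coframe_eq_0: "x \<in> V \<Longrightarrow> \<theta> x X = 0 \<Longrightarrow> (\<And>\<alpha>. \<alpha> < m \<Longrightarrow> \<phi> \<alpha> x X = 0) \<Longrightarrow> X = 0"
  using coframe unfolding adapted_coframe_def by blast+

lemma H_eq: "x \<in> V \<Longrightarrow> H x = {X. \<theta> x X = 0}"
  using contact by (simp add: contact_form_def)

lemma inverse_levi_unitary:
  assumes "x \<in> V" "\<alpha> < m" "\<beta> < m"
  shows "hi \<alpha> \<beta> x = of_bool (\<alpha> = \<beta>)"
proof -
  have "(\<Sum>\<gamma><m. h \<beta> \<gamma> x * hi \<alpha> \<gamma> x) = of_bool (\<beta> = \<alpha>)"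
    using inverse_levi assms by (simp add: inverse_levi_matrix_def)
  moreover have "(\<Sum>\<gamma><m. h \<beta> \<gamma> x * hi \<alpha> \<gamma> x) = (\<Sum>\<gamma><m. if \<gamma> = \<beta> then hi \<alpha> \<beta> x else 0)"
    using unitary assms by (intro sum.cong) (auto simp: unitary_def)
  ultimately show ?thesis using assms by (auto simp: eq_commute)
qed

text \<open>The Levi matrix is constant in a unitary coframe, and the Kronecker deltas leave only
  these two terms of the equation that makes it parallel.\<close>

lemma connection_skew:
  assumes x: "x \<in> V" and "\<alpha> < m" "\<beta> < m"
  shows "\<Gamma> \<alpha> \<beta> x X + cnj (\<Gamma> \<beta> \<alpha> x X) = 0"
proof -
  have "dird (h \<alpha> \<beta>) x X = dird (\<lambda>y. of_bool (\<alpha> = \<beta>) :: complex) x X"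
    using dird_cong[OF open_V x, of "h \<alpha> \<beta>"] unitary assms by (simp add: unitary_def)
  also have "\<dots> = 0" by (simp add: frechet_derivative_const)
  finally have "(\<Sum>\<gamma><m. \<Gamma> \<alpha> \<gamma> x X * h \<gamma> \<beta> x + h \<alpha> \<gamma> x * cnj (\<Gamma> \<beta> \<gamma> x X)) = 0"
    using parallel_levi[OF assms, of X] by simp
  moreover have "(\<Sum>\<gamma><m. \<Gamma> \<alpha> \<gamma> x X * h \<gamma> \<beta> x + h \<alpha> \<gamma> x * cnj (\<Gamma> \<beta> \<gamma> x X)) =
      (\<Sum>\<gamma><m. (if \<gamma> = \<beta> then \<Gamma> \<alpha> \<beta> x X else 0) + (if \<gamma> = \<alpha> then cnj (\<Gamma> \<beta> \<alpha> x X) else 0))"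
    using unitary assms by (intro sum.cong) (auto simp: unitary_def)
  ultimately show ?thesis using assms by (simp add: sum.distrib)
qed

lemma reeb_differentiable: "x \<in> V \<Longrightarrow> e differentiable (at x)"
  by (rule smooth_on_differentiable[OF smooth_on_reeb[OF open_V contact]])

lemma lie_theta:
  "x \<in> V \<Longrightarrow> dird (\<lambda>y. \<theta> y Y) x (e x) + \<theta> x (dird e x Y) = 0"
  using lie_form_eq_extd[OF open_V theta_form _ reeb_differentiable reeb(1)[OF open_V contact]]
    reeb(2)[OF open_V contact] by simp

lemma torsion_unitary:
  assumes "x \<in> V" "\<alpha> < m"
  shows "A_low m h A \<alpha> \<beta> x = cnj (A \<alpha> \<beta> x)"
proof -
  have "(\<Sum>\<gamma><m. h \<gamma> \<alpha> x * A \<gamma> \<beta> x) = (\<Sum>\<gamma><m. if \<gamma> = \<alpha> then A \<alpha> \<beta> x else 0)"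
    using unitary assms by (intro sum.cong) (auto simp: unitary_def)
  then show ?thesis using assms by (simp add: A_low_def)
qed

text \<open>The term in \<open>N\<close> does not contribute since the Reeb field annihilates the \<open>\<phi>\<close>.\<close>

lemma lie_phi:
  assumes tf: "\<And>x \<alpha> \<beta>. x \<in> V \<Longrightarrow> \<alpha> < m \<Longrightarrow> \<beta> < m \<Longrightarrow> A \<alpha> \<beta> x = 0" and x: "x \<in> V" and \<alpha>: "\<alpha> < m"
  shows "dird (\<lambda>y. \<phi> \<alpha> y Y) x (e x) + \<phi> \<alpha> x (dird e x Y) = - (\<Sum>\<beta><m. \<phi> \<beta> x Y * \<Gamma> \<beta> \<alpha> x (e x))"
proof -
  have "extd (\<phi> \<alpha>) x (e x) Y = (\<Sum>\<beta><m. wedge (\<phi> \<beta> x) (\<Gamma> \<beta> \<alpha> x) (e x) Y)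
        + (\<Sum>\<beta><m. A \<alpha> \<beta> x * wedge (\<lambda>X. complex_of_real (\<theta> x X)) (bar (\<phi> \<beta> x)) (e x) Y)
        - 1 / 2 * (\<Sum>\<beta><m. \<Sum>\<gamma><m. N \<beta> \<gamma> \<alpha> x * wedge (bar (\<phi> \<beta> x)) (bar (\<phi> \<gamma> x)) (e x) Y)"
    by (rule structure_equation[OF x \<alpha>])
  also have "\<dots> = (\<Sum>\<beta><m. - (\<phi> \<beta> x Y * \<Gamma> \<beta> \<alpha> x (e x)) / 2) + 0 - 1 / 2 * 0"
    using tf x \<alpha>
    by (intro arg_cong2[of _ _ _ _ "(-)"] arg_cong2[of _ _ _ _ "(+)"] arg_cong2[of _ _ _ _ "(*)"] refl
        sum.cong sum.neutral ballI) (simp_all add: wedge_def phi_reeb mult.commute)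
  finally have "2 * extd (\<phi> \<alpha>) x (e x) Y = - (\<Sum>\<beta><m. \<phi> \<beta> x Y * \<Gamma> \<beta> \<alpha> x (e x))"
    by (simp add: sum_distrib_left sum_negf)
  then show ?thesis
    using lie_form_eq_extd[OF open_V phi_form[OF \<alpha>] x reeb_differentiable[OF x], of 0 Y]
      phi_reeb \<alpha> by simp
qed

text \<open>The Levi form in a unitary coframe, where \<open>2 * odot\<close> of a form and its
  conjugate is twice a real part. Linearity, definiteness and differentiability of \<open>L\<close>
  are all obtained from this explicit expression.\<close>

definition levi_metric :: "'a metric" where
  "levi_metric x X Y = 2 * Re (\<Sum>\<alpha><m. \<phi> \<alpha> x X * cnj (\<phi> \<alpha> x Y))"

lemma levi_metric_alt:
  "levi_metric x X Y = Re (2 * (\<Sum>\<alpha><m. odot (\<phi> \<alpha> x) (bar (\<phi> \<alpha> x)) X Y))"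
proof -
  have "Re (2 * odot (\<phi> \<alpha> x) (bar (\<phi> \<alpha> x)) X Y) = 2 * Re (\<phi> \<alpha> x X * cnj (\<phi> \<alpha> x Y))" for \<alpha>
    by (simp add: odot_def)
  then show ?thesis
    by (simp only: levi_metric_def sum_distrib_left Re_sum)
qed

lemma levi_metric_eq:
  assumes x: "x \<in> V" and U: "V \<subseteq> U" and "levi_form m U H J \<theta> L"
  shows "L x X Y = levi_metric x X Y"
proof -
  have "complex_of_real (L x X Y) = 2 * (\<Sum>\<alpha><m. \<Sum>\<beta><m. h \<alpha> \<beta> x * odot (\<phi> \<alpha> x) (bar (\<phi> \<beta> x)) X Y)"
    using assms open_V coframe levi unfolding levi_form_def by blast
  also have "(\<Sum>\<alpha><m. \<Sum>\<beta><m. h \<alpha> \<beta> x * odot (\<phi> \<alpha> x) (bar (\<phi> \<beta> x)) X Y)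
    = (\<Sum>\<alpha><m. \<Sum>\<beta><m. if \<alpha> = \<beta> then odot (\<phi> \<alpha> x) (bar (\<phi> \<alpha> x)) X Y else 0)"
    using unitary x by (intro sum.cong) (auto simp: unitary_def)
  also have "\<dots> = (\<Sum>\<alpha><m. odot (\<phi> \<alpha> x) (bar (\<phi> \<alpha> x)) X Y)"
    by (intro sum.cong) auto
  finally have "L x X Y = Re (2 * (\<Sum>\<alpha><m. odot (\<phi> \<alpha> x) (bar (\<phi> \<alpha> x)) X Y))"
    by (metis Re_complex_of_real)
  also have "\<dots> = levi_metric x X Y"
    by (rule levi_metric_alt[symmetric])
  finally show ?thesis .
qed

lemma levi_metric_reeb: "x \<in> V \<Longrightarrow> levi_metric x (e x) Y = 0"
  by (simp add: levi_metric_def phi_reeb)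

lemma levi_metric_sym: "levi_metric x X Y = levi_metric x Y X"
  by (simp add: levi_metric_def mult.commute)

lemma linear_levi_metric: "x \<in> V \<Longrightarrow> linear (levi_metric x X)"
  by (rule linearI)
    (simp_all add: levi_metric_def linear_add[OF one_form_on_linear[OF phi_form]] 
      linear_scale[OF one_form_on_linear[OF phi_form]] algebra_simps sum.distrib sum_distrib_left)

lemma levi_metric_pos:
  assumes "x \<in> V" "\<theta> x X = 0" "X \<noteq> 0"
  shows "levi_metric x X X > 0"
proof -
  have *: "levi_metric x X X = 2 * (\<Sum>\<alpha><m. (cmod (\<phi> \<alpha> x X))\<^sup>2)"
    by (simp add: levi_metric_def complex_mult_cnj cmod_power2)
  obtain \<alpha> where "\<alpha> < m" "\<phi> \<alpha> x X \<noteq> 0" using coframe_eq_0 assms by blast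
  then have "(\<Sum>\<alpha><m. (cmod (\<phi> \<alpha> x X))\<^sup>2) > 0" by (intro sum_pos2[of _ \<alpha>]) auto
  with * show ?thesis by simp
qed

lemma levi_metric_has_derivative:
  assumes "x \<in> V"
  shows "((\<lambda>y. levi_metric y X Y) has_derivative (\<lambda>Z. 2 * Re (\<Sum>\<alpha><m.
    \<phi> \<alpha> x X * cnj (dird (\<lambda>y. \<phi> \<alpha> y Y) x Z) + dird (\<lambda>y. \<phi> \<alpha> y X) x Z * cnj (\<phi> \<alpha> x Y)))) (at x)"
  unfolding levi_metric_def
  by (intro has_derivative_mult_right has_derivative_Re has_derivative_sum has_derivative_mult
      has_derivative_cnj has_derivative_dird one_form_on_differentiable[OF phi_form assms]) auto

lemma lie_levi_metric:
  assumes tf: "\<And>x \<alpha> \<beta>. x \<in> V \<Longrightarrow> \<alpha> < m \<Longrightarrow> \<beta> < m \<Longrightarrow> A \<alpha> \<beta> x = 0" and x: "x \<in> V"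
  shows "lie_metric e levi_metric x X Y = 0"
proof -
  let ?G = "\<lambda>\<beta> \<alpha>. \<Gamma> \<beta> \<alpha> x (e x)"
  let ?l = "\<lambda>\<alpha> Y. dird (\<lambda>y. \<phi> \<alpha> y Y) x (e x) + \<phi> \<alpha> x (dird e x Y)"
  have "lie_metric e levi_metric x X Y = 2 * Re (\<Sum>\<alpha><m. ?l \<alpha> X * cnj (\<phi> \<alpha> x Y) + \<phi> \<alpha> x X * cnj (?l \<alpha> Y))"
    unfolding lie_metric_def dird_eq[OF levi_metric_has_derivative[OF x]]
    by (simp add: levi_metric_def algebra_simps sum.distrib)
  also have "(\<Sum>\<alpha><m. ?l \<alpha> X * cnj (\<phi> \<alpha> x Y) + \<phi> \<alpha> x X * cnj (?l \<alpha> Y)) =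
     (\<Sum>\<alpha><m. (- (\<Sum>\<beta><m. \<phi> \<beta> x X * ?G \<beta> \<alpha>)) * cnj (\<phi> \<alpha> x Y) +
        \<phi> \<alpha> x X * cnj (- (\<Sum>\<beta><m. \<phi> \<beta> x Y * ?G \<beta> \<alpha>)))"
    using lie_phi[OF tf x] by simp
  also have "\<dots> = - ((\<Sum>\<alpha><m. \<Sum>\<beta><m. \<phi> \<beta> x X * ?G \<beta> \<alpha> * cnj (\<phi> \<alpha> x Y)) +
     (\<Sum>\<alpha><m. \<Sum>\<beta><m. \<phi> \<alpha> x X * cnj (\<phi> \<beta> x Y) * cnj (?G \<beta> \<alpha>)))"
    by (simp add: sum.distrib sum_distrib_left sum_distrib_right sum_negf sum_subtractf algebra_simps)
  \<comment> \<open>Exchanging the summation indices pairs every coefficient with the conjugate of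
    its transpose, so that \<open>connection_skew\<close> applies term by term.\<close>
  also have "(\<Sum>\<alpha><m. \<Sum>\<beta><m. \<phi> \<alpha> x X * cnj (\<phi> \<beta> x Y) * cnj (?G \<beta> \<alpha>)) =
     (\<Sum>\<alpha><m. \<Sum>\<beta><m. \<phi> \<beta> x X * cnj (\<phi> \<alpha> x Y) * cnj (?G \<alpha> \<beta>))"
    by (rule sum.swap)
  also have "(\<Sum>\<alpha><m. \<Sum>\<beta><m. \<phi> \<beta> x X * ?G \<beta> \<alpha> * cnj (\<phi> \<alpha> x Y)) + \<dots> =
     (\<Sum>\<alpha><m. \<Sum>\<beta><m. \<phi> \<beta> x X * cnj (\<phi> \<alpha> x Y) * (?G \<beta> \<alpha> + cnj (?G \<alpha> \<beta>)))"
    by (simp add: algebra_simps sum.distrib)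
  also have "\<dots> = 0"
    using connection_skew[OF x] by simp
  finally show ?thesis by simp
qed

text \<open>No derivative of \<open>J\<close> is taken: \<open>J\<close> enters only through
  \<phi>(JX) = i \<phi>(X). The Lie derivative of each \<open>\<phi> \<alpha>\<close> along
  \<open>e\<close> combines the \<phi> without their conjugates, hence commutes with multiplication
  by i; a torsion term would bring in conjugates, which pick up -i instead. The vector identity is
  then tested against \<theta> and the \<phi>.\<close>

lemma reeb_symmetry:
  assumes tf: "\<And>x \<alpha> \<beta>. x \<in> V \<Longrightarrow> \<alpha> < m \<Longrightarrow> \<beta> < m \<Longrightarrow> A \<alpha> \<beta> x = 0" and x: "x \<in> V"
    and W: "open W" "x \<in> W" and X: "smooth_on W X" "\<And>y. y \<in> W \<Longrightarrow> X y \<in> H y"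
    and J: "\<And>y Y. y \<in> V \<Longrightarrow> Y \<in> H y \<Longrightarrow> J y Y \<in> H y"
    and JX: "smooth_on W (\<lambda>y. J y (X y))"
  shows "lie_bracket e X x \<in> H x"
    and "lie_bracket e (\<lambda>y. J y (X y)) x = J x (lie_bracket e X x)"
proof -
  have o: "open (V \<inter> W)" "x \<in> V \<inter> W" using open_V W x by auto
  note \<theta>f = one_form_on_subset[OF theta_form Int_lower1[of V W]]
    and \<phi>f = one_form_on_subset[OF phi_form Int_lower1[of V W]]
  have H: "lie_bracket e Z x \<in> H x" if Z: "smooth_on W Z" "\<And>y. y \<in> V \<inter> W \<Longrightarrow> Z y \<in> H y" for Z
  proof -
    have "\<theta> x (lie_bracket e Z x) = 0"
      using form_lie_bracket[OF o(1) \<theta>f o(2) smooth_on_differentiable[OF Z(1) W(2)], of "\<lambda>_. 0" e]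
        Z(2) H_eq lie_theta[OF x, of "Z x"] by (auto simp: frechet_derivative_const)
    then show ?thesis using H_eq x by simp
  qed
  show XH: "lie_bracket e X x \<in> H x" using H X by simp
  have JXH: "lie_bracket e (\<lambda>y. J y (X y)) x \<in> H x" using H[OF JX] J X by simp
  have \<phi>: "\<phi> \<alpha> x (lie_bracket e (\<lambda>y. J y (X y)) x) = \<phi> \<alpha> x (J x (lie_bracket e X x))" if \<alpha>: "\<alpha> < m" for \<alpha>
  proof -
    let ?s = "\<lambda>y. \<phi> \<alpha> y (X y)"
    have "((\<lambda>y. \<phi> \<alpha> y (X y)) has_derivative 
        (\<lambda>Z. dird (\<lambda>y. \<phi> \<alpha> y (X x)) x Z + \<phi> \<alpha> x (dird X x Z))) (at x)"
      by (rule one_form_apply_has_derivative[OF o(1) \<phi>f[OF \<alpha>] o(2)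
          has_derivative_dird[OF smooth_on_differentiable[OF X(1) W(2)]]])
    then have ds: "?s differentiable (at x)" by (auto simp: differentiable_def)
    have dis: "dird (\<lambda>y. \<i> * ?s y) x Z = \<i> * dird ?s x Z" for Z
      by (rule dird_eq[OF has_derivative_mult_right[OF has_derivative_dird[OF ds]]])
    have "\<phi> \<alpha> x (lie_bracket e (\<lambda>y. J y (X y)) x) = \<i> * dird ?s x (e x) +
        (\<Sum>\<beta><m. \<phi> \<beta> x (J x (X x)) * \<Gamma> \<beta> \<alpha> x (e x))"
      using form_lie_bracket[OF o(1) \<phi>f[OF \<alpha>] o(2) smooth_on_differentiable[OF JX W(2)], of "\<lambda>y. \<i> * ?s y" e]
        lie_phi[OF tf x \<alpha>] phi_J[OF _ \<alpha>] X(2) by (simp add: dis)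
    also have "(\<Sum>\<beta><m. \<phi> \<beta> x (J x (X x)) * \<Gamma> \<beta> \<alpha> x (e x)) = \<i> * (\<Sum>\<beta><m. \<phi> \<beta> x (X x) * \<Gamma> \<beta> \<alpha> x (e x))"
      using phi_J[OF x] X(2)[OF W(2)] by (simp add: sum_distrib_left mult.assoc)
    also have "(\<Sum>\<beta><m. \<phi> \<beta> x (X x) * \<Gamma> \<beta> \<alpha> x (e x)) = \<phi> \<alpha> x (lie_bracket e X x) - dird ?s x (e x)"
      using form_lie_bracket[OF o(1) \<phi>f[OF \<alpha>] o(2) smooth_on_differentiable[OF X(1) W(2)], of ?s e]
        lie_phi[OF tf x \<alpha>] by simp
    finally show ?thesis using phi_J[OF x \<alpha> XH] by (simp add: algebra_simps)
  qed
  have "lie_bracket e (\<lambda>y. J y (X y)) x - J x (lie_bracket e X x) = 0"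
  proof (rule coframe_eq_0[OF x])
    show "\<theta> x (lie_bracket e (\<lambda>y. J y (X y)) x - J x (lie_bracket e X x)) = 0"
      using J[OF x XH] JXH H_eq[OF x] linear_diff[OF one_form_on_linear[OF theta_form x]] by simp
    show "\<phi> \<alpha> x (lie_bracket e (\<lambda>y. J y (X y)) x - J x (lie_bracket e X x)) = 0" if "\<alpha> < m" for \<alpha>
      using \<phi>[OF that] linear_diff[OF one_form_on_linear[OF phi_form[OF that] x]] by simp
  qed
  then show "lie_bracket e (\<lambda>y. J y (X y)) x = J x (lie_bracket e X x)" by simp
qed

text \<open>The Webster scalar is defined through the dual frame, a definite description. Tracing
  the Einstein equation turns it into a polynomial in the components of \<open>h\<close>,
  \<open>hi\<close>, \<open>N\<close> and their conjugates, from which the smoothness required of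
  the gauge field can be read off.\<close>

lemma webster_sc_eq:
  assumes "CR_einstein_equations m V \<theta> \<phi> h hi \<Gamma> A N \<Lambda>" and x: "x \<in> V"
  shows "webster_sc m \<theta> \<phi> hi \<Gamma> x = (\<Sum>\<gamma><m. (\<Sum>\<delta><m. \<Sum>\<epsilon><m.
    N_low m h N \<gamma> \<delta> \<epsilon> x * N_up m hi (N_low m h N) \<gamma> \<delta> \<epsilon> x) + complex_of_real \<Lambda>)"
  unfolding webster_sc_def
proof (rule sum.cong[OF refl])
  fix \<gamma> assume "\<gamma> \<in> {..<m}"
  then have "webster_ric m \<theta> \<phi> hi \<Gamma> \<gamma> \<gamma> x - (\<Sum>\<delta><m. \<Sum>\<epsilon><m.
      N_low m h N \<gamma> \<delta> \<epsilon> x * N_up m hi (N_low m h N) \<gamma> \<delta> \<epsilon> x) = complex_of_real \<Lambda> * of_bool (\<gamma> = \<gamma>)"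
    using assms unfolding CR_einstein_equations_def Let_def by blast
  then show "webster_ric m \<theta> \<phi> hi \<Gamma> \<gamma> \<gamma> x = (\<Sum>\<delta><m. \<Sum>\<epsilon><m.
      N_low m h N \<gamma> \<delta> \<epsilon> x * N_up m hi (N_low m h N) \<gamma> \<delta> \<epsilon> x) + complex_of_real \<Lambda>"
    by (simp add: algebra_simps)
qed

lemma smooth_webster_sc:
  assumes "CR_einstein_equations m V \<theta> \<phi> h hi \<Gamma> A N \<Lambda>"
  shows "smooth_on V (webster_sc m \<theta> \<phi> hi \<Gamma>)"
proof -
  note cnj = smooth_on_bounded_linear[OF open_V bounded_linear_cnj]
  have h: "smooth_on V (h \<alpha> \<beta>)" if "\<alpha> < m" "\<beta> < m" for \<alpha> \<beta>
    using levi that by (simp add: levi_matrix_def)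
  \<comment> \<open>\<open>inverse_levi_matrix\<close> is a pointwise condition; smoothness comes
    from unitarity, which makes \<open>hi\<close> constant on \<open>V\<close>.\<close>
  have hi: "smooth_on V (hi \<alpha> \<beta>)" if "\<alpha> < m" "\<beta> < m" for \<alpha> \<beta>
    by (rule smooth_on_cong[OF open_V _ smooth_on_const[of V "of_bool (\<alpha> = \<beta>)"]])
      (simp add: inverse_levi_unitary that)
  have T: "smooth_on V (N_low m h N \<alpha> \<beta> \<gamma>)" if "\<alpha> < m" "\<beta> < m" "\<gamma> < m" for \<alpha> \<beta> \<gamma>
    unfolding N_low_def
    by (intro cnj smooth_on_sum smooth_on_mult open_V h smooth_N) (use that in auto)
  have "smooth_on V (N_up m hi (N_low m h N) \<alpha> \<beta> \<gamma>)" if "\<alpha> < m" "\<beta> < m" "\<gamma> < m" for \<alpha> \<beta> \<gamma>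
    unfolding N_up_def
    by (intro smooth_on_sum smooth_on_mult cnj open_V hi T) (use that in auto)
  then have "smooth_on V (\<lambda>x. \<Sum>\<gamma><m. (\<Sum>\<delta><m. \<Sum>\<epsilon><m.
    N_low m h N \<gamma> \<delta> \<epsilon> x * N_up m hi (N_low m h N) \<gamma> \<delta> \<epsilon> x) + complex_of_real \<Lambda>)"
    by (intro smooth_on_sum smooth_on_add smooth_on_mult smooth_on_const open_V T) auto
  then show ?thesis
    by (rule smooth_on_cong[OF open_V, rotated]) (simp add: webster_sc_eq[OF assms])
qed

end

section \<open>Metrics over an almost CR--Einstein structure\<close>

lemma unitary_coframe_local:
  assumes cr: "almost_CR_einstein m U H J \<theta> \<Lambda>" and x: "x \<in> U"
  obtains V \<phi> h hi \<Gamma> A N where "x \<in> V" "V \<subseteq> U" "unitary_coframe m V H J \<theta> \<phi> h hi \<Gamma> A N"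
    "\<And>y \<alpha> \<beta>. y \<in> V \<Longrightarrow> \<alpha> < m \<Longrightarrow> \<beta> < m \<Longrightarrow> A \<alpha> \<beta> y = 0"
    "CR_einstein_equations m V \<theta> \<phi> h hi \<Gamma> A N \<Lambda>"
proof -
  obtain V \<phi> h hi \<Gamma> A N where V: "x \<in> V" "V \<subseteq> U" "unitary m V h"
      and wt: "webster_tanaka m V H J \<theta> \<phi> h hi \<Gamma> A N"
    using cr x unfolding almost_CR_einstein_def by blast
  have eq: "CR_einstein_equations m V \<theta> \<phi> h hi \<Gamma> A N \<Lambda>"
    using cr V wt unfolding almost_CR_einstein_def by blast
  have ct: "contact_form U H \<theta>"
    using cr unfolding almost_CR_einstein_def by blast
  then have "contact_form V H \<theta>"
    using V(2) one_form_on_subset[of U \<theta> V] unfolding contact_form_def by blast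
  then interpret unitary_coframe m V H J \<theta> \<phi> h hi \<Gamma> A N
    using V(3) wt by unfold_locales
  \<comment> \<open>The Einstein equations concern the lowered torsion; in a unitary coframe
    lowering the index is mere conjugation.\<close>
  have "A \<alpha> \<beta> y = 0" if "y \<in> V" "\<alpha> < m" "\<beta> < m" for y \<alpha> \<beta>
    using eq torsion_unitary[OF that(1,2), of \<beta>] that unfolding CR_einstein_equations_def Let_def by simp
  then show thesis using that V eq unitary_coframe_axioms by blast
qed

locale cr_einstein =
  fixes m :: nat and U :: "'a::euclidean_space set" and H :: "'a \<Rightarrow> 'a set" and J :: "'a \<Rightarrow> 'a \<Rightarrow> 'a"
    and \<theta> :: "'a \<Rightarrow> 'a \<Rightarrow> real" and \<Lambda>u :: real and L :: "'a metric"
  assumes cr: "almost_CR_einstein m U H J \<theta> \<Lambda>u" and levi_form: "levi_form m U H J \<theta> L"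
begin

lemma contact_CR: "contact_almost_CR m U H J" and contact: "contact_form U H \<theta>"
  using cr unfolding almost_CR_einstein_def by blast+

lemma open_U: "open U" and bundle_J: "bundle_complex_structure U H J"
  using contact_CR unfolding contact_almost_CR_def by blast+

lemma theta_form: "one_form_on U \<theta>"
  using contact by (simp add: contact_form_def)

lemmas theta_reeb [simp] = reeb(1)[OF open_U contact]

lemmas reeb_differentiable = smooth_on_differentiable[OF smooth_on_reeb[OF open_U contact]]

lemma coframe_ex:
  assumes "x \<in> U"
  shows "\<exists>V \<phi> h hi \<Gamma> A N. x \<in> V \<and> V \<subseteq> U \<and> unitary_coframe m V H J \<theta> \<phi> h hi \<Gamma> A N \<and>
    (\<forall>y \<alpha> \<beta>. y \<in> V \<longrightarrow> \<alpha> < m \<longrightarrow> \<beta> < m \<longrightarrow> A \<alpha> \<beta> y = 0) \<and>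
    CR_einstein_equations m V \<theta> \<phi> h hi \<Gamma> A N \<Lambda>u \<and>
    (\<forall>y X Y. y \<in> V \<longrightarrow> L y X Y = unitary_coframe.levi_metric m \<phi> y X Y)"
proof -
  obtain V \<phi> h hi \<Gamma> A N where V: "x \<in> V" "V \<subseteq> U"
    and uc: "unitary_coframe m V H J \<theta> \<phi> h hi \<Gamma> A N"
    and tf: "\<forall>y \<alpha> \<beta>. y \<in> V \<longrightarrow> \<alpha> < m \<longrightarrow> \<beta> < m \<longrightarrow> A \<alpha> \<beta> y = 0"
    and eq: "CR_einstein_equations m V \<theta> \<phi> h hi \<Gamma> A N \<Lambda>u"
    using unitary_coframe_local[OF cr assms] by metis
  have "L y X Y = unitary_coframe.levi_metric m \<phi> y X Y" if "y \<in> V" for y X Y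
    by (rule unitary_coframe.levi_metric_eq[OF uc that V(2) levi_form])
  with V uc tf eq show ?thesis by metis
qed

text \<open>Each claim depends only on a neighbourhood of \<open>x\<close>, where \<open>L\<close>
  coincides with the \<open>levi_metric\<close> of a unitary coframe.\<close>

lemma
  assumes x: "x \<in> U"
  shows linear_L: "linear (L x X)" and L_sym: "L x X Y = L x Y X" and L_reeb: "L x (reeb \<theta> x) Y = 0"
    and L_pos: "\<theta> x X = 0 \<Longrightarrow> X \<noteq> 0 \<Longrightarrow> L x X X > 0"
    and differentiable_L: "(\<lambda>y. L y X Y) differentiable (at x)"
    and lie_L: "lie_metric (reeb \<theta>) L x X Y = 0"
    and lie_theta: "dird (\<lambda>y. \<theta> y X) x (reeb \<theta> x) = - \<theta> x (dird (reeb \<theta>) x X)"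
proof -
  obtain V \<phi> h hi \<Gamma> A N where V: "x \<in> V" "V \<subseteq> U"
    and "unitary_coframe m V H J \<theta> \<phi> h hi \<Gamma> A N"
    and tf: "\<And>y \<alpha> \<beta>. y \<in> V \<Longrightarrow> \<alpha> < m \<Longrightarrow> \<beta> < m \<Longrightarrow> A \<alpha> \<beta> y = 0"
    and L: "\<And>y X Y. y \<in> V \<Longrightarrow> L y X Y = unitary_coframe.levi_metric m \<phi> y X Y"
    using coframe_ex[OF x] by metis
  then interpret V: unitary_coframe m V H J \<theta> \<phi> h hi \<Gamma> A N by simp
  have Lx: "L x = V.levi_metric x" using L[OF V(1)] by blast
  show "linear (L x X)" "L x X Y = L x Y X" "L x (reeb \<theta> x) Y = 0"
    "\<theta> x X = 0 \<Longrightarrow> X \<noteq> 0 \<Longrightarrow> L x X X > 0"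
    unfolding Lx using V(1) V.linear_levi_metric V.levi_metric_sym V.levi_metric_reeb V.levi_metric_pos
    by blast+
  have "(\<lambda>y. V.levi_metric y X Y) differentiable (at x)"
    using V.levi_metric_has_derivative[OF V(1)] unfolding differentiable_def by blast
  then show "(\<lambda>y. L y X Y) differentiable (at x)"
    by (rule differentiable_cong[OF V.open_V V(1), rotated]) (simp add: L)
  have "dird (\<lambda>y. L y X Y) x = dird (\<lambda>y. V.levi_metric y X Y) x"
    by (rule dird_cong[OF V.open_V V(1) L])
  then show "lie_metric (reeb \<theta>) L x X Y = 0"
    using V.lie_levi_metric[OF tf V(1), of X Y] by (simp add: lie_metric_def Lx)
  show "dird (\<lambda>y. \<theta> y X) x (reeb \<theta> x) = - \<theta> x (dird (reeb \<theta>) x X)"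
    using V.lie_theta[OF V(1), of X] by simp
qed

lemma transverse_symmetry: "transverse_infinitesimal_symmetry U H J (reeb \<theta>)"
  unfolding transverse_infinitesimal_symmetry_def infinitesimal_symmetry_def
proof (intro conjI allI impI ballI exI[of _ \<theta>])
  show "smooth_on U (reeb \<theta>)" by (rule smooth_on_reeb[OF open_U contact])
  show "contact_form U H \<theta>" by (rule contact)
  fix W X x assume X: "local_section U H W X" and xW: "x \<in> W"
  then have W: "open W" "W \<subseteq> U" "smooth_on W X" "\<And>y. y \<in> W \<Longrightarrow> X y \<in> H y"
    by (auto simp: local_section_def)
  have x: "x \<in> U" using W xW by blast
  have JX: "smooth_on W (\<lambda>y. J y (X y))"
    using bundle_J X unfolding bundle_complex_structure_def by blast
  obtain V \<phi> h hi \<Gamma> A N where V: "x \<in> V" "V \<subseteq> U"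
    and "unitary_coframe m V H J \<theta> \<phi> h hi \<Gamma> A N"
    and tf: "\<And>y \<alpha> \<beta>. y \<in> V \<Longrightarrow> \<alpha> < m \<Longrightarrow> \<beta> < m \<Longrightarrow> A \<alpha> \<beta> y = 0"
    and L: "\<And>y X Y. y \<in> V \<Longrightarrow> L y X Y = unitary_coframe.levi_metric m \<phi> y X Y"
    using coframe_ex[OF x] by metis
  then interpret V: unitary_coframe m V H J \<theta> \<phi> h hi \<Gamma> A N by simp
  have J: "J y Y \<in> H y" if "y \<in> V" "Y \<in> H y" for y Y
    using bundle_J that V(2) unfolding bundle_complex_structure_def by blast
  show "lie_bracket (reeb \<theta>) X x \<in> H x"
    "lie_bracket (reeb \<theta>) (\<lambda>y. J y (X y)) x = J x (lie_bracket (reeb \<theta>) X x)"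
    using V.reeb_symmetry[OF tf V(1) W(1) xW W(3,4) J JX] by blast+
qed simp

end

section \<open>The metric on the strip and its Killing field\<close>

lemma sharp_eq:
  assumes "\<And>Z. linear (\<lambda>X. g x X Z)" "\<And>X. (\<And>Z. g x X Z = 0) \<Longrightarrow> X = 0" "\<And>Z. g x v Z = \<alpha> Z"
  shows "sharp g x \<alpha> = v"
  unfolding sharp_def
proof (rule the_equality)
  fix w assume "\<forall>Z. g x w Z = \<alpha> Z"
  then have "g x (w - v) Z = 0" for Z
    using assms(3) linear_diff[OF assms(1)[of Z], of w v] by simp
  then show "w = v" using assms(2)[of "w - v"] by simp
qed (use assms(3) in simp)

text \<open>The profile \<open>l\<close> stands for \<open>\<lambda>_0\<close> and is kept abstract,
  since the Killing property holds for every differentiable profile. The factor 4 combines the 2 of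
  the normal form with the 2 in \<kappa> = 2 \<theta>.\<close>

locale strip_metric = cr_einstein m U H J \<theta> \<Lambda>u L
  for m and U :: "'a::euclidean_space set" and H J \<theta> \<Lambda>u L +
  fixes l :: "real \<Rightarrow> real" and g :: "(real \<times> 'a) metric"
  assumes differentiable_l: "l differentiable (at t)"
    and g: "g p X Y = 4 * odot (\<lambda>Z. \<theta> (snd p) (snd Z)) (\<lambda>Z. fst Z + l (fst p) * \<theta> (snd p) (snd Z)) X Y
              + L (snd p) (snd X) (snd Y)"
begin

lemma open_strip: "open (strip U)"
  unfolding strip_def by (intro open_Times open_U) simp

lemma snd_strip: "p \<in> strip U \<Longrightarrow> snd p \<in> U"
  by (auto simp: strip_def)

lemma g_expand:
  "g p X Y = 2 * \<theta> (snd p) (snd X) * fst Y + 2 * fst X * \<theta> (snd p) (snd Y)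
     + 4 * l (fst p) * \<theta> (snd p) (snd X) * \<theta> (snd p) (snd Y) + L (snd p) (snd X) (snd Y)"
  by (simp add: g odot_def field_simps)

lemma g_sym: "p \<in> strip U \<Longrightarrow> g p X Y = g p Y X"
  using L_sym[OF snd_strip] by (simp add: g_expand)

lemma linear_g: "p \<in> strip U \<Longrightarrow> linear (g p X)"
  by (rule linearI)
    (simp_all add: g_expand linear_add[OF one_form_on_linear[OF theta_form snd_strip]]
      linear_scale[OF one_form_on_linear[OF theta_form snd_strip]]
      linear_add[OF linear_L[OF snd_strip]] linear_scale[OF linear_L[OF snd_strip]] algebra_simps)

lemma linear_g_left: "p \<in> strip U \<Longrightarrow> linear (\<lambda>X. g p X Y)"
  using linear_g[of p Y] g_sym[of p _ Y] by simp

lemma theta_0: "p \<in> strip U \<Longrightarrow> \<theta> (snd p) 0 = 0" and L_0: "p \<in> strip U \<Longrightarrow> L (snd p) X 0 = 0"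
  using linear_0[OF one_form_on_linear[OF theta_form snd_strip]] linear_0[OF linear_L[OF snd_strip]]
  by blast+

text \<open>Pairing with \<open>(1, 0)\<close> detects \<open>\<theta> (snd X)\<close>; once this
  vanishes, pairing with the Reeb direction detects \<open>fst X\<close>; the rest lies in the
  kernel of \<theta>, where \<open>L\<close> is definite.\<close>

lemma g_nondegenerate:
  assumes p: "p \<in> strip U" and 0: "\<And>Z. g p X Z = 0"
  shows "X = 0"
proof -
  have t: "\<theta> (snd p) (snd X) = 0"
    using 0[of "(1, 0)"] by (simp add: g_expand theta_0[OF p] L_0[OF p])
  have f: "fst X = 0"
    using 0[of "(0, reeb \<theta> (snd p))"] t snd_strip[OF p] L_sym[OF snd_strip[OF p]] L_reeb[OF snd_strip[OF p]]
    by (simp add: g_expand)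
  have "L (snd p) (snd X) (snd X) = 0"
    using 0[of X] t by (simp add: g_expand)
  with L_pos[OF snd_strip[OF p] t] have "snd X = 0" by force
  with f show ?thesis by (simp add: prod_eq_iff)
qed

text \<open>The factor 1/2 is forced by \<kappa> = 2 \<theta>: the product with
  \<open>(1, 0)\<close> is twice the value of \<theta> and has to be 1. The multiple of \<kappa>
  added to \<lambda> in \<alpha> is exactly the one for which the first component is 0.\<close>

abbreviation k :: "real \<times> 'a \<Rightarrow> real \<times> 'a" where
  "k p \<equiv> (0, (1 / 2) *\<^sub>R reeb \<theta> (snd p))"

lemma theta_k: "p \<in> strip U \<Longrightarrow> \<theta> (snd p) ((1 / 2) *\<^sub>R reeb \<theta> (snd p)) = 1 / 2"
  using linear_scale[OF one_form_on_linear[OF theta_form snd_strip], of p "1 / 2" "reeb \<theta> (snd p)"]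
    snd_strip[of p] by simp

lemma L_k: "p \<in> strip U \<Longrightarrow> L (snd p) ((1 / 2) *\<^sub>R reeb \<theta> (snd p)) Y = 0"
  using linear_scale[OF linear_L[OF snd_strip], of p Y "1 / 2" "reeb \<theta> (snd p)"]
    L_sym[OF snd_strip] L_reeb[OF snd_strip] by simp

lemma g_k: "p \<in> strip U \<Longrightarrow> g p (k p) Z = fst Z + 2 * l (fst p) * \<theta> (snd p) (snd Z)"
  by (simp add: g_expand theta_k L_k)

lemma g_k_k: "p \<in> strip U \<Longrightarrow> g p (k p) (k p) = l (fst p)"
  by (simp add: g_k theta_k)

lemma sharp_k: "p \<in> strip U \<Longrightarrow> (\<And>Z. \<alpha> Z = fst Z + 2 * l (fst p) * \<theta> (snd p) (snd Z)) \<Longrightarrow> sharp g p \<alpha> = k p"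
  using sharp_eq[of g p "k p" \<alpha>, OF linear_g_left g_nondegenerate] g_k by simp

lemma k_has_derivative:
  assumes p: "p \<in> strip U"
  shows "(k has_derivative (\<lambda>X. (0, (1 / 2) *\<^sub>R dird (reeb \<theta>) (snd p) (snd X)))) (at p)"
  by (auto intro!: derivative_eq_intros has_derivative_compose[of snd snd _ _ "reeb \<theta>"]
      has_derivative_dird reeb_differentiable snd_strip p)

lemma smooth_k: "smooth_on (strip U) k"
proof -
  have "smooth_on (snd -` U) (\<lambda>p. reeb \<theta> (snd p))"
    by (rule smooth_on_compose_linear[OF open_U bounded_linear_snd smooth_on_reeb[OF open_U contact]])
  then have "smooth_on (strip U) (\<lambda>p. reeb \<theta> (snd p))"
    by (rule smooth_on_subset) (auto simp: strip_def)
  then show ?thesis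
    by (rule smooth_on_bounded_linear[OF open_strip, rotated])
      (intro bounded_linear_intros)
qed

lemma g_has_derivative:
  assumes p: "p \<in> strip U"
  shows "((\<lambda>q. g q X Y) has_derivative (\<lambda>Z.
     2 * dird (\<lambda>y. \<theta> y (snd X)) (snd p) (snd Z) * fst Y
     + 2 * fst X * dird (\<lambda>y. \<theta> y (snd Y)) (snd p) (snd Z)
     + 4 * dird l (fst p) (fst Z) * \<theta> (snd p) (snd X) * \<theta> (snd p) (snd Y)
     + 4 * l (fst p) * (dird (\<lambda>y. \<theta> y (snd X)) (snd p) (snd Z) * \<theta> (snd p) (snd Y)
         + \<theta> (snd p) (snd X) * dird (\<lambda>y. \<theta> y (snd Y)) (snd p) (snd Z))
     + dird (\<lambda>y. L y (snd X) (snd Y)) (snd p) (snd Z))) (at p)"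
proof -
  note x = snd_strip[OF p]
  have [derivative_intros]: "((\<lambda>q. \<theta> (snd q) W) has_derivative (\<lambda>Z. dird (\<lambda>y. \<theta> y W) (snd p) (snd Z))) (at p)" for W
    by (auto intro!: has_derivative_compose[of snd snd _ _ "\<lambda>y. \<theta> y W"] derivative_eq_intros
        has_derivative_dird one_form_on_differentiable[OF theta_form x])
  have [derivative_intros]: "((\<lambda>q. L (snd q) (snd X) (snd Y)) has_derivative 
      (\<lambda>Z. dird (\<lambda>y. L y (snd X) (snd Y)) (snd p) (snd Z))) (at p)"
    by (auto intro!: has_derivative_compose[of snd snd _ _ "\<lambda>y. L y (snd X) (snd Y)"] derivative_eq_intros
        has_derivative_dird differentiable_L[OF x])
  have [derivative_intros]: "((\<lambda>q. l (fst q)) has_derivative (\<lambda>Z. dird l (fst p) (fst Z))) (at p)"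
    by (auto intro!: has_derivative_compose[of fst fst _ _ l] derivative_eq_intros
        has_derivative_dird differentiable_l)
  show ?thesis
    unfolding g_expand by (rule derivative_eq_intros refl)+ (simp add: fun_eq_iff algebra_simps)
qed

lemma lie_g:
  assumes p: "p \<in> strip U"
  shows "lie_metric k g p X Y = 0"
proof -
  note x = snd_strip[OF p]
  let ?e = "reeb \<theta> (snd p)" and ?D = "dird (reeb \<theta>) (snd p)"
  have sc: "dird f x ((1 / 2) *\<^sub>R Z) = (1 / 2) * dird f x Z" if "f differentiable (at x)" for f :: "'a \<Rightarrow> real" and x Z
    using linear_scale[OF linear_dird[OF that]] by simp
  have d\<theta>: "dird (\<lambda>y. \<theta> y W) (snd p) ((1 / 2) *\<^sub>R ?e) = - \<theta> (snd p) (?D W) / 2" for W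
    using sc[OF one_form_on_differentiable[OF theta_form x], of W ?e] lie_theta[OF x, of W] by simp
  have dL: "dird (\<lambda>y. L y (snd X) (snd Y)) (snd p) ((1 / 2) *\<^sub>R ?e)
      = - (L (snd p) (?D (snd X)) (snd Y) + L (snd p) (snd X) (?D (snd Y))) / 2"
    using sc[OF differentiable_L[OF x], of "snd X" "snd Y" ?e] lie_L[OF x, of "snd X" "snd Y"] by (simp add: lie_metric_def)
  have \<theta>s: "\<theta> (snd p) ((1 / 2) *\<^sub>R W) = \<theta> (snd p) W / 2" for W
    using linear_scale[OF one_form_on_linear[OF theta_form x], of "1 / 2" W] by simp
  have Ls: "L (snd p) W ((1 / 2) *\<^sub>R W') = L (snd p) W W' / 2" 
    "L (snd p) ((1 / 2) *\<^sub>R W') W = L (snd p) W' W / 2" for W W'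
    using linear_scale[OF linear_L[OF x], of W "1 / 2" W'] L_sym[OF x] by simp_all
  \<comment> \<open>Along \<open>k\<close> the profile is differentiated only in direction
    0.\<close>
  have dl: "dird l (fst p) 0 = 0"
    by (rule linear_0[OF linear_dird[OF differentiable_l]])
  show ?thesis
    unfolding lie_metric_def dird_eq[OF g_has_derivative[OF p]] dird_eq[OF k_has_derivative[OF p]]
    by (simp add: g_expand d\<theta> dL \<theta>s Ls dl theta_0[OF p] field_simps del: scaleR_conv_of_real)
qed

lemma killing_k: "killing_on (strip U) g k"
  using smooth_k lie_g by (simp add: killing_on_def)

text \<open>The conformal factor depends on the first coordinate alone and is constant along
  \<open>k\<close>, so the multiplier is 0 and \<open>k\<close> is even Killing for
  \<open>G\<close>.\<close>

lemma conformal_killing_k: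
  assumes G: "\<And>p X Y. p \<in> strip U \<Longrightarrow> G p X Y = c (fst p) * g p X Y"
    and c: "\<And>p. p \<in> strip U \<Longrightarrow> c differentiable (at (fst p))"
  shows "conformal_killing_on (strip U) G k"
proof -
  have "lie_metric k G p X Y = 0" if p: "p \<in> strip U" for p X Y
  proof -
    have gd: "(\<lambda>q. g q X Y) differentiable (at p)"
      using g_has_derivative[OF p] unfolding differentiable_def by blast
    have "((\<lambda>q. c (fst q)) has_derivative (\<lambda>Z. dird c (fst p) (fst Z))) (at p)"
      by (auto intro!: has_derivative_compose[of fst fst _ _ c] derivative_eq_intros has_derivative_dird c p)
    from has_derivative_mult[OF this has_derivative_dird[OF gd]]
    have "((\<lambda>q. G q X Y) has_derivative
        (\<lambda>Z. c (fst p) * dird (\<lambda>q. g q X Y) p Z + dird c (fst p) (fst Z) * g p X Y)) (at p)"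
      by (rule has_derivative_transform_within_open[OF _ open_strip p]) (simp add: G)
    from dird_eq[OF this, of "k p"] have "dird (\<lambda>q. G q X Y) p (k p) = c (fst p) * dird (\<lambda>q. g q X Y) p (k p)"
      using linear_0[OF linear_dird[OF c[OF p]]] by simp
    then have "lie_metric k G p X Y = c (fst p) * lie_metric k g p X Y"
      by (simp add: lie_metric_def G[OF p] algebra_simps)
    with lie_g[OF p] show ?thesis by simp
  qed
  then show ?thesis unfolding conformal_killing_on_def using smooth_k by (metis mult_zero_left)
qed

end

section \<open>Smoothness of the trigonometric functions and of the conformal factor\<close>

text \<open>The span of cos and sin is closed under differentiation, so the induction runs over all
  coefficients at once.\<close>

lemma smooth_on_trig:
  fixes S :: "real set"
  shows "smooth_on S (\<lambda>t. a * cos t + b * sin t)"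
proof -
  have d: "((\<lambda>t. a * cos t + b * sin t) has_derivative (\<lambda>X. X * b * cos t + (- X * a) * sin t)) (at t)" for a b t :: real
    by (auto intro!: derivative_eq_intros simp: fun_eq_iff algebra_simps)
  have "Ck_on k S (\<lambda>t. a * cos t + b * sin t)" for k
  proof (induction k arbitrary: a b)
    case 0
    show ?case by (simp add: continuous_intros)
  next
    case (Suc k)
    have "Ck_on k S (\<lambda>t. dird (\<lambda>t. a * cos t + b * sin t) t X)" for X
      unfolding dird_eq[OF d] by (rule Suc.IH)
    moreover have "(\<lambda>t. a * cos t + b * sin t) differentiable (at t)" for t
      using d[of a b t] unfolding differentiable_def by blast
    ultimately show ?case by simp
  qed
  then show ?thesis by (simp add: smooth_on_def)
qed

lemma smooth_on_cos: "smooth_on (S :: real set) cos" and smooth_on_sin: "smooth_on (S :: real set) sin"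
  using smooth_on_trig[of S 1 0] smooth_on_trig[of S 0 1] by simp_all

lemma smooth_on_power:
  fixes f :: "'a::real_normed_vector \<Rightarrow> real"
  shows "open S \<Longrightarrow> smooth_on S f \<Longrightarrow> smooth_on S (\<lambda>x. f x ^ n)"
  by (induction n) (simp_all add: smooth_on_const smooth_on_mult)

text \<open>The reciprocal solves the one-dimensional linear system f(x) X = 1.\<close>

lemma smooth_on_inverse:
  fixes f :: "real \<Rightarrow> real"
  assumes "open S" "smooth_on S f" "\<And>x. x \<in> S \<Longrightarrow> f x \<noteq> 0"
  shows "smooth_on S (\<lambda>x. 1 / f x)"
proof (rule linear_system_smooth[OF assms(1), where T = "\<lambda>x X. f x * X" and b = "\<lambda>x. 1"])
  show "one_form_on S (\<lambda>x X. f x * X)"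
    using assms(1,2) smooth_on_mult[OF assms(1,2) smooth_on_const]
    by (auto simp: one_form_on_def linear_iff algebra_simps)
  show "inj (\<lambda>X. f x * X)" if "x \<in> S" for x
    using assms(3)[OF that] by (auto simp: inj_def)
qed (use assms(3) in \<open>auto intro: smooth_on_const\<close>)

lemma cos_strip: "p \<in> strip U \<Longrightarrow> cos (fst p) > 0"
  unfolding strip_def using cos_gt_zero_pi[of "fst p"] by auto

lemma smooth_sec: "smooth_on {- pi / 2<..<pi / 2} (\<lambda>t::real. (1 / cos t)\<^sup>2)"
proof (intro smooth_on_power smooth_on_inverse smooth_on_cos open_greaterThanLessThan)
  show "cos t \<noteq> 0" if "t \<in> {- pi / 2<..<pi / 2}" for t :: real
    using cos_gt_zero_pi[of t] that by simp
qed

section \<open>Restriction to open subsets, kernels of functionals, locally affine functions\<close>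

lemma contact_form_subset: "contact_form U H \<theta> \<Longrightarrow> V \<subseteq> U \<Longrightarrow> contact_form V H \<theta>"
  using one_form_on_subset[of U \<theta> V] unfolding contact_form_def by blast

text \<open>In \<open>fefferman_einstein_on\<close> the CR structure and the coframe live on the
  same set, so the structure on \<open>U\<close> has to be shrunk to the domain of a coframe. Its
  closure conditions transfer because a local section over \<open>V\<close> is one over
  \<open>U\<close>.\<close>

lemma contact_almost_CR_subset:
  assumes CR: "contact_almost_CR m U H J" and V: "open V" "V \<subseteq> U"
  shows "contact_almost_CR m V H J"
proof -
  note CR' = CR[unfolded contact_almost_CR_def]
  have ls: "local_section U H V' X" if "local_section V H V' X" for V' X
    using that V unfolding local_section_def by blast
  have "bundle_complex_structure V H J"
    unfolding bundle_complex_structure_def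
  proof (intro conjI)
    have b: "bundle_complex_structure U H J"
      using CR' by (elim conjE)
    note b = b[unfolded bundle_complex_structure_def]
    show "\<forall>x\<in>V. \<forall>X\<in>H x. J x X \<in> H x \<and> J x (J x X) = - X"
      using b[THEN conjunct1] V(2) by blast
    show "\<forall>x\<in>V. \<forall>X\<in>H x. \<forall>Y\<in>H x. \<forall>a b. J x (a *\<^sub>R X + b *\<^sub>R Y) = a *\<^sub>R J x X + b *\<^sub>R J x Y"
      using b[THEN conjunct2, THEN conjunct1] V(2) by blast
    show "\<forall>V' X. local_section V H V' X \<longrightarrow> smooth_on V' (\<lambda>x. J x (X x))"
      using b[THEN conjunct2, THEN conjunct2] ls by blast
  qed
  moreover have "partially_integrable V H J"
    using CR'[THEN conjunct2, THEN conjunct2, THEN conjunct2, THEN conjunct2] ls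
    unfolding partially_integrable_def by blast
  moreover have "\<exists>V' \<theta>. x \<in> V' \<and> open V' \<and> V' \<subseteq> V \<and> contact_form V' H \<theta>" if "x \<in> V" for x
  proof -
    have "x \<in> U" using V(2) that by blast
    from bspec[OF CR'[THEN conjunct2, THEN conjunct2, THEN conjunct1] this]
    obtain V' \<theta> where V': "x \<in> V'" "open V'" "V' \<subseteq> U" "contact_form V' H \<theta>"
      by (elim exE conjE)
    show ?thesis
      by (rule exI[of _ "V' \<inter> V"], rule exI[of _ \<theta>])
        (use that V(1) V' contact_form_subset[OF V'(4), of "V' \<inter> V"] in \<open>simp add: open_Int\<close>)
  qed
  ultimately show ?thesis
    unfolding contact_almost_CR_def using CR'[THEN conjunct1] V(1) by (intro conjI ballI)
qed

text \<open>Supplies a nonzero vector of the contact distribution, on which two conformally related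
  metrics can be compared.\<close>

lemma linear_functional_kernel:
  fixes f :: "'a::euclidean_space \<Rightarrow> real"
  assumes "linear f" "DIM('a) > 1"
  obtains X where "X \<noteq> 0" "f X = 0"
proof -
  obtain b where b: "b \<in> (Basis :: 'a set)" using nonempty_Basis by blast
  have "Basis \<noteq> {b}" using assms(2) by (metis card.empty card_insert_if finite.emptyI empty_iff less_irrefl One_nat_def)
  then obtain b' where b': "b' \<in> Basis" "b' \<noteq> b" using b by blast
  show thesis
  proof (cases "f b = 0")
    case True
    then show ?thesis using that[of b] b nonzero_Basis by blast
  next
    case False
    let ?X = "f b' *\<^sub>R b - f b *\<^sub>R b'"
    have "?X \<bullet> b' = - f b"
      using b b' by (simp add: inner_diff_left inner_Basis)
    with False have "?X \<noteq> 0" by auto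
    moreover have "f ?X = 0"
      using assms(1) by (simp add: linear_diff linear_scale)
    ultimately show ?thesis by (rule that)
  qed
qed

text \<open>The slope is locally constant, hence constant on the connected interval. So
  \<open>f\<close> is affine with a single slope, up to the ends by continuity, and equal end values
  force that slope to be 0.\<close>

lemma locally_affine_vanishes:
  fixes f :: "real \<Rightarrow> real"
  assumes ab: "a < b" and cont: "continuous_on {a..b} f" and ends: "f a = 0" "f b = 0"
    and aff: "\<And>s. s \<in> {a<..<b} \<Longrightarrow> \<exists>\<epsilon>>0. \<exists>p q. \<forall>t. \<bar>t - s\<bar> < \<epsilon> \<longrightarrow> f t = p * t + q"
    and t: "t \<in> {a<..<b}"
  shows "f t = 0"
proof -
  have loc: "\<exists>\<epsilon>>0. \<exists>p. \<forall>t\<in>ball s \<epsilon>. (f has_real_derivative p) (at t)" if s: "s \<in> {a<..<b}" for s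
  proof -
    obtain \<epsilon> p q where "\<epsilon> > 0" and pq: "\<And>t. \<bar>t - s\<bar> < \<epsilon> \<Longrightarrow> f t = p * t + q"
      using aff[OF s] by blast
    have "(f has_real_derivative p) (at t)" if t: "t \<in> ball s \<epsilon>" for t
    proof -
      have "((\<lambda>t. p * t + q) has_real_derivative p) (at t)"
        by (auto intro!: derivative_eq_intros)
      then show ?thesis
        by (rule has_field_derivative_transform_within_open[OF _ open_ball t])
          (use pq in \<open>simp add: dist_real_def abs_minus_commute\<close>)
    qed
    with \<open>\<epsilon> > 0\<close> show ?thesis by blast
  qed
  have "(deriv f has_real_derivative 0) (at s within {a<..<b})" if s: "s \<in> {a<..<b}" for s
  proof -
    obtain \<epsilon> p where "\<epsilon> > 0" and p: "\<And>t. t \<in> ball s \<epsilon> \<Longrightarrow> (f has_real_derivative p) (at t)"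
      using loc[OF s] by blast
    have "(deriv f has_real_derivative 0) (at s)"
      by (rule has_field_derivative_transform_within_open[where f = "\<lambda>_. p", OF DERIV_const open_ball])
        (use \<open>\<epsilon> > 0\<close> DERIV_imp_deriv[OF p] in auto)
    then show ?thesis by (rule has_field_derivative_at_within)
  qed
  then obtain d where d: "\<And>s. s \<in> {a<..<b} \<Longrightarrow> deriv f s = d"
    using has_field_derivative_zero_constant[of "{a<..<b}" "deriv f"] by auto
  have df: "(f has_real_derivative d) (at s)" if s: "s \<in> {a<..<b}" for s
    using loc[OF s] d[OF s] DERIV_imp_deriv[of f _ s] by force
  have const: "f s - d * s = f a - d * a" if "a \<le> s" "s \<le> b" for s
    by (rule DERIV_isconst2[OF ab _ _ that])
      (auto intro!: continuous_intros cont derivative_eq_intros df)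
  from const[of b] ab ends have "d * (b - a) = 0" by (simp add: algebra_simps)
  with ab have "d = 0" by simp
  with const[of t] t ends show ?thesis by simp
qed

section \<open>Comparison with Fefferman metrics\<close>

context strip_metric
begin

text \<open>
  When \<open>l\<close> vanishes, the gauge field can be chosen to cancel the connection terms of the
  Fefferman metric.
\<close>

lemma fefferman_if_null:
  assumes null: "\<And>t. t \<in> {- pi / 2<..<pi / 2} \<Longrightarrow> l t = 0" and ein: "einstein_on (strip U) G"
    and G: "\<And>p X Y. p \<in> strip U \<Longrightarrow> G p X Y = (1 / cos (fst p))\<^sup>2 * g p X Y"
  shows "fefferman_einstein_on m (strip U) G"
  unfolding fefferman_einstein_on_def
proof (intro conjI ballI ein)
  fix p assume p: "p \<in> strip U"
  obtain V \<phi> h hi \<Gamma> A N where V: "snd p \<in> V" "V \<subseteq> U"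
    and uc: "unitary_coframe m V H J \<theta> \<phi> h hi \<Gamma> A N"
    and tf: "\<And>y \<alpha> \<beta>. y \<in> V \<Longrightarrow> \<alpha> < m \<Longrightarrow> \<beta> < m \<Longrightarrow> A \<alpha> \<beta> y = 0"
    and eq: "CR_einstein_equations m V \<theta> \<phi> h hi \<Gamma> A N \<Lambda>u"
    and L: "\<And>y X Y. y \<in> V \<Longrightarrow> L y X Y = unitary_coframe.levi_metric m \<phi> y X Y"
    using coframe_ex[OF snd_strip[OF p]] by metis
  interpret V: unitary_coframe m V H J \<theta> \<phi> h hi \<Gamma> A N by (rule uc)
  define \<xi> where "\<xi> x Z = - (1 / (real m + 2)) * (Re (\<i> * (\<Sum>\<alpha><m. \<Gamma> \<alpha> \<alpha> x Z))
      - 1 / (2 * real m + 2) * Re (webster_sc m \<theta> \<phi> hi \<Gamma> x) * \<theta> x Z)" for x Z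
  define \<Omega> where "\<Omega> q = (1 / cos (fst q))\<^sup>2" for q :: "real \<times> 'a"
  have W: "open (strip V)" "strip V \<subseteq> strip U" "p \<in> strip V" "snd ` strip V \<subseteq> V"
    using V p V.open_V by (auto simp: strip_def intro!: open_Times)
  have "linear (\<xi> x)" if x: "x \<in> V" for x
  proof -
    note lin = one_form_on_linear[OF V.connection_form x] one_form_on_linear[OF V.theta_form x]
    have "linear (\<lambda>Z. Re (\<i> * (\<Sum>\<alpha><m. \<Gamma> \<alpha> \<alpha> x Z)))"
      by (rule linearI)
        (simp_all add: linear_add[OF lin(1)] linear_scale[OF lin(1)] sum.distrib sum_distrib_left sum_negf)
    note linear_compose_scale_right[OF linear_compose_sub[OF this linear_compose_scale_right[OF lin(2)]]]
    from this[unfolded real_scaleR_def]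
    show ?thesis unfolding \<xi>_def[abs_def] .
  qed
  moreover have "smooth_on V (\<lambda>x. \<xi> x Z)" for Z
  proof -
    note Re = smooth_on_bounded_linear[OF V.open_V bounded_linear_Re]
    have "smooth_on V (\<lambda>x. \<Sum>\<alpha><m. \<Gamma> \<alpha> \<alpha> x Z)"
      by (rule smooth_on_sum[OF V.open_V]) (simp add: one_form_on_smooth[OF V.connection_form])
    then have 1: "smooth_on V (\<lambda>x. Re (\<i> * (\<Sum>\<alpha><m. \<Gamma> \<alpha> \<alpha> x Z)))"
      by (rule Re[OF smooth_on_mult[OF V.open_V smooth_on_const]])
    have 2: "smooth_on V (\<lambda>x. Re (webster_sc m \<theta> \<phi> hi \<Gamma> x))"
      by (rule Re[OF V.smooth_webster_sc[OF eq]])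
    show ?thesis
      unfolding \<xi>_def
      by (rule smooth_on_mult[OF V.open_V smooth_on_const smooth_on_diff[OF V.open_V 1
        smooth_on_mult[OF V.open_V smooth_on_mult[OF V.open_V smooth_on_const 2]
          one_form_on_smooth[OF V.theta_form]]]])
  qed
  ultimately have \<xi>: "one_form_on V \<xi>" by (simp add: one_form_on_def)
  have dfst: "dird fst q Z = fst Z" for q Z :: "real \<times> 'a"
    by (rule dird_eq) (auto intro!: derivative_eq_intros)
  have "smooth_on (fst -` {- pi / 2<..<pi / 2}) \<Omega>"
    unfolding \<Omega>_def by (rule smooth_on_compose_linear[OF _ bounded_linear_fst smooth_sec]) simp
  then have \<Omega>: "smooth_on (strip V) \<Omega>"
    by (rule smooth_on_subset) (auto simp: strip_def)
  have "G q X Y = \<Omega> q * fefferman m \<theta> \<phi> hi \<Gamma> \<xi> fst q X Y" if q: "q \<in> strip V" for q X Y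
  proof -
    have qU: "q \<in> strip U" and qV: "snd q \<in> V" using q W by auto
    have l0: "l (fst q) = 0" using q by (intro null) (auto simp: strip_def)
    have "L (snd q) (snd X) (snd Y) = Re (2 * (\<Sum>\<alpha><m. odot (\<lambda>Z. \<phi> \<alpha> (snd q) (snd Z)) (\<lambda>Z. cnj (\<phi> \<alpha> (snd q) (snd Z))) X Y))"
      unfolding L[OF qV] V.levi_metric_alt by (simp add: odot_def)
    moreover have "dird fst q Z + 1 / (real m + 2) * (Re (\<i> * (\<Sum>\<alpha><m. \<Gamma> \<alpha> \<alpha> (snd q) (snd Z)))
        - 1 / (2 * real m + 2) * Re (webster_sc m \<theta> \<phi> hi \<Gamma> (snd q)) * \<theta> (snd q) (snd Z))
        + \<xi> (snd q) (snd Z) = fst Z" for Z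
      by (simp add: dfst \<xi>_def)
    ultimately have "fefferman m \<theta> \<phi> hi \<Gamma> \<xi> fst q X Y = g q X Y"
      unfolding fefferman_def Let_def g l0 by simp
    with G[OF qU] show ?thesis by (simp add: \<Omega>_def)
  qed
  then show "\<exists>W V H J \<theta> \<phi> h hi \<Gamma> A N \<xi> \<psi> \<Omega>.
        p \<in> W \<and> open W \<and> W \<subseteq> strip U \<and> snd ` W \<subseteq> V \<and>
        contact_almost_CR m V H J \<and> contact_form V H \<theta> \<and>
        unitary m V h \<and> webster_tanaka m V H J \<theta> \<phi> h hi \<Gamma> A N \<and>
        one_form_on V \<xi> \<and>
        smooth_on W \<psi> \<and> (\<forall>q\<in>W. dird \<psi> q (1, 0) \<noteq> 0) \<and>
        smooth_on W \<Omega> \<and>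
        (\<forall>q\<in>W. \<Omega> q > 0 \<and> (\<forall>X Y. G q X Y = \<Omega> q * fefferman m \<theta> \<phi> hi \<Gamma> \<xi> \<psi> q X Y))"
    using W \<xi> \<Omega> V.contact V.unitary V.webster_tanaka contact_almost_CR_subset[OF contact_CR V.open_V V(2)]
      smooth_on_linear[OF bounded_linear_fst] cos_strip[of _ V]
    by (intro exI[of _ "strip V"] exI[of _ V] exI[of _ H] exI[of _ J] exI[of _ \<theta>] exI[of _ \<phi>]
      exI[of _ h] exI[of _ hi] exI[of _ \<Gamma>] exI[of _ A] exI[of _ N] exI[of _ \<xi>] exI[of _ fst] exI[of _ \<Omega>])
      (auto simp: dfst \<Omega>_def less_imp_neq[symmetric])
qed

end

context strip_metric
begin

text \<open>
  On the annihilator of \<open>\<theta>\<close> the two conformally related metrics are pulled back from the leaf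
  space, so \<open>c/\<Omega>\<close> and \<open>\<partial>\<psi>/\<partial>\<phi>\<close> depend on the leaf only and \<open>\<psi>\<close> is affine along the
  fibres.  Evaluating both metrics on the Reeb field then shows that \<open>l\<close> is affine.
\<close>

lemma fefferman_imp_locally_affine:
  assumes F: "fefferman_einstein_on m (strip U) G" and m: "m > 0"
    and G: "\<And>p X Y. p \<in> strip U \<Longrightarrow> G p X Y = c (fst p) * g p X Y"
    and c: "\<And>p. p \<in> strip U \<Longrightarrow> c (fst p) > 0"
    and p: "(t0, x0) \<in> strip U"
  shows "\<exists>\<epsilon>>0. \<exists>a b. \<forall>t. \<bar>t - t0\<bar> < \<epsilon> \<longrightarrow> l t = a * t + b"
proof -
  obtain W V H' J' \<theta>' \<phi> h hi \<Gamma> A N \<xi> \<psi> \<Omega> where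
      W: "(t0, x0) \<in> W" "open W" "W \<subseteq> strip U" "snd ` W \<subseteq> V"
    and "contact_form V H' \<theta>'" "unitary m V h" "webster_tanaka m V H' J' \<theta>' \<phi> h hi \<Gamma> A N"
    and \<xi>: "one_form_on V \<xi>" and \<psi>: "smooth_on W \<psi>" and \<psi>': "\<forall>q\<in>W. dird \<psi> q (1, 0) \<noteq> 0"
    and \<Omega>: "\<forall>q\<in>W. \<Omega> q > 0 \<and> (\<forall>X Y. G q X Y = \<Omega> q * fefferman m \<theta>' \<phi> hi \<Gamma> \<xi> \<psi> q X Y)"
    using bspec[OF conjunct2[OF F[unfolded fefferman_einstein_on_def]] p] by (elim exE conjE)
  then interpret V: unitary_coframe m V H' J' \<theta>' \<phi> h hi \<Gamma> A N by unfold_locales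
  \<comment> \<open>\<open>\<eta>\<close> collects what is pulled back from the leaf space, so only
    the differential of \<psi> in \<open>\<sigma>\<close> can vary along a fibre.\<close>
  define \<eta> where "\<eta> x Z = 1 / (real m + 2) * (Re (\<i> * (\<Sum>\<alpha><m. \<Gamma> \<alpha> \<alpha> x Z))
      - 1 / (2 * real m + 2) * Re (webster_sc m \<theta>' \<phi> hi \<Gamma> x) * \<theta>' x Z) + \<xi> x Z" for x Z
  define \<sigma> where "\<sigma> q Z = dird \<psi> q Z + \<eta> (snd q) (snd Z)" for q Z
  have fef: "fefferman m \<theta>' \<phi> hi \<Gamma> \<xi> \<psi> q X Y = 
      2 * (\<theta>' (snd q) (snd X) * \<sigma> q Y + \<sigma> q X * \<theta>' (snd q) (snd Y))
        + V.levi_metric (snd q) (snd X) (snd Y)" for q X Y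
  proof -
    have "4 * odot (\<lambda>Z. \<theta>' (snd q) (snd Z)) (\<sigma> q) X Y =
        2 * (\<theta>' (snd q) (snd X) * \<sigma> q Y + \<sigma> q X * \<theta>' (snd q) (snd Y))"
      by (simp add: odot_def)
    moreover have "Re (2 * (\<Sum>\<alpha><m. odot (\<lambda>Z. \<phi> \<alpha> (snd q) (snd Z)) (\<lambda>Z. cnj (\<phi> \<alpha> (snd q) (snd Z))) X Y))
        = V.levi_metric (snd q) (snd X) (snd Y)"
      unfolding V.levi_metric_alt by (simp add: odot_def)
    ultimately show ?thesis
      unfolding fefferman_def Let_def by (simp add: \<sigma>_def[abs_def] \<eta>_def add.assoc)
  qed
  have key: "c (fst q) * g q X Y = \<Omega> q * (2 * (\<theta>' (snd q) (snd X) * \<sigma> q Y + \<sigma> q X * \<theta>' (snd q) (snd Y))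
        + V.levi_metric (snd q) (snd X) (snd Y))" if "q \<in> W" for q X Y
    using that \<Omega> G[of q X Y] W(3) fef by (metis subsetD)
  \<comment> \<open>In a product box the fibres are intervals, which permits integration along
    them.\<close>
  obtain I B where IB: "open I" "open B" "(t0, x0) \<in> I \<times> B" "I \<times> B \<subseteq> W"
    by (rule open_prod_elim[OF W(2,1)])
  obtain \<epsilon> where "\<epsilon> > 0" and \<epsilon>: "ball t0 \<epsilon> \<subseteq> I"
    using IB(1,3) openE[of I t0] by auto
  have dim: "DIM('a) > 1"
    using contact_CR m by (simp add: contact_almost_CR_def)
  have inW: "(t, y) \<in> W" if "t \<in> ball t0 \<epsilon>" "y \<in> B" for t y using that IB \<epsilon> by blast
  have \<psi>d: "(\<psi> has_derivative dird \<psi> q) (at q)" if "q \<in> W" for q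
    using has_derivative_dird smooth_on_differentiable[OF \<psi> that] .
  have "\<exists>s r. s > 0 \<and> (\<forall>t\<in>ball t0 \<epsilon>. c t = \<Omega> (t, y) * s \<and> dird \<psi> (t, y) (1, 0) = r)" if y: "y \<in> B" for y
  proof -
    have t0: "t0 \<in> ball t0 \<epsilon>" using \<open>\<epsilon> > 0\<close> by simp
    have yV: "y \<in> V" and yU: "y \<in> U" using inW[OF t0 y] W(3,4) by (force simp: strip_def)+
    have lin0: "\<theta> y 0 = 0" "\<theta>' y 0 = 0" "L y X 0 = 0" "V.levi_metric y X 0 = 0" for X
      using linear_0[OF one_form_on_linear[OF theta_form yU]]
        linear_0[OF one_form_on_linear[OF V.theta_form yV]]
        linear_0[OF linear_L[OF yU]] linear_0[OF V.linear_levi_metric[OF yV]] by blast+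
    have \<eta>0: "\<eta> y 0 = 0"
      unfolding \<eta>_def using lin0(2) linear_0[OF one_form_on_linear[OF \<xi> yV]]
      by (simp add: linear_0[OF one_form_on_linear[OF V.connection_form yV]])
    obtain X where X: "X \<noteq> 0" "\<theta> y X = 0"
      using linear_functional_kernel[OF one_form_on_linear[OF theta_form yU] dim] by blast
    have LX: "L y X X > 0" using L_pos[OF yU X(2,1)] .
    \<comment> \<open>Both constants are fixed before \<open>t\<close>, since they may depend on the
      leaf only: \<open>s\<close> is the ratio of the two Levi forms on \<open>X\<close>, and
      \<open>r\<close> follows from pairing the vertical vector with the Reeb field.\<close>
    define s where "s = V.levi_metric y X X / L y X X"
    define r where "r = s / \<theta>' y (reeb \<theta> y)"
    have "s > 0 \<and> c t = \<Omega> (t, y) * s \<and> dird \<psi> (t, y) (1, 0) = r" if t: "t \<in> ball t0 \<epsilon>" for t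
    proof -
      note q = inW[OF t y]
      have ct: "c t > 0" using c q W(3) by fastforce
      have \<Omega>q: "\<Omega> (t, y) > 0" using \<Omega> q by blast
      have \<psi>q: "dird \<psi> (t, y) (1, 0) \<noteq> 0" using \<psi>' q by blast
      \<comment> \<open>Pairing with the vertical vector makes \<open>\<theta>'\<close> a nonzero
        multiple of \<theta>; that the two structures share their contact distribution is a
        conclusion here.\<close>
      have 1: "c t * \<theta> y Z = \<Omega> (t, y) * dird \<psi> (t, y) (1, 0) * \<theta>' y Z" for Z
        using key[OF q, of "(1, 0)" "(0, Z)"] V.levi_metric_sym[of y 0 Z] L_sym[OF yU, of 0 Z]
        by (simp add: g_expand lin0 \<sigma>_def \<eta>0)
      have \<theta>'X: "\<theta>' y X = 0" using 1[of X] X(2) \<Omega>q \<psi>q by simp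
      have "c t * L y X X = \<Omega> (t, y) * V.levi_metric y X X"
        using key[OF q, of "(0, X)" "(0, X)"] X(2) by (simp add: g_expand \<theta>'X)
      then have cs: "c t = \<Omega> (t, y) * s" using LX by (simp add: s_def field_simps)
      with ct \<Omega>q have s: "s > 0" by (metis zero_less_mult_pos)
      have "\<Omega> (t, y) * s = \<Omega> (t, y) * (dird \<psi> (t, y) (1, 0) * \<theta>' y (reeb \<theta> y))"
        using 1[of "reeb \<theta> y"] yU cs by simp
      with \<Omega>q have "s = dird \<psi> (t, y) (1, 0) * \<theta>' y (reeb \<theta> y)" by simp
      with s cs show ?thesis by (auto simp: r_def)
    qed
    then show ?thesis using t0 by blast
  qed
  then have "\<forall>y. \<exists>s r. y \<in> B \<longrightarrow> s > 0 \<and> (\<forall>t\<in>ball t0 \<epsilon>. c t = \<Omega> (t, y) * s \<and> dird \<psi> (t, y) (1, 0) = r)"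
    by blast
  then obtain s r where s: "\<And>y. y \<in> B \<Longrightarrow> s y > 0"
    and c_eq: "\<And>t y. t \<in> ball t0 \<epsilon> \<Longrightarrow> y \<in> B \<Longrightarrow> c t = \<Omega> (t, y) * s y"
    and r: "\<And>t y. t \<in> ball t0 \<epsilon> \<Longrightarrow> y \<in> B \<Longrightarrow> dird \<psi> (t, y) (1, 0) = r y"
    by metis
  have t0: "t0 \<in> ball t0 \<epsilon>" using \<open>\<epsilon> > 0\<close> by simp
  have \<psi>_affine: "\<psi> (t, y) = \<psi> (t0, y) + r y * (t - t0)" if t: "t \<in> ball t0 \<epsilon>" and y: "y \<in> B" for t y
  proof -
    have 0: "((\<lambda>t. \<psi> (t, y) - r y * t) has_real_derivative 0) (at u within ball t0 \<epsilon>)" if u: "u \<in> ball t0 \<epsilon>" for u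
    proof -
      have "((\<lambda>t. \<psi> (t, y)) has_derivative (\<lambda>h. dird \<psi> (u, y) (h, 0))) (at u)"
        by (rule has_derivative_compose[of "\<lambda>t. (t, y)" "\<lambda>h. (h, 0)" _ _ \<psi>, OF _ \<psi>d[OF inW[OF u y]]]) (auto intro!: derivative_eq_intros)
      moreover have "dird \<psi> (u, y) (h, 0) = r y * h" for h
      proof -
        have "dird \<psi> (u, y) (h *\<^sub>R (1, 0)) = h *\<^sub>R dird \<psi> (u, y) (1, 0)"
          by (rule linear_scale[OF linear_dird[OF smooth_on_differentiable[OF \<psi> inW[OF u y]]]])
        then show ?thesis using r[OF u y] by simp
      qed
      ultimately have "((\<lambda>t. \<psi> (t, y)) has_real_derivative r y) (at u)"
        by (simp add: has_field_derivative_def)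
      then have "((\<lambda>t. \<psi> (t, y) - r y * t) has_real_derivative r y - r y * 1) (at u)"
        by (intro DERIV_diff DERIV_cmult DERIV_ident)
      then show ?thesis using has_field_derivative_at_within by fastforce
    qed
    from has_field_derivative_zero_constant[OF convex_ball 0]
    obtain C where "\<And>t. t \<in> ball t0 \<epsilon> \<Longrightarrow> \<psi> (t, y) - r y * t = C" by blast
    from this[OF t] this[OF t0] show ?thesis by (simp add: algebra_simps)
  qed
  let ?e = "reeb \<theta> x0" and ?P = "\<lambda>t. dird \<psi> (t, x0) (0, reeb \<theta> x0)"
  have x0: "x0 \<in> B" using IB(3) by simp
  have x0U: "x0 \<in> U" using snd_strip[OF p] by simp
  \<comment> \<open>Two values on a fibre determine the affine function \<psi>. Interpolating
    between \<open>t0\<close> and a second point avoids differentiating \<open>r\<close>, which was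
    obtained by choice and has no known regularity.\<close>
  define t1 where "t1 = t0 + \<epsilon> / 2"
  have t1: "t1 \<in> ball t0 \<epsilon>" "t1 \<noteq> t0" using \<open>\<epsilon> > 0\<close> by (auto simp: t1_def dist_real_def)
  have P: "?P t = ?P t0 + (?P t1 - ?P t0) / (t1 - t0) * (t - t0)" if t: "t \<in> ball t0 \<epsilon>" for t
  proof -
    have d: "((\<lambda>y. \<psi> (u, y)) has_derivative (\<lambda>Z. dird \<psi> (u, x0) (0, Z))) (at x0)" if u: "u \<in> ball t0 \<epsilon>" for u
      by (rule has_derivative_compose[of "Pair u" "Pair 0" _ _ \<psi>, OF _ \<psi>d[OF inW[OF u x0]]])
        (auto intro!: derivative_eq_intros)
    have "((\<lambda>y. \<psi> (t0, y) + (t - t0) / (t1 - t0) * (\<psi> (t1, y) - \<psi> (t0, y))) has_derivative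
        (\<lambda>Z. dird \<psi> (t0, x0) (0, Z) + (t - t0) / (t1 - t0) * (dird \<psi> (t1, x0) (0, Z) - dird \<psi> (t0, x0) (0, Z)))) (at x0)"
      by (intro has_derivative_add has_derivative_mult_right has_derivative_diff d t0 t1)
    note comb = this
    have "\<psi> (t0, y) + (t - t0) / (t1 - t0) * (\<psi> (t1, y) - \<psi> (t0, y)) = \<psi> (t, y)" if y: "y \<in> B" for y
      using \<psi>_affine[OF t y] \<psi>_affine[OF t1(1) y] t1(2) by simp
    from has_derivative_transform_within_open[OF comb IB(2) x0 this]
    have "((\<lambda>y. \<psi> (t, y)) has_derivative
        (\<lambda>Z. dird \<psi> (t0, x0) (0, Z) + (t - t0) / (t1 - t0) * (dird \<psi> (t1, x0) (0, Z) - dird \<psi> (t0, x0) (0, Z)))) (at x0)" .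
    from dird_eq[OF this, of ?e] dird_eq[OF d[OF t], of ?e] show ?thesis by simp
  qed
  have l: "s x0 * (4 * l t) = 4 * \<theta>' x0 ?e * (?P t + \<eta> x0 ?e) + V.levi_metric x0 ?e ?e" if t: "t \<in> ball t0 \<epsilon>" for t
  proof -
    note q = inW[OF t x0]
    have "\<Omega> (t, x0) > 0" using \<Omega> q by blast
    moreover have "\<Omega> (t, x0) * (s x0 * (4 * l t))
        = \<Omega> (t, x0) * (4 * \<theta>' x0 ?e * (?P t + \<eta> x0 ?e) + V.levi_metric x0 ?e ?e)"
      using key[OF q, of "(0, ?e)" "(0, ?e)"] c_eq[OF t x0]
      by (simp add: g_expand x0U L_reeb[OF x0U] \<sigma>_def algebra_simps)
    ultimately show ?thesis by simp
  qed
  define K where "K = (?P t1 - ?P t0) / (t1 - t0)"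
  have "l t = (\<theta>' x0 ?e * K / s x0) * t
      + (\<theta>' x0 ?e * (?P t0 - K * t0 + \<eta> x0 ?e) + V.levi_metric x0 ?e ?e / 4) / s x0"
    if t: "\<bar>t - t0\<bar> < \<epsilon>" for t
  proof -
    have "t \<in> ball t0 \<epsilon>" using t by (simp add: dist_real_def abs_minus_commute)
    from l[OF this] P[OF this, folded K_def] s[OF x0] show ?thesis
      by (simp add: field_simps)
  qed
  with \<open>\<epsilon> > 0\<close> show ?thesis by blast
qed

end

section \<open>Boundary values of \<open>\<lambda>_0\<close> and the Einstein constant\<close>

lemma smooth_nf_lambda0: "smooth_on S (nf_lambda0 m \<Lambda> \<Lambda>u cu)" if "open S"
proof -
  have p: "smooth_on S (\<lambda>t. cos t ^ n)" for n
    by (rule smooth_on_power[OF that smooth_on_cos])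
  have "smooth_on S (\<lambda>t. \<Lambda>u / (2 * real m + 2)
     + (\<Lambda> / (2 * real m + 1) - \<Lambda>u / (2 * real m + 2))
       * ((\<Sum>j=0..m. nf_coeff m j * cos t ^ (2 * j)) - 2 * nf_coeff m m * cos t ^ (2 * m + 2))
     + cu * cos t ^ (2 * m + 1) * sin t)"
    by (intro smooth_on_add smooth_on_mult smooth_on_diff smooth_on_sum smooth_on_const smooth_on_sin p that)
  then show ?thesis by (simp add: nf_lambda0_def[abs_def])
qed

text \<open>Only the term \<open>j = 0\<close> of the sum survives, with value
  \<open>nf_coeff m 0 = 1\<close>, and then the two contributions of \<open>\<Lambda>u\<close>
  cancel.\<close>

lemma nf_lambda0_at_zero_cos:
  assumes "cos t = 0"
  shows "nf_lambda0 m \<Lambda> \<Lambda>u cu t = \<Lambda> / (2 * real m + 1)"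
proof -
  have "(\<Sum>j=0..m. nf_coeff m j * cos t ^ (2 * j)) = (\<Sum>j=0..m. if j = 0 then 1 else 0)"
    using assms by (intro sum.cong) auto
  with assms show ?thesis by (simp add: nf_lambda0_def)
qed

text \<open>Raising an index of \<open>r * G\<close> gives \<open>r\<close> times the identity,
  whose trace is the dimension. This ties the prescribed Ricci scalar to the Einstein
  constant.\<close>

lemma einstein_ricci_scalar:
  fixes G :: "'e::euclidean_space metric"
  assumes "\<And>Z. linear (\<lambda>X. G x X Z)" "\<And>X. (\<And>Z. G x X Z = 0) \<Longrightarrow> X = 0"
    and "\<And>X Y. ricci G x X Y = r * G x X Y"
  shows "ricci_scalar G x = real DIM('e) * r"
proof -
  have "sharp G x (ricci G x Y) = r *\<^sub>R Y" for Y
    using assms(3) linear_scale[OF assms(1), of r Y] by (intro sharp_eq assms(1,2)) simp_all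
  then show ?thesis by (simp add: ricci_scalar_def trace_end_def)
qed

section \<open>The normal form\<close>

theorem proposition10p1:
  fixes m :: nat
    and \<A> :: "('p::{t2_space, second_countable_topology}, real \<times> 'a::euclidean_space) chart set"
    and C :: "(('p, real \<times> 'a) chart \<Rightarrow> (real \<times> 'a) metric) set"
    and K :: "('p, real \<times> 'a) chart \<Rightarrow> real \<times> 'a \<Rightarrow> (real \<times> 'a) set"
    and ghat :: "('p, real \<times> 'a) chart \<Rightarrow> (real \<times> 'a) metric"
    and \<Lambda> \<Lambda>u cu :: real
    and nf :: "('p, real \<times> 'a) chart"
    and U :: "'a set" and H :: "'a \<Rightarrow> 'a set" and J :: "'a \<Rightarrow> 'a \<Rightarrow> 'a"
    and \<theta> :: "'a \<Rightarrow> 'a \<Rightarrow> real" and L :: "'a metric"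
    and \<kappa> lam \<alpha> :: "real \<times> 'a \<Rightarrow> real \<times> 'a \<Rightarrow> real"
    and g :: "(real \<times> 'a) metric"
    and v :: "real \<times> 'a \<Rightarrow> real \<times> 'a"
  assumes "m > 1" and "DIM(real \<times> 'a) = 2 * m + 2"
    \<comment> \<open>the conformal optical geometry\<close>
    and "smooth_manifold \<A>" and "oriented_atlas \<A>"
    and "lorentzian_conformal_class \<A> C" and "time_oriented \<A> C"
    and "null_line_distribution \<A> C K"
    and "geodesic_congruence \<A> C K" and "nonshearing_congruence \<A> C K"
    and "twisting_congruence \<A> C K"
    and "weyl_condition \<A> C K"
    and "ghat \<in> C" and "einstein_metric \<A> ghat"
    and "\<forall>c\<in>\<A>. \<forall>x\<in>img c. ricci_scalar (ghat c) x = (2 * real m + 2) * \<Lambda>"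
    \<comment> \<open>the normal form, in the coordinates given by the chart nf\<close>
    and "nf \<in> \<A>" and "img nf = strip U" and "open U" and "U \<noteq> {}"
    and "\<forall>p\<in>strip U. K nf p = span {(1, 0)}"
    and "almost_CR_einstein m U H J \<theta> \<Lambda>u" and "levi_form m U H J \<theta> L"
    and kappa: "\<And>p X. \<kappa> p X = 2 * \<theta> (snd p) (snd X)"
    and lambda: "\<And>p X. lam p X = fst X + nf_lambda0 m \<Lambda> \<Lambda>u cu (fst p) * \<theta> (snd p) (snd X)"
    and g: "\<And>p X Y. g p X Y = 2 * odot (\<kappa> p) (lam p) X Y + L (snd p) (snd X) (snd Y)"
    and "\<forall>p\<in>strip U. \<forall>X Y. ghat nf p X Y = (1 / cos (fst p))\<^sup>2 * g p X Y"
    \<comment> \<open>the vector field v\<close>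
    and alpha: "\<And>p X. \<alpha> p X = lam p X + 1 / 2 * nf_lambda0 m \<Lambda> \<Lambda>u cu (fst p) * \<kappa> p X"
    and v: "\<And>p. v p = sharp g p (\<alpha> p)"
  shows "killing_on (strip U) g v \<and>
         conformal_killing_on (strip U) (ghat nf) v \<and>
         descends_to (strip U) v (\<lambda>x. (1 / 2) *\<^sub>R reeb \<theta> x) \<and>
         transverse_infinitesimal_symmetry U H J (reeb \<theta>) \<and>
         ((\<forall>p\<in>strip U. g p (v p) (v p) = 0) \<longleftrightarrow>
            fefferman_einstein_on m (strip U) (ghat nf) \<and> ricci_flat_on (strip U) (ghat nf))"
proof -
  let ?l = "nf_lambda0 m \<Lambda> \<Lambda>u cu"
  have m: "m > 1" and dim: "DIM(real \<times> 'a) = 2 * m + 2" by fact+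
  have ein: "einstein_metric \<A> ghat"
    and scal: "\<forall>c\<in>\<A>. \<forall>x\<in>img c. ricci_scalar (ghat c) x = (2 * real m + 2) * \<Lambda>"
    and nf: "nf \<in> \<A>" "img nf = strip U" and U: "U \<noteq> {}" by fact+
  have ghat: "ghat nf p X Y = (1 / cos (fst p))\<^sup>2 * g p X Y" if "p \<in> strip U" for p X Y
    using \<open>\<forall>p\<in>strip U. \<forall>X Y. ghat nf p X Y = (1 / cos (fst p))\<^sup>2 * g p X Y\<close> that by blast
  have smooth_l: "smooth_on UNIV ?l" by (rule smooth_nf_lambda0) simp
  interpret strip_metric m U H J \<theta> \<Lambda>u L ?l g
  proof
    show "almost_CR_einstein m U H J \<theta> \<Lambda>u" "levi_form m U H J \<theta> L" by fact+
    show "?l differentiable (at t)" for t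
      using smooth_on_differentiable[OF smooth_l] by simp
    show "g p X Y = 4 * odot (\<lambda>Z. \<theta> (snd p) (snd Z)) (\<lambda>Z. fst Z + ?l (fst p) * \<theta> (snd p) (snd Z)) X Y
        + L (snd p) (snd X) (snd Y)" for p X Y
      by (simp add: g odot_def kappa lambda)
  qed
  have v_eq: "v p = k p" if "p \<in> strip U" for p
    unfolding v using that by (rule sharp_k) (simp add: alpha lambda kappa algebra_simps)
  \<comment> \<open>\<open>v\<close> is identified with \<open>k\<close> on the strip only; since
    the strip is open, the derivatives there agree too.\<close>
  have dv: "dird v p = dird k p" if "p \<in> strip U" for p
    by (rule dird_cong[OF open_strip that v_eq])
  have smooth_v: "smooth_on (strip U) v"
    by (rule smooth_on_cong[OF open_strip v_eq[symmetric] smooth_k])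
  have killing: "killing_on (strip U) g v"
    using killing_k smooth_v by (simp add: killing_on_def lie_metric_def v_eq dv)
  have sec: "(\<lambda>t. (1 / cos t)\<^sup>2) differentiable (at (fst p))" if "p \<in> strip U" for p :: "real \<times> 'a"
    using smooth_on_differentiable[OF smooth_sec] that by (auto simp: strip_def)
  have conformal: "conformal_killing_on (strip U) (ghat nf) v"
    using conformal_killing_k[of "ghat nf" "\<lambda>t. (1 / cos t)\<^sup>2", OF ghat sec] smooth_v
    by (simp add: conformal_killing_on_def lie_metric_def v_eq dv)
  have descends: "descends_to (strip U) v (\<lambda>x. (1 / 2) *\<^sub>R reeb \<theta> x)"
    by (simp add: descends_to_def v_eq)
  obtain r where r: "\<And>p X Y. p \<in> strip U \<Longrightarrow> ricci (ghat nf) p X Y = r * ghat nf p X Y"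
    using ein nf unfolding einstein_metric_def by metis
  obtain x0 where x0: "x0 \<in> U" using U by blast
  then have p0: "(0, x0) \<in> strip U" by (simp add: strip_def)
  have "r = \<Lambda>"
  proof -
    have "ricci_scalar (ghat nf) (0, x0) = real DIM(real \<times> 'a) * r"
    proof (rule einstein_ricci_scalar)
      show "linear (\<lambda>X. ghat nf (0, x0) X Z)" for Z
        using linear_g_left[OF p0] ghat[OF p0] by simp
      show "X = 0" if "\<And>Z. ghat nf (0, x0) X Z = 0" for X
        by (rule g_nondegenerate[OF p0]) (use that ghat[OF p0] in simp)
    qed (rule r[OF p0])
    moreover have "ricci_scalar (ghat nf) (0, x0) = (2 * real m + 2) * \<Lambda>"
      using scal nf p0 by blast
    ultimately have "(2 * real m + 2) * r = (2 * real m + 2) * \<Lambda>"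
      using dim by simp
    moreover have "2 * real m + 2 \<noteq> 0" by simp
    ultimately show ?thesis by simp
  qed
  with r have ricci: "ricci (ghat nf) p X Y = \<Lambda> * ghat nf p X Y" if "p \<in> strip U" for p X Y
    using that by simp
  have einstein: "einstein_on (strip U) (ghat nf)"
    unfolding einstein_on_def using ricci by blast
  have flat: "ricci_flat_on (strip U) (ghat nf) \<longleftrightarrow> \<Lambda> = 0"
  proof
    assume "ricci_flat_on (strip U) (ghat nf)"
    \<comment> \<open>For these two vectors the product under \<open>ghat nf\<close> is 1, as the
      conformal factor is 1 at \<phi> = 0, so their Ricci value is \<Lambda> itself.\<close>
    then have "ricci (ghat nf) (0, x0) (1, 0) (k (0, x0)) = 0"
      using p0 unfolding ricci_flat_on_def by blast
    then have "\<Lambda> * ghat nf (0, x0) (1, 0) (k (0, x0)) = 0"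
      by (simp only: ricci[OF p0])
    moreover have "ghat nf (0, x0) (1, 0) (k (0, x0)) = 1"
      using g_k[OF p0, of "(1, 0)"] g_sym[OF p0] theta_0[OF p0] by (simp add: ghat[OF p0])
    ultimately show "\<Lambda> = 0" by simp
  qed (simp add: ricci_flat_on_def ricci)
  \<comment> \<open>The formula for \<open>\<lambda>_0\<close> is smooth on the whole line, so it
    has values at the ends of the interval although the conformal factor blows up there.\<close>
  have cont: "continuous_on {- pi / 2..pi / 2} ?l"
    by (intro continuous_at_imp_continuous_on ballI differentiable_imp_continuous_within
      smooth_on_differentiable[OF smooth_l]) simp
  have ends: "?l (- pi / 2) = \<Lambda> / (2 * real m + 1)" "?l (pi / 2) = \<Lambda> / (2 * real m + 1)"
    by (simp_all add: nf_lambda0_at_zero_cos)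
  have null: "(\<forall>p\<in>strip U. g p (v p) (v p) = 0) \<longleftrightarrow> (\<forall>t\<in>{- pi / 2<..<pi / 2}. ?l t = 0)"
    using x0 by (auto simp: v_eq g_k_k strip_def)
  have "(\<forall>t\<in>{- pi / 2<..<pi / 2}. ?l t = 0) \<longleftrightarrow>
      fefferman_einstein_on m (strip U) (ghat nf) \<and> \<Lambda> = 0"
  proof (intro iffI conjI ballI)
    assume l: "\<forall>t\<in>{- pi / 2<..<pi / 2}. ?l t = 0"
    then show "fefferman_einstein_on m (strip U) (ghat nf)"
      by (intro fefferman_if_null einstein ghat) auto
    have "?l (pi / 2) = 0"
      by (rule continuous_constant_on_closure[of "{- pi / 2<..<pi / 2}" ?l])
        (use cont l in \<open>auto simp: closure_greaterThanLessThan\<close>)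
    moreover have "2 * real m + 1 \<noteq> 0" by simp
    ultimately show "\<Lambda> = 0" by (simp add: ends(2))
  next
    fix t assume F: "fefferman_einstein_on m (strip U) (ghat nf) \<and> \<Lambda> = 0" and t: "t \<in> {- pi / 2<..<pi / 2}"
    show "?l t = 0"
    proof (rule locally_affine_vanishes[OF _ cont _ _ _ t])
      show "?l (- pi / 2) = 0" "?l (pi / 2) = 0" using F ends by simp_all
      show "\<exists>\<epsilon>>0. \<exists>a b. \<forall>t. \<bar>t - s\<bar> < \<epsilon> \<longrightarrow> ?l t = a * t + b" if s: "s \<in> {- pi / 2<..<pi / 2}" for s
      proof (rule fefferman_imp_locally_affine[of "ghat nf" "\<lambda>t. (1 / cos t)\<^sup>2"])
        \<comment> \<open>The profile depends on \<phi> alone, so the fibre over one leaf point is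
          enough.\<close>
        show "(s, x0) \<in> strip U" using s x0 by (simp add: strip_def)
        show "0 < (1 / cos (fst p))\<^sup>2" if "p \<in> strip U" for p :: "real \<times> 'a"
          using cos_strip[OF that] by simp
      qed (use F m ghat in auto)
    qed simp
  qed
  then show ?thesis
    using killing conformal descends transverse_symmetry null flat by simp
qed

end
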